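(* Let $F_{28}:=(6,\{02,03,14,15,45\})$. Then $\lambda_{F_{28}}=15/64$. Furthermore, the $F_{28}$-problem is perfectly $B$-stable with $B:=(3,\{00,12\})$, and the unique (up to automorphisms of $B$) maximiser of $p(F_{28},B(\boldsymbol x))$ over $\boldsymbol x\in\mathbb S_3$ is $\boldsymbol x=(1/2,1/4,1/4)$.
   Context: All graphs are finite and simple. $(m,E)$ denotes the graph or pattern with vertex set $\{0,\dots,m-1\}$ and edge set $E$; $ij$ abbreviates $\{i,j\}$ ($ii$ is a loop). For graphs $F,G$ with $\kappa\le n$ vertices, $p(F,G)$ is the number of $\kappa$-subsets of $V(G)$ inducing a subgraph isomorphic to $F$, divided by $\binom n\kappa$; $p(F,n)$ is the maximum of $p(F,G)$ over $n$-vertex graphs $G$; $\lambda_F=\lim_{n\to\infty}p(F,n)$ (the limit exists). A pattern is a graph in which loops are allowed; its automorphisms are the bijections of the vertex set preserving edges, non-edges, loops and non-loops. For a pattern $B$ on $\{0,\dots,m-1\}$ and disjoint (possibly empty) sets $V_0,\dots,V_{m-1}$, the blowup $B(V_0,\dots,V_{m-1})$ is the simple graph on $\bigcup V_i$ in which distinct $x\in V_i$, $y\in V_j$ are adjacent iff $\{i,j\}\in E(B)$ (so $V_i$ is a clique if $i$ has a loop and independent otherwise); $B()$ is the family of all blowups. $\mathbb S_m=\{\boldsymbol x\in\mathbb R^m:x_i\ge0,\sum x_i=1\}$, and $p(F,B(\boldsymbol x))$ is the limit as $n\to\infty$ of $p(F,B(V_0,\dots,V_{m-1}))$ with $|V_i|=(x_i+o(1))n$.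 $\delta_{\mathrm{edit}}(G,B())$ is the minimum number of vertex pairs whose adjacency must be changed to turn $G$ into a graph isomorphic to a blowup of $B$ (of the same order). The $F$-problem is perfectly $B$-stable if there is $C>0$ such that every graph $G$ with $n\ge C$ vertices satisfies $\delta_{\mathrm{edit}}(G,B())\le C\,(p(F,n)-p(F,G))\,n^2$. *)

theory Defs
  imports Complex_Main "HOL-Library.Disjoint_Sets"
begin

text \<open>
  A pattern is a pair of a vertex set and a set of edges. The edge \<open>ij\<close> is the set \<open>{i, j}\<close>,
  so that a loop \<open>ii\<close> is the singleton \<open>{i}\<close>. Graphs are the finite loopless patterns.
\<close>

type_synonym 'a pattern = "'a set \<times> 'a set set"

abbreviation verts :: "'a pattern \<Rightarrow> 'a set" where
  "verts G \<equiv> fst G"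

abbreviation edges :: "'a pattern \<Rightarrow> 'a set set" where
  "edges G \<equiv> snd G"

definition simple_graph :: "'a pattern \<Rightarrow> bool" where
  "simple_graph G \<longleftrightarrow> finite (verts G) \<and> (\<forall>e\<in>edges G. e \<subseteq> verts G \<and> card e = 2)"

text \<open>The case \<open>x = y\<close> below expresses preservation of loops and non-loops.\<close>

definition isomorphism :: "'a pattern \<Rightarrow> 'b pattern \<Rightarrow> ('a \<Rightarrow> 'b) \<Rightarrow> bool" where
  "isomorphism G H f \<longleftrightarrow> bij_betw f (verts G) (verts H) \<and>
     (\<forall>x\<in>verts G. \<forall>y\<in>verts G. {x, y} \<in> edges G \<longleftrightarrow> {f x, f y} \<in> edges H)"

definition isomorphic :: "'a pattern \<Rightarrow> 'b pattern \<Rightarrow> bool" where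
  "isomorphic G H \<longleftrightarrow> (\<exists>f. isomorphism G H f)"

abbreviation automorphism :: "'a pattern \<Rightarrow> ('a \<Rightarrow> 'a) \<Rightarrow> bool" where
  "automorphism G \<equiv> isomorphism G G"

definition induced :: "'a pattern \<Rightarrow> 'a set \<Rightarrow> 'a pattern" where
  "induced G S = (S, {e \<in> edges G. e \<subseteq> S})"

definition ind_density :: "'a pattern \<Rightarrow> 'b pattern \<Rightarrow> real" where
  "ind_density F G =
     real (card {S. S \<subseteq> verts G \<and> card S = card (verts F) \<and> isomorphic (induced G S) F}) /
     real (card (verts G) choose card (verts F))"

text \<open>
  Every finite graph is isomorphic to one with vertices in \<^typ>\<open>nat\<close>, so it suffices to
  let host graphs range over those.
\<close>

definition max_density :: "'a pattern \<Rightarrow> nat \<Rightarrow> real" where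
  "max_density F n =
     Max {ind_density F G | G :: nat pattern. simple_graph G \<and> card (verts G) = n}"

definition blowup_parts :: "'b pattern \<Rightarrow> ('b \<Rightarrow> 'a set) \<Rightarrow> bool" where
  "blowup_parts B V \<longleftrightarrow> (\<forall>i\<in>verts B. finite (V i)) \<and> disjoint_family_on V (verts B)"

definition blowup :: "'b pattern \<Rightarrow> ('b \<Rightarrow> 'a set) \<Rightarrow> 'a pattern" where
  "blowup B V =
     (\<Union>i\<in>verts B. V i,
      {{x, y} | x y. x \<noteq> y \<and>
         (\<exists>i\<in>verts B. \<exists>j\<in>verts B. x \<in> V i \<and> y \<in> V j \<and> {i, j} \<in> edges B)})"

definition blowups :: "'b pattern \<Rightarrow> nat pattern set" where
  "blowups B = {blowup B V | V. blowup_parts B V}"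

definition edit_distance :: "nat pattern \<Rightarrow> 'b pattern \<Rightarrow> nat" where
  "edit_distance G B =
     Min {card ((edges G - edges H) \<union> (edges H - edges G)) | H.
            simple_graph H \<and> verts H = verts G \<and> (\<exists>H'\<in>blowups B. isomorphic H H')}"

definition perfectly_stable :: "'a pattern \<Rightarrow> 'b pattern \<Rightarrow> bool" where
  "perfectly_stable F B \<longleftrightarrow>
     (\<exists>C::real. C > 0 \<and>
       (\<forall>G :: nat pattern. simple_graph G \<and> real (card (verts G)) \<ge> C \<longrightarrow>
          real (edit_distance G B)
            \<le> C * (max_density F (card (verts G)) - ind_density F G) * real (card (verts G)) ^ 2))"

text \<open>Vectors in \<open>\<real>\<^sup>m\<close> are lists of length \<open>m\<close>, with coordinates indexed from 0.\<close>

definition std_simplex :: "nat \<Rightarrow> real list set" where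
  "std_simplex m = {x. length x = m \<and> (\<forall>i<m. x ! i \<ge> 0) \<and> (\<Sum>i<m. x ! i) = 1}"

text \<open>
  The common limit of the densities in all sequences of blowups whose part sizes are
  \<open>(x\<^sub>i + o(1)) n\<close>; here \<open>B\<close> is a pattern on \<open>{0, \<dots>, m - 1}\<close>. For \<open>x\<close> in the simplex there
  is such a sequence, so at most one \<open>L\<close> qualifies.
\<close>

definition blowup_density :: "'a pattern \<Rightarrow> nat pattern \<Rightarrow> real list \<Rightarrow> real" where
  "blowup_density F B x =
     (THE L. \<forall>V :: nat \<Rightarrow> nat \<Rightarrow> nat set.
        (\<forall>n. blowup_parts B (V n)) \<and>
        (\<forall>i\<in>verts B. (\<lambda>n. real (card (V n i)) / real n) \<longlonglongrightarrow> x ! i) \<longrightarrow>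
        (\<lambda>n. ind_density F (blowup B (V n))) \<longlonglongrightarrow> L)"

definition F28 :: "nat pattern" where
  "F28 = ({..<6}, {{0, 2}, {0, 3}, {1, 4}, {1, 5}, {4, 5}})"

definition B28 :: "nat pattern" where
  "B28 = ({..<3}, {{0, 0}, {1, 2}})"

end

theory Submission
  imports Defs "HOL-Library.FuncSet" "HOL-Combinatorics.Permutations"
begin

text \<open>
  A blowup of \<^const>\<open>B28\<close> is the disjoint union of a clique (part 0) and a complete bipartite graph
  (parts 1 and 2), and \<^const>\<open>F28\<close> is the disjoint union of a triangle and a path on three vertices.
  A copy of \<^const>\<open>F28\<close> in the blowup takes its triangle from the clique and its path from the
  bipartite graph. For part ratios \<open>x\<^sub>0, x\<^sub>1, x\<^sub>2\<close> the six-tuples of vertices that form such a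
  copy have density \<open>x\<^sub>0\<^sup>3 x\<^sub>1 x\<^sub>2 (x\<^sub>1 + x\<^sub>2)\<close>. With \<open>P = x\<^sub>0 (x\<^sub>1 + x\<^sub>2)\<close> this is \<open>(P\<^sup>3 - P
  x\<^sub>0\<^sup>2 (x\<^sub>1 - x\<^sub>2)\<^sup>2) / 4\<close>, so its maximum is \<open>1 / 256\<close>, attained only at \<open>(1/2, 1/4, 1/4)\<close>.
  As \<^const>\<open>F28\<close> has 12 automorphisms, the density of copies is \<open>720 / 12 = 60\<close> times as large,
  which gives \<open>15 / 64\<close>.

  The upper bound is a flag algebra argument. A form on six vertices (\<open>flag_form\<close>) is written
  as a sum of squares plus \<open>2048\<close> times indicators of copies of \<^const>\<open>F28\<close>. Averaged over the 45
  ways of assigning roles to the six vertices it is at most \<open>2880 / 45 = 64\<close> on every graph on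
  six vertices (\<open>split_sum_le\<close>, a finite check). This proves \<open>256 F \<le> n\<^sup>6\<close>, where \<open>F\<close> counts
  the tuples that form a copy. The sums range over all maps from six positions to the vertices,
  repetitions included, vertices carry weights and loops are allowed. There is then no lower
  order error term: for the optimal weights on a blowup of \<^const>\<open>B28\<close>, with loops in part 0, both
  sides agree.

  The inequality has slack (\<open>flag_inequality\<close>): four roots that look like one vertex of part 0,
  one of part 1 and two of part 2 predict to which part every other vertex belongs, and every
  pair of vertices that contradicts this prediction lies in a bad tuple, for which the sum over
  the 45 ways is at most \<open>2824\<close> instead of \<open>2880\<close>.

  Stability follows in three steps. A graph close to the optimum has a root quadruple with few
  bad tuples, and the prediction by these roots is a partition with few wrong pairs
  (\<open>near_extremal_classes\<close>). For a partition with the least number \<open>w\<close> of wrong pairs, the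
  wrong pairs produce at least \<open>c w n\<^sup>4\<close> bad tuples (\<open>bad_count_ge\<close>): a wrong pair of two
  vertices with few wrong pairs is seen by most roots, and a vertex with many wrong pairs
  contradicts every part in which it could be put. Finally the parts have nearly optimal sizes,
  so that a slight change of the vertex weights makes the flag inequality exact on the blowup.
  The graph then has at least \<open>c' w n\<^sup>4\<close> fewer copies than the blowup on the same parts
  (\<open>blowup_count_ge\<close>). Since the blowup is itself a graph on \<open>n\<close> vertices, \<open>w / n\<^sup>2\<close> is at most
  a constant times the deficit in density, and \<open>w\<close> bounds the edit distance.
\<close>

section \<open>Weighted sums over six-tuples\<close>

text \<open>
  The vertex weights \<open>m\<close> multiply along the tuple. The maps in \<open>{..<6} \<rightarrow>\<^sub>E V\<close> need not be
  injective; that is what makes the total mass exactly \<open>(\<Sum>v\<in>V. m v)\<^sup>6\<close>.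
\<close>

definition tsum :: "'v set \<Rightarrow> ('v \<Rightarrow> real) \<Rightarrow> ((nat \<Rightarrow> 'v) \<Rightarrow> real) \<Rightarrow> real" where
  "tsum V m F = (\<Sum>\<phi>\<in>{..<6} \<rightarrow>\<^sub>E V. (\<Prod>i<6. m (\<phi> i)) * F \<phi>)"

lemma bij_betw_comp_PiE:
  assumes "\<pi> permutes I"
  shows "bij_betw (\<lambda>\<phi>. \<phi> \<circ> \<pi>) (I \<rightarrow>\<^sub>E V) (I \<rightarrow>\<^sub>E V)"
proof (rule bij_betwI[where g = "\<lambda>\<phi>. \<phi> \<circ> inv \<pi>"])
  have *: "\<phi> \<circ> p \<in> I \<rightarrow>\<^sub>E V" if "\<phi> \<in> I \<rightarrow>\<^sub>E V" "p permutes I" for \<phi> p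
    using that permutes_in_image[of p I] permutes_not_in[of p I]
    by (auto simp: PiE_def extensional_def Pi_def)
  show "(\<lambda>\<phi>. \<phi> \<circ> \<pi>) \<in> (I \<rightarrow>\<^sub>E V) \<rightarrow> (I \<rightarrow>\<^sub>E V)" using * assms by auto
  show "(\<lambda>\<phi>. \<phi> \<circ> inv \<pi>) \<in> (I \<rightarrow>\<^sub>E V) \<rightarrow> (I \<rightarrow>\<^sub>E V)" using * permutes_inv[OF assms] by auto
qed (use permutes_inv_o[OF assms] in \<open>auto simp: comp_assoc\<close>)

lemma tsum_permute:
  assumes "\<pi> permutes {..<6}"
  shows "tsum V m (\<lambda>\<phi>. F (\<phi> \<circ> \<pi>)) = tsum V m F"
proof -
  have "tsum V m (\<lambda>\<phi>. F (\<phi> \<circ> \<pi>)) = (\<Sum>\<phi>\<in>{..<6} \<rightarrow>\<^sub>E V. (\<Prod>i<6. m ((\<phi> \<circ> \<pi>) i)) * F (\<phi> \<circ> \<pi>))"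
    unfolding tsum_def using prod.permute[OF assms, of "\<lambda>i. m (_ i)"] by (simp add: comp_def)
  also have "\<dots> = tsum V m F"
    unfolding tsum_def by (rule sum.reindex_bij_betw[OF bij_betw_comp_PiE[OF assms]])
  finally show ?thesis .
qed

text \<open>
  The summation variables may be renamed, so a summand matters only up to the order of the six
  positions.
\<close>

lemma tsum_index:
  fixes a b c d e f :: nat
  assumes "distinct [a, b, c, d, e, f]" "{a, b, c, d, e, f} \<subseteq> {..<6}"
  shows "tsum V m (\<lambda>\<phi>. G (\<phi> a) (\<phi> b) (\<phi> c) (\<phi> d) (\<phi> e) (\<phi> f))
       = tsum V m (\<lambda>\<phi>. G (\<phi> 0) (\<phi> 1) (\<phi> 2) (\<phi> 3) (\<phi> 4) (\<phi> 5))"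
proof -
  let ?t = "[a, b, c, d, e, f]"
  define \<pi> where "\<pi> i = (if i < 6 then ?t ! i else i)" for i
  have "inj_on \<pi> {..<6}"
    using nth_eq_iff_index_eq[OF assms(1)] by (auto simp: \<pi>_def inj_on_def)
  moreover have "\<pi> ` {..<6} \<subseteq> {..<6}"
  proof -
    have "?t ! i \<in> {a, b, c, d, e, f}" if "i < 6" for i
      using that nth_mem[of i ?t] by simp
    hence "?t ! i \<in> {..<6}" if "i < 6" for i
      using that assms(2) by blast
    thus ?thesis unfolding \<pi>_def by auto
  qed
  ultimately have "bij_betw \<pi> {..<6} {..<6}"
    by (metis bij_betw_def endo_inj_surj finite_lessThan)
  hence "\<pi> permutes {..<6}" by (rule bij_imp_permutes) (simp add: \<pi>_def)
  from tsum_permute[OF this, of V m "\<lambda>\<phi>. G (\<phi> 0) (\<phi> 1) (\<phi> 2) (\<phi> 3) (\<phi> 4) (\<phi> 5)"]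
  show ?thesis by (simp add: \<pi>_def)
qed

lemma sum_PiE_Suc:
  "(\<Sum>\<phi>\<in>{..<Suc k} \<rightarrow>\<^sub>E V. F \<phi>) = (\<Sum>\<phi>\<in>{..<k} \<rightarrow>\<^sub>E V. \<Sum>v\<in>V. F (\<phi>(k := v)))"
proof -
  have "{..<Suc k} \<rightarrow>\<^sub>E V = (\<lambda>(v, \<phi>). \<phi>(k := v)) ` (V \<times> ({..<k} \<rightarrow>\<^sub>E V))"
    by (simp add: lessThan_Suc PiE_insert_eq)
  moreover have "inj_on (\<lambda>(v, \<phi>). \<phi>(k := v)) (V \<times> ({..<k} \<rightarrow>\<^sub>E V))"
    by (rule inj_combinator) simp
  ultimately show ?thesis
    by (simp add: sum.reindex sum.cartesian_product' case_prod_unfold sum.swap[of _ V])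
qed

lemma tsum_nested:
  "tsum V m (\<lambda>\<phi>. G (\<phi> 0) (\<phi> 1) (\<phi> 2) (\<phi> 3) (\<phi> 4) (\<phi> 5))
   = (\<Sum>a\<in>V. \<Sum>b\<in>V. \<Sum>c\<in>V. \<Sum>d\<in>V. \<Sum>e\<in>V. \<Sum>f\<in>V.
        m a * m b * m c * m d * m e * m f * G a b c d e f)"
proof -
  have 6: "{..<6::nat} = {..<Suc (Suc (Suc (Suc (Suc (Suc 0)))))}" by auto
  show ?thesis
    unfolding tsum_def unfolding 6 sum_PiE_Suc
    by (simp add: lessThan_0 numeral_eq_Suc lessThan_Suc mult_ac)
qed

lemma tsum_mono:
  assumes "\<And>v. v \<in> V \<Longrightarrow> m v \<ge> 0" "\<And>\<phi>. \<phi> \<in> {..<6} \<rightarrow>\<^sub>E V \<Longrightarrow> F \<phi> \<le> G \<phi>"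
  shows "tsum V m F \<le> tsum V m G"
  unfolding tsum_def using assms
  by (intro sum_mono mult_left_mono prod_nonneg) (auto simp: PiE_def Pi_def)

lemma tsum_add: "tsum V m (\<lambda>\<phi>. F \<phi> + G \<phi>) = tsum V m F + tsum V m G"
  by (simp add: tsum_def sum.distrib ring_distribs)

lemma tsum_diff: "tsum V m (\<lambda>\<phi>. F \<phi> - G \<phi>) = tsum V m F - tsum V m G"
  by (simp add: tsum_def sum_subtractf ring_distribs)

lemma tsum_cmult: "tsum V m (\<lambda>\<phi>. c * F \<phi>) = c * tsum V m F"
  by (simp add: tsum_def sum_distrib_left mult_ac)

lemma tsum_const: assumes "finite V" shows "tsum V m (\<lambda>_. c) = c * (\<Sum>v\<in>V. m v) ^ 6"
proof -
  have "tsum V m (\<lambda>_. c) = c * (\<Sum>\<phi>\<in>{..<6::nat} \<rightarrow>\<^sub>E V. \<Prod>i<6. m (\<phi> i))"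
    by (simp add: tsum_def sum_distrib_left mult_ac)
  also have "(\<Sum>\<phi>\<in>{..<6::nat} \<rightarrow>\<^sub>E V. \<Prod>i<6. m (\<phi> i)) = (\<Prod>i<6::nat. \<Sum>v\<in>V. m v)"
    using prod_sum_PiE[of "{..<6::nat}" "\<lambda>_. V" "\<lambda>_. m"] assms by simp
  finally show ?thesis by simp
qed

section \<open>The flag algebra certificate and its finite check\<close>

text \<open>
  How one vertex is joined to an ordered pair of vertices.
\<close>

datatype link = NoLink | LinkL | LinkR | LinkLR

definition link :: "bool \<Rightarrow> bool \<Rightarrow> link" where
  "link p q = (if p then if q then LinkLR else LinkL else if q then LinkR else NoLink)"

text \<open>
  In the flags with two roots \<open>a, b\<close>, the unordered pair of other vertices \<open>c, d\<close> is described
  by the links of \<open>c\<close> and of \<open>d\<close> to \<open>(a, b)\<close> and by the adjacency of \<open>c\<close> and \<open>d\<close>. For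
  non-adjacent roots \<open>S1, \<dots>, S9\<close> are the nine orbits, under exchange of the roots, of the flags
  with nonzero coefficient; all other flags are merged into \<open>S0\<close>.
\<close>

datatype sflag = S1 | S2 | S3 | S4 | S5 | S6 | S7 | S8 | S9 | S0

definition sflag :: "link \<Rightarrow> link \<Rightarrow> bool \<Rightarrow> sflag" where
  "sflag s t e =
     (case s of
        NoLink \<Rightarrow> (case t of NoLink \<Rightarrow> if e then S2 else S1 | LinkL \<Rightarrow> if e then S4 else S3
                   | LinkR \<Rightarrow> if e then S4 else S3 | LinkLR \<Rightarrow> if e then S6 else S5)
      | LinkL \<Rightarrow> (case t of NoLink \<Rightarrow> if e then S4 else S3 | LinkL \<Rightarrow> S0
                   | LinkR \<Rightarrow> if e then S0 else S7 | LinkLR \<Rightarrow> S0)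
      | LinkR \<Rightarrow> (case t of NoLink \<Rightarrow> if e then S4 else S3 | LinkL \<Rightarrow> if e then S0 else S7
                   | LinkR \<Rightarrow> S0 | LinkLR \<Rightarrow> S0)
      | LinkLR \<Rightarrow> (case t of NoLink \<Rightarrow> if e then S6 else S5 | LinkL \<Rightarrow> S0
                   | LinkR \<Rightarrow> S0 | LinkLR \<Rightarrow> if e then S9 else S8))"

text \<open>
  The Gram matrix of the part of the quadratic form that is invariant under exchange of the
  roots; \<open>sforms\<close> below diagonalises it.
\<close>

fun sgram :: "sflag \<Rightarrow> sflag \<Rightarrow> int" where
  "sgram S1 = case_sflag 64 (-160) 96 (-64) 128 (-32) (-80) (-128) (-80) 0"
| "sgram S2 = case_sflag (-160) 1984 (-240) 544 (-1536) (-288) 8 (-416) 328 0"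
| "sgram S3 = case_sflag 96 (-240) 172 (-124) 192 (-48) (-134) (-192) (-92) 0"
| "sgram S4 = case_sflag (-64) 544 (-124) 224 (-416) (-64) 28 (-64) 100 0"
| "sgram S5 = case_sflag 128 (-1536) 192 (-416) 1216 192 (-16) 256 (-288) 0"
| "sgram S6 = case_sflag (-32) (-288) (-48) (-64) 192 128 88 288 40 0"
| "sgram S7 = case_sflag (-80) 8 (-134) 28 (-16) 88 140 256 62 0"
| "sgram S8 = case_sflag (-128) (-416) (-192) (-64) 256 288 256 704 160 0"
| "sgram S9 = case_sflag (-80) 328 (-92) 100 (-288) 40 62 160 192 0"
| "sgram S0 = (\<lambda>_. 0)"

text \<open>
  Flags that differ from their mirror image under exchange of the roots: \<open>M1, M2, M3\<close> are the
  mirror images of \<open>P1, P2, P3\<close>, and all remaining flags, among them all symmetric ones, become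
  \<open>A0\<close>. Forms in the differences \<open>Pi - Mi\<close> give the antisymmetric part.
\<close>

datatype aflag = P1 | M1 | P2 | M2 | P3 | M3 | A0

definition aflag :: "link \<Rightarrow> link \<Rightarrow> bool \<Rightarrow> aflag" where
  "aflag s t e =
     (case s of
        NoLink \<Rightarrow> (case t of NoLink \<Rightarrow> A0 | LinkL \<Rightarrow> if e then A0 else M1
                   | LinkR \<Rightarrow> if e then A0 else P1 | LinkLR \<Rightarrow> A0)
      | LinkL \<Rightarrow> (case t of NoLink \<Rightarrow> if e then A0 else M1 | LinkL \<Rightarrow> if e then M3 else M2
                   | LinkR \<Rightarrow> A0 | LinkLR \<Rightarrow> A0)
      | LinkR \<Rightarrow> (case t of NoLink \<Rightarrow> if e then A0 else P1 | LinkL \<Rightarrow> A0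
                   | LinkR \<Rightarrow> if e then P3 else P2 | LinkLR \<Rightarrow> A0)
      | LinkLR \<Rightarrow> A0)"

fun agram :: "aflag \<Rightarrow> aflag \<Rightarrow> int" where
  "agram P1 = case_aflag 132 (-132) (-240) 240 (-192) 192 0"
| "agram M1 = case_aflag (-132) 132 240 (-240) 192 (-192) 0"
| "agram P2 = case_aflag (-240) 240 1088 (-1088) 512 (-512) 0"
| "agram M2 = case_aflag 240 (-240) (-1088) 1088 (-512) 512 0"
| "agram P3 = case_aflag (-192) 192 512 (-512) 320 (-320) 0"
| "agram M3 = case_aflag 192 (-192) (-512) 512 (-320) 320 0"
| "agram A0 = (\<lambda>_. 0)"

text \<open>
  The flags over two adjacent roots. Here \<open>E1, E2, E3\<close> are symmetric in the roots, \<open>EMi\<close> is the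
  mirror image of \<open>EPi\<close>, and one Gram matrix carries both parts.
\<close>

datatype eflag = E1 | E2 | E3 | EP1 | EM1 | EP2 | EM2 | EP3 | EM3 | E0

definition eflag :: "link \<Rightarrow> link \<Rightarrow> bool \<Rightarrow> eflag" where
  "eflag s t e =
     (case s of
        NoLink \<Rightarrow> (case t of NoLink \<Rightarrow> if e then E0 else E1 | LinkL \<Rightarrow> if e then E0 else EM1
                   | LinkR \<Rightarrow> if e then E0 else EP1 | LinkLR \<Rightarrow> if e then E0 else E2)
      | LinkL \<Rightarrow> (case t of NoLink \<Rightarrow> if e then E0 else EM1 | LinkL \<Rightarrow> if e then E0 else EM3
                   | LinkR \<Rightarrow> E0 | LinkLR \<Rightarrow> EM2)
      | LinkR \<Rightarrow> (case t of NoLink \<Rightarrow> if e then E0 else EP1 | LinkL \<Rightarrow> E0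
                   | LinkR \<Rightarrow> if e then E0 else EP3 | LinkLR \<Rightarrow> EP2)
      | LinkLR \<Rightarrow> (case t of NoLink \<Rightarrow> if e then E0 else E2 | LinkL \<Rightarrow> EM2
                   | LinkR \<Rightarrow> EP2 | LinkLR \<Rightarrow> if e then E3 else E0))"

fun egram :: "eflag \<Rightarrow> eflag \<Rightarrow> int" where
  "egram E1 = case_eflag 256 (-128) 128 0 0 0 0 0 0 0"
| "egram E2 = case_eflag (-128) 64 (-64) 0 0 0 0 0 0 0"
| "egram E3 = case_eflag 128 (-64) 64 0 0 0 0 0 0 0"
| "egram EP1 = case_eflag 0 0 0 648 (-648) (-216) 216 0 0 0"
| "egram EM1 = case_eflag 0 0 0 (-648) 648 216 (-216) 0 0 0"
| "egram EP2 = case_eflag 0 0 0 (-216) 216 72 (-72) 0 0 0"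
| "egram EM2 = case_eflag 0 0 0 216 (-216) (-72) 72 0 0 0"
| "egram EP3 = case_eflag 0 0 0 0 0 0 0 256 (-256) 0"
| "egram EM3 = case_eflag 0 0 0 0 0 0 0 (-256) 256 0"
| "egram E0 = (\<lambda>_. 0)"

text \<open>
  The flags over four roots \<open>c, d, e, f\<close> that span exactly the two edges \<open>cd\<close> and \<open>ef\<close>, with
  one further vertex. In \<open>T1\<close> it forms a triangle with \<open>cd\<close> and is not adjacent to \<open>ef\<close>, in
  \<open>C1\<close> it is adjacent to exactly one of \<open>c, d\<close>, which gives a path on three vertices, and to
  neither of \<open>e, f\<close>; \<open>T2\<close> and \<open>C2\<close> exchange the two edges.
\<close>

datatype kflag = T1 | T2 | C1 | C2 | K0

definition kflag :: "link \<Rightarrow> link \<Rightarrow> kflag" where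
  "kflag s t =
     (case s of
        NoLink \<Rightarrow> (case t of NoLink \<Rightarrow> K0 | LinkL \<Rightarrow> C2 | LinkR \<Rightarrow> C2 | LinkLR \<Rightarrow> T2)
      | LinkL \<Rightarrow> (case t of NoLink \<Rightarrow> C1 | LinkL \<Rightarrow> K0 | LinkR \<Rightarrow> K0 | LinkLR \<Rightarrow> K0)
      | LinkR \<Rightarrow> (case t of NoLink \<Rightarrow> C1 | LinkL \<Rightarrow> K0 | LinkR \<Rightarrow> K0 | LinkLR \<Rightarrow> K0)
      | LinkLR \<Rightarrow> (case t of NoLink \<Rightarrow> T1 | LinkL \<Rightarrow> K0 | LinkR \<Rightarrow> K0 | LinkLR \<Rightarrow> K0))"

text \<open>
  The matrix of \<open>352 (C - T)\<^sup>2\<close>, with \<open>T\<close> and \<open>C\<close> the numbers of triangles and of paths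
  attached to the two root edges, increased by \<open>2048\<close> for a triangle on one edge and a path on
  the other whose new vertices are not adjacent, since these six vertices form a copy of
  \<^const>\<open>F28\<close>.
\<close>

fun kgram :: "kflag \<Rightarrow> kflag \<Rightarrow> bool \<Rightarrow> int" where
  "kgram T1 = case_kflag (\<lambda>_. 352) (\<lambda>_. 352) (\<lambda>_. -352) (\<lambda>e. if e then -352 else 1696) (\<lambda>_. 0)"
| "kgram T2 = case_kflag (\<lambda>_. 352) (\<lambda>_. 352) (\<lambda>e. if e then -352 else 1696) (\<lambda>_. -352) (\<lambda>_. 0)"
| "kgram C1 = case_kflag (\<lambda>_. -352) (\<lambda>e. if e then -352 else 1696) (\<lambda>_. 352) (\<lambda>_. 352) (\<lambda>_. 0)"
| "kgram C2 = case_kflag (\<lambda>e. if e then -352 else 1696) (\<lambda>_. -352) (\<lambda>_. 352) (\<lambda>_. 352) (\<lambda>_. 0)"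
| "kgram K0 = (\<lambda>_ _. 0)"

text \<open>
  The contribution of a tuple in which \<open>a, b\<close> are the roots of the forms with two roots and \<open>c,
  d\<close> and \<open>e, f\<close> are the two flags; \<open>c, d, e, f\<close> are also the roots of the form with four roots,
  whose two flags are \<open>a\<close> and \<open>b\<close>. The arguments are the 15 adjacencies, which makes exhaustive
  evaluation possible.
\<close>

definition flag_form :: "bool \<Rightarrow> bool \<Rightarrow> bool \<Rightarrow> bool \<Rightarrow> bool \<Rightarrow> bool \<Rightarrow> bool \<Rightarrow> bool \<Rightarrow> bool \<Rightarrow> bool \<Rightarrow> bool \<Rightarrow> bool \<Rightarrow> bool \<Rightarrow> bool \<Rightarrow> bool \<Rightarrow> int"
  where
  "flag_form ab ac ad ae af bc bd be bf cd ce cf de df ef =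
     (if cd then if ef then if ce then 0 else if cf then 0 else if de then 0 else if df then 0
        else kgram (kflag (link ac ad) (link ae af)) (kflag (link bc bd) (link be bf)) ab
      else 0 else 0)
     + (if ab then egram (eflag (link ac bc) (link ad bd) cd) (eflag (link ae be) (link af bf) ef)
        else sgram (sflag (link ac bc) (link ad bd) cd) (sflag (link ae be) (link af bf) ef)
           + agram (aflag (link ac bc) (link ad bd) cd) (aflag (link ae be) (link af bf) ef))"

definition flag_form_at :: "('a \<Rightarrow> 'a \<Rightarrow> bool) \<Rightarrow> 'a \<Rightarrow> 'a \<Rightarrow> 'a \<Rightarrow> 'a \<Rightarrow> 'a \<Rightarrow> 'a \<Rightarrow> int" where
  "flag_form_at A a b c d e f = flag_form (A a b) (A a c) (A a d) (A a e) (A a f) (A b c) (A b d) (A b e) (A b f) (A c d) (A c e) (A c f) (A d e) (A d f) (A e f)"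

text \<open>
  Each summand is the choice of a pair for the first two positions and of a split of the
  remaining four vertices into two pairs. By the symmetries of the flag form these 45 orders
  represent all 720.
\<close>

definition split_sum :: "('a \<Rightarrow> 'a \<Rightarrow> 'a \<Rightarrow> 'a \<Rightarrow> 'a \<Rightarrow> 'a \<Rightarrow> int) \<Rightarrow> 'a \<Rightarrow> 'a \<Rightarrow> 'a \<Rightarrow> 'a \<Rightarrow> 'a \<Rightarrow> 'a \<Rightarrow> int" where
  "split_sum T a b c d e f =
       T a b c d e f + T a b c e d f + T a b c f d e
     + T a c b d e f + T a c b e d f + T a c b f d e
     + T a d b c e f + T a d b e c f + T a d b f c e
     + T a e b c d f + T a e b d c f + T a e b f c d
     + T a f b c d e + T a f b d c e + T a f b e c d
     + T b c a d e f + T b c a e d f + T b c a f d e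
     + T b d a c e f + T b d a e c f + T b d a f c e
     + T b e a c d f + T b e a d c f + T b e a f c d
     + T b f a c d e + T b f a d c e + T b f a e c d
     + T c d a b e f + T c d a e b f + T c d a f b e
     + T c e a b d f + T c e a d b f + T c e a f b d
     + T c f a b d e + T c f a d b e + T c f a e b d
     + T d e a b c f + T d e a c b f + T d e a f b c
     + T d f a b c e + T d f a c b e + T d f a e b c
     + T e f a b c d + T e f a c b d + T e f a d b c"

definition rel6 :: "bool \<Rightarrow> bool \<Rightarrow> bool \<Rightarrow> bool \<Rightarrow> bool \<Rightarrow> bool \<Rightarrow> bool \<Rightarrow> bool \<Rightarrow> bool \<Rightarrow> bool \<Rightarrow> bool \<Rightarrow> bool \<Rightarrow> bool \<Rightarrow> bool \<Rightarrow> bool \<Rightarrow>  nat \<Rightarrow> nat \<Rightarrow> bool" where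
  "rel6 ab ac ad ae af bc bd be bf cd ce cf de df ef i j =
     [[False, ab, ac, ad, ae, af], [ab, False, bc, bd, be, bf], [ac, bc, False, cd, ce, cf],
      [ad, bd, cd, False, de, df], [ae, be, ce, de, False, ef], [af, bf, cf, df, ef, False]] ! i ! j"

definition split_sum_bits :: "bool \<Rightarrow> bool \<Rightarrow> bool \<Rightarrow> bool \<Rightarrow> bool \<Rightarrow> bool \<Rightarrow> bool \<Rightarrow> bool \<Rightarrow> bool \<Rightarrow> bool \<Rightarrow> bool \<Rightarrow> bool \<Rightarrow> bool \<Rightarrow> bool \<Rightarrow> bool \<Rightarrow> int" where
  "split_sum_bits ab ac ad ae af bc bd be bf cd ce cf de df ef = split_sum (flag_form_at (rel6 ab ac ad ae af bc bd be bf cd ce cf de df ef)) 0 1 2 3 4 5"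

text \<open>
  A code equation in which the list lookups have been evaluated. Only table lookups remain for
  the exhaustive check.
\<close>

lemmas split_sum_bits_eq [code] =
  split_sum_bits_def [unfolded split_sum_def flag_form_at_def rel6_def, simplified One_nat_def numeral_eq_Suc
    Num.pred_numeral_simps BitM.simps numeral_One nth_Cons_Suc nth_Cons_0]

text \<open>
  Nested successors let the evaluation compare degrees without arithmetic on numerals.
\<close>

fun count4 :: "bool \<Rightarrow> bool \<Rightarrow> bool \<Rightarrow> bool \<Rightarrow> nat" where
  "count4 p q r s = (if p then Suc else id) ((if q then Suc else id) ((if r then Suc else id) (if s then Suc 0 else 0)))"

text \<open>
  The conjunction of \<open>P\<close> over all extensions of \<open>xs\<close> by \<open>n\<close> bits, evaluated depth first, so
  that the checks below can cut off a branch as soon as its first bits are known.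
\<close>

fun all_bools :: "nat \<Rightarrow> (bool list \<Rightarrow> bool) \<Rightarrow> bool list \<Rightarrow> bool" where
  "all_bools 0 P xs = P xs"
| "all_bools (Suc n) P xs = (all_bools n P (True # xs) \<and> all_bools n P (False # xs))"

text \<open>
  The sum over all splits is invariant under permutations of the six vertices. It is therefore
  enough to treat graphs whose vertex degrees are nondecreasing. For consecutive vertices the
  degrees are compared without their common adjacency, as soon as the bits that determine them
  are present; this cuts the \<open>2\<^sup>15\<close> cases down considerably.
\<close>

fun check4 :: "bool list \<Rightarrow> bool" where
  "check4 [ef, df, de, cf, ce, cd, bf, be, bd, bc, af, ae, ad, ac, ab] = (if count4 ad bd cd df \<le> count4 ae be ce ef then if count4 ae be ce de \<le> count4 af bf cf df then
     split_sum_bits ab ac ad ae af bc bd be bf cd ce cf de df ef \<le> 2880 else True else True)"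
| "check4 _ = True"
fun check3 :: "bool list \<Rightarrow> bool" where
  "check3 [df, de, cf, ce, cd, bf, be, bd, bc, af, ae, ad, ac, ab] = (if count4 ac bc ce cf \<le> count4 ad bd de df then all_bools 1 check4 [df, de, cf, ce, cd, bf, be, bd, bc, af, ae, ad, ac, ab] else True)"
| "check3 _ = True"
fun check2 :: "bool list \<Rightarrow> bool" where
  "check2 [cf, ce, cd, bf, be, bd, bc, af, ae, ad, ac, ab] = (if count4 ab bd be bf \<le> count4 ac cd ce cf then all_bools 2 check3 [cf, ce, cd, bf, be, bd, bc, af, ae, ad, ac, ab] else True)"
| "check2 _ = True"
fun check1 :: "bool list \<Rightarrow> bool" where
  "check1 [bf, be, bd, bc, af, ae, ad, ac, ab] = (if count4 ac ad ae af \<le> count4 bc bd be bf then all_bools 3 check2 [bf, be, bd, bc, af, ae, ad, ac, ab] else True)"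
| "check1 _ = True"

lemma all_graphs_checked: "all_bools 9 check1 []"
  by code_simp

section \<open>The certificate as a sum of squares\<close>

text \<open>
  A positive semidefinite integer matrix, witnessed by a diagonalisation with nonnegative
  weights \<open>w\<close> and linear forms \<open>l\<close>.
\<close>

definition pos_kernel :: "('k \<Rightarrow> 'k \<Rightarrow> int) \<Rightarrow> bool" where
  "pos_kernel k \<longleftrightarrow> (\<exists>ws. list_all (\<lambda>(w, l). w \<ge> 0) ws \<and> (\<forall>s t. k s t = (\<Sum>(w, l)\<leftarrow>ws. w * l s * l t)))"

lemma pos_kernelI:
  assumes "list_all (\<lambda>(w, l). w \<ge> 0) ws"
    and "\<And>s t. k s t = (\<Sum>(w, l)\<leftarrow>ws. w * l s * l t)"
  shows "pos_kernel k"
  unfolding pos_kernel_def using assms by (intro exI[of _ ws]) auto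

text \<open>
  The double sum is \<open>\<Sum>w (\<Sum>p \<mu> p l (g p))\<^sup>2\<close>.
\<close>

lemma pos_kernel_sum_nonneg:
  fixes \<mu> :: "'p \<Rightarrow> real"
  assumes "pos_kernel k"
  shows "0 \<le> (\<Sum>p\<in>P. \<Sum>q\<in>P. \<mu> p * \<mu> q * of_int (k (g p) (g q)))"
proof -
  obtain ws where "list_all (\<lambda>(w, l). w \<ge> 0) ws"
    and k: "\<And>s t. k s t = (\<Sum>(w, l)\<leftarrow>ws. w * l s * l t)"
    using assms unfolding pos_kernel_def by blast
  hence ws: "w \<ge> 0" if "(w, l) \<in> set ws" for w l using that by (auto simp: list_all_iff)
  have "(\<Sum>p\<in>P. \<Sum>q\<in>P. \<mu> p * \<mu> q * of_int (\<Sum>(w, l)\<leftarrow>vs. w * l (g p) * l (g q))) \<ge> 0"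
    if "set vs \<subseteq> set ws" for vs
    using that
  proof (induction vs)
    case (Cons v vs)
    obtain w l where v: "v = (w, l)" by force
    have "(\<Sum>p\<in>P. \<Sum>q\<in>P. \<mu> p * \<mu> q * of_int (\<Sum>(w, l)\<leftarrow>v # vs. w * l (g p) * l (g q)))
       = of_int w * (\<Sum>p\<in>P. \<mu> p * of_int (l (g p))) ^ 2
         + (\<Sum>p\<in>P. \<Sum>q\<in>P. \<mu> p * \<mu> q * of_int (\<Sum>(w, l)\<leftarrow>vs. w * l (g p) * l (g q)))"
      by (simp add: v power2_eq_square sum_product sum_distrib_left ring_distribs sum.distrib mult_ac)
    moreover have "w \<ge> 0" using Cons.prems ws v by auto
    ultimately show ?case using Cons by simp
  qed simp
  from this[of ws] show ?thesis by (simp add: k)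
qed

text \<open>
  Since the flag inequality is an equality on the optimal blowup, every form must vanish there:
  for any two non-adjacent roots in the blowup with ratios \<open>1/2, 1/4, 1/4\<close>, each linear form
  has mean 0 over the pairs \<open>(c, d)\<close>. The same holds for the antisymmetric forms, and over
  adjacent roots for \<open>eforms\<close>.
\<close>

definition sforms :: "(int \<times> (sflag \<Rightarrow> int)) list" where
  "sforms =
    [(4, case_sflag (-4) 10 (-6) 4 (-8) 2 5 8 5 0), (7, case_sflag 0 0 2 (-2) 0 0 (-1) 0 2 0),
     (1, case_sflag 0 16 0 6 (-16) 0 (-3) 0 8 0), (24, case_sflag 0 6 0 2 (-4) (-2) (-1) (-4) 0 0),
     (16, case_sflag 0 5 0 0 (-4) (-1) 0 (-2) 0 0), (64, case_sflag 0 1 0 0 (-1) 0 0 0 0 0)]"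

lemma sgram_eq:
  "\<forall>s \<in> set [S1, S2, S3, S4, S5, S6, S7, S8, S9, S0]. \<forall>t \<in> set [S1, S2, S3, S4, S5, S6, S7, S8, S9, S0].
     sgram s t = (\<Sum>(w, l)\<leftarrow>sforms. w * l s * l t)"
  by code_simp

lemma pos_kernel_sgram: "pos_kernel sgram"
proof (rule pos_kernelI[of sforms])
  show "list_all (\<lambda>(w, l). 0 \<le> w) sforms" by code_simp
  have "s \<in> set [S1, S2, S3, S4, S5, S6, S7, S8, S9, S0]" for s by (cases s) simp_all
  thus "sgram s t = (\<Sum>(w, l)\<leftarrow>sforms. w * l s * l t)" for s t
    by (intro sgram_eq[THEN bspec, THEN bspec])
qed

definition aforms :: "(int \<times> (aflag \<Rightarrow> int)) list" where
  "aforms =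
    [(64, case_aflag (-1) 1 4 (-4) 2 (-2) 0), (64, case_aflag (-1) 1 0 0 1 (-1) 0),
     (4, case_aflag 1 (-1) 4 (-4) 0 0 0)]"

lemma agram_eq:
  "\<forall>s \<in> set [P1, M1, P2, M2, P3, M3, A0]. \<forall>t \<in> set [P1, M1, P2, M2, P3, M3, A0].
     agram s t = (\<Sum>(w, l)\<leftarrow>aforms. w * l s * l t)"
  by code_simp

lemma pos_kernel_agram: "pos_kernel agram"
proof (rule pos_kernelI[of aforms])
  show "list_all (\<lambda>(w, l). 0 \<le> w) aforms" by code_simp
  have "s \<in> set [P1, M1, P2, M2, P3, M3, A0]" for s by (cases s) simp_all
  thus "agram s t = (\<Sum>(w, l)\<leftarrow>aforms. w * l s * l t)" for s t
    by (intro agram_eq[THEN bspec, THEN bspec])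
qed

definition eforms :: "(int \<times> (eflag \<Rightarrow> int)) list" where
  "eforms =
    [(64, case_eflag 2 (-1) 1 0 0 0 0 0 0 0), (72, case_eflag 0 0 0 3 (-3) (-1) 1 0 0 0),
     (256, case_eflag 0 0 0 0 0 0 0 1 (-1) 0)]"

lemma egram_eq:
  "\<forall>s \<in> set [E1, E2, E3, EP1, EM1, EP2, EM2, EP3, EM3, E0]. \<forall>t \<in> set [E1, E2, E3, EP1, EM1, EP2, EM2, EP3, EM3, E0].
     egram s t = (\<Sum>(w, l)\<leftarrow>eforms. w * l s * l t)"
  by code_simp

lemma pos_kernel_egram: "pos_kernel egram"
proof (rule pos_kernelI[of eforms])
  show "list_all (\<lambda>(w, l). 0 \<le> w) eforms" by code_simp
  have "s \<in> set [E1, E2, E3, EP1, EM1, EP2, EM2, EP3, EM3, E0]" for s by (cases s) simp_all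
  thus "egram s t = (\<Sum>(w, l)\<leftarrow>eforms. w * l s * l t)" for s t
    by (intro egram_eq[THEN bspec, THEN bspec])
qed

text \<open>
  For fixed roots \<open>\<phi> 0, \<phi> 1\<close> the flags \<open>(\<phi> 2, \<phi> 3)\<close> and \<open>(\<phi> 4, \<phi> 5)\<close> range independently over
  the same set, so the sum over them is the quadratic form of the kernel. Because repeated
  vertices are allowed, no correction for overlapping flags is needed.
\<close>

lemma tsum_root2_nonneg:
  assumes m: "\<forall>v\<in>V. m v \<ge> 0" and k: "pos_kernel k"
  shows "0 \<le> tsum V m (\<lambda>\<phi>. if R (\<phi> 0) (\<phi> 1)
     then of_int (k (g (\<phi> 0) (\<phi> 1) (\<phi> 2) (\<phi> 3)) (g (\<phi> 0) (\<phi> 1) (\<phi> 4) (\<phi> 5))) else 0)"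
proof -
  have pos: "0 \<le> (\<Sum>c\<in>V. \<Sum>d\<in>V. \<Sum>e\<in>V. \<Sum>f\<in>V. m a * m b * m c * m d * m e * m f *
      (if R a b then of_int (k (g a b c d) (g a b e f)) else 0))" if "a \<in> V" "b \<in> V" for a b
  proof -
    have "(\<Sum>c\<in>V. \<Sum>d\<in>V. \<Sum>e\<in>V. \<Sum>f\<in>V. m a * m b * m c * m d * m e * m f *
        (if R a b then of_int (k (g a b c d) (g a b e f)) else 0))
      = (\<Sum>c\<in>V. \<Sum>d\<in>V. \<Sum>e\<in>V. \<Sum>f\<in>V. (if R a b then m a * m b else 0) *
          ((m c * m d) * (m e * m f) * of_int (k (g a b c d) (g a b e f))))"
      by (intro sum.cong refl) simp
    also have "\<dots> = (if R a b then m a * m b else 0) *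
        (\<Sum>p\<in>V \<times> V. \<Sum>q\<in>V \<times> V. (m (fst p) * m (snd p)) * (m (fst q) * m (snd q)) *
           of_int (k (g a b (fst p) (snd p)) (g a b (fst q) (snd q))))"
      by (simp only: sum_distrib_left sum.cartesian_product' fst_conv snd_conv)
    also have "\<dots> \<ge> 0"
      by (rule mult_nonneg_nonneg[OF _ pos_kernel_sum_nonneg[OF k]]) (use m that in simp)
    finally show ?thesis .
  qed
  show ?thesis
    unfolding tsum_nested[of V m "\<lambda>a b c d e f. if R a b then of_int (k (g a b c d) (g a b e f)) else 0"]
    by (rule sum_nonneg, rule sum_nonneg, rule pos)
qed

lemma tsum_root4_nonneg:
  assumes m: "\<forall>v\<in>V. m v \<ge> 0" and k: "pos_kernel k"
  shows "0 \<le> tsum V m (\<lambda>\<phi>. if R (\<phi> 2) (\<phi> 3) (\<phi> 4) (\<phi> 5)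
     then of_int (k (g (\<phi> 2) (\<phi> 3) (\<phi> 4) (\<phi> 5) (\<phi> 0)) (g (\<phi> 2) (\<phi> 3) (\<phi> 4) (\<phi> 5) (\<phi> 1))) else 0)"
proof -
  let ?G = "\<lambda>c d e f a b. if R c d e f then of_int (k (g c d e f a) (g c d e f b)) else 0 :: real"
  have pos: "0 \<le> (\<Sum>a\<in>V. \<Sum>b\<in>V. m c * m d * m e * m f * m a * m b * ?G c d e f a b)"
    if "c \<in> V" "d \<in> V" "e \<in> V" "f \<in> V" for c d e f
  proof -
    have "(\<Sum>a\<in>V. \<Sum>b\<in>V. m c * m d * m e * m f * m a * m b * ?G c d e f a b)
      = (\<Sum>a\<in>V. \<Sum>b\<in>V. (if R c d e f then m c * m d * m e * m f else 0) *
          (m a * m b * of_int (k (g c d e f a) (g c d e f b))))"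
      by (intro sum.cong refl) simp
    also have "\<dots> = (if R c d e f then m c * m d * m e * m f else 0) *
        (\<Sum>a\<in>V. \<Sum>b\<in>V. m a * m b * of_int (k (g c d e f a) (g c d e f b)))"
      by (simp only: sum_distrib_left)
    also have "\<dots> \<ge> 0"
      by (rule mult_nonneg_nonneg[OF _ pos_kernel_sum_nonneg[OF k]]) (use m that in simp)
    finally show ?thesis .
  qed
  have "0 \<le> tsum V m (\<lambda>\<phi>. ?G (\<phi> 0) (\<phi> 1) (\<phi> 2) (\<phi> 3) (\<phi> 4) (\<phi> 5))"
    unfolding tsum_nested[of V m ?G]
    by (rule sum_nonneg, rule sum_nonneg, rule sum_nonneg, rule sum_nonneg, rule pos)
  also have "\<dots> = tsum V m (\<lambda>\<phi>. ?G (\<phi> 2) (\<phi> 3) (\<phi> 4) (\<phi> 5) (\<phi> 0) (\<phi> 1))"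
    by (rule tsum_index[of 2 3 4 5 0 1 V m ?G, symmetric]) auto
  finally show ?thesis .
qed

text \<open>
  The path has centre \<open>a\<close> and ends \<open>c, d\<close>; the triangle is \<open>b, e, f\<close>. The positions agree with
  the vertices \<open>0, \<dots>, 5\<close> of \<^const>\<open>F28\<close>.
\<close>

definition copy_at :: "('v \<Rightarrow> 'v \<Rightarrow> bool) \<Rightarrow> 'v \<Rightarrow> 'v \<Rightarrow> 'v \<Rightarrow> 'v \<Rightarrow> 'v \<Rightarrow> 'v \<Rightarrow> bool" where
  "copy_at A a b c d e f \<longleftrightarrow> A a c \<and> A a d \<and> A b e \<and> A b f \<and> A e f \<and>
     \<not> A a b \<and> \<not> A a e \<and> \<not> A a f \<and> \<not> A b c \<and> \<not> A b d \<and> \<not> A c d \<and> \<not> A c e \<and> \<not> A c f \<and> \<not> A d e \<and> \<not> A d f"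

text \<open>
  The positive semidefinite part of \<^const>\<open>kgram\<close>.
\<close>

definition kpos :: "kflag \<Rightarrow> kflag \<Rightarrow> int" where
  "kpos s t = 352 * case_kflag (-1) (-1) 1 1 0 s * case_kflag (-1) (-1) 1 1 0 t"

lemma pos_kernel_kpos: "pos_kernel kpos"
  by (rule pos_kernelI[of "[(352, case_kflag (-1) (-1) 1 1 0)]"]) (auto simp: kpos_def)

lemma kgram_table:
  "\<forall>s \<in> set [T1, T2, C1, C2, K0]. \<forall>t \<in> set [T1, T2, C1, C2, K0]. \<forall>e \<in> set [True, False].
     kgram s t e = 352 * case_kflag (-1) (-1) 1 1 0 s * case_kflag (-1) (-1) 1 1 0 t
       + 2048 * (of_bool (\<not> e \<and> s = T1 \<and> t = C2) + of_bool (\<not> e \<and> s = T2 \<and> t = C1)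
               + of_bool (\<not> e \<and> t = T1 \<and> s = C2) + of_bool (\<not> e \<and> t = T2 \<and> s = C1))"
  by code_simp

lemma kgram_eq:
  "kgram s t e = kpos s t
     + 2048 * (of_bool (\<not> e \<and> s = T1 \<and> t = C2) + of_bool (\<not> e \<and> s = T2 \<and> t = C1)
             + of_bool (\<not> e \<and> t = T1 \<and> s = C2) + of_bool (\<not> e \<and> t = T2 \<and> s = C1))"
proof -
  have "s \<in> set [T1, T2, C1, C2, K0]" for s by (cases s) simp_all
  moreover have "e \<in> set [True, False]" by simp
  ultimately show ?thesis
    unfolding kpos_def by (intro kgram_table[THEN bspec, THEN bspec, THEN bspec])
qed

lemma kflag_iff:
  "kflag (link p q) (link r s) = T1 \<longleftrightarrow> p \<and> q \<and> \<not> r \<and> \<not> s"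
  "kflag (link p q) (link r s) = T2 \<longleftrightarrow> r \<and> s \<and> \<not> p \<and> \<not> q"
  "kflag (link p q) (link r s) = C1 \<longleftrightarrow> \<not> r \<and> \<not> s \<and> p \<noteq> q"
  "kflag (link p q) (link r s) = C2 \<longleftrightarrow> \<not> p \<and> \<not> q \<and> r \<noteq> s"
  by (auto simp: kflag_def link_def)

lemma copy_at_iff:
  assumes sym: "\<And>x y. A x y = A y x"
    and root: "A c d" "A e f" "\<not> A c e" "\<not> A c f" "\<not> A d e" "\<not> A d f"
  shows "copy_at A e x y f c d \<longleftrightarrow> (\<not> A x y \<and> A x c \<and> A x d \<and> \<not> A x e \<and> \<not> A x f \<and> \<not> A y c \<and> \<not> A y d) \<and> A y e \<and> \<not> A y f"
  unfolding copy_at_def sym[of e x] sym[of e y] sym[of e c] sym[of e d] sym[of f c] sym[of f d] using root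
  by (simp only: simp_thms) blast

text \<open>
  If \<open>x\<close> completes \<open>cd\<close> to a triangle and \<open>y\<close> completes \<open>ef\<close> to a path, exactly one of \<open>e, f\<close>
  is the centre of the path.
\<close>

lemma copy_at_pair:
  assumes sym: "\<And>x y. A x y = A y x"
    and root: "A c d" "A e f" "\<not> A c e" "\<not> A c f" "\<not> A d e" "\<not> A d f"
  shows "of_bool (copy_at A e x y f c d) + of_bool (copy_at A f x y e c d)
    = (of_bool (\<not> A x y \<and> (A x c \<and> A x d \<and> \<not> A x e \<and> \<not> A x f) \<and> (\<not> A y c \<and> \<not> A y d \<and> A y e \<noteq> A y f)) :: int)"
proof -
  have "A f e" using root by (simp add: sym[of f e])
  let ?P = "\<not> A x y \<and> A x c \<and> A x d \<and> \<not> A x e \<and> \<not> A x f \<and> \<not> A y c \<and> \<not> A y d"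
  have 1: "copy_at A e x y f c d \<longleftrightarrow> ?P \<and> A y e \<and> \<not> A y f"
    by (rule copy_at_iff[OF sym root])
  have 2: "copy_at A f x y e c d \<longleftrightarrow> ?P \<and> \<not> A y e \<and> A y f"
    unfolding copy_at_iff[OF sym root(1) \<open>A f e\<close> root(4) root(3) root(6) root(5)] by blast
  have 3: "\<not> A x y \<and> (A x c \<and> A x d \<and> \<not> A x e \<and> \<not> A x f) \<and> (\<not> A y c \<and> \<not> A y d \<and> A y e \<noteq> A y f)
    \<longleftrightarrow> ?P \<and> A y e \<noteq> A y f" by blast
  show ?thesis unfolding 1 2 3 by (cases ?P; cases "A y e"; cases "A y f"; simp only: simp_thms of_bool_eq add_0_left add_0_right)
qed

text \<open>
  On the roots \<open>cd, ef\<close> the surplus of \<^const>\<open>kgram\<close> over its positive semidefinite part counts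
  copies of \<^const>\<open>F28\<close>: the triangle is on either of the two edges, its third vertex is \<open>a\<close> or \<open>b\<close>,
  and the centre of the path is either end of the other edge.
\<close>

lemma kgram_copies:
  assumes sym: "\<And>x y. A x y = A y x"
    and root: "A c d" "A e f" "\<not> A c e" "\<not> A c f" "\<not> A d e" "\<not> A d f"
  defines "K \<equiv> \<lambda>x. kflag (link (A x c) (A x d)) (link (A x e) (A x f))"
  shows "kgram (K a) (K b) (A a b) = kpos (K a) (K b)
    + 2048 * ((of_bool (copy_at A e a b f c d) + of_bool (copy_at A f a b e c d)) + (of_bool (copy_at A c a b d e f) + of_bool (copy_at A d a b c e f))
            + (of_bool (copy_at A e b a f c d) + of_bool (copy_at A f b a e c d)) + (of_bool (copy_at A c b a d e f) + of_bool (copy_at A d b a c e f)))"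
proof -
  have root': "\<not> A e c" "\<not> A e d" "\<not> A f c" "\<not> A f d" using root by (simp_all add: sym[of e c] sym[of e d] sym[of f c] sym[of f d])
  have *: "of_bool (copy_at A e x y f c d) + of_bool (copy_at A f x y e c d) = (of_bool (\<not> A x y \<and> K x = T1 \<and> K y = C2) :: int)" for x y
    unfolding copy_at_pair[OF sym root] K_def kflag_iff by (rule refl)
  have **: "of_bool (copy_at A c x y d e f) + of_bool (copy_at A d x y c e f) = (of_bool (\<not> A x y \<and> K x = T2 \<and> K y = C1) :: int)" for x y
    unfolding copy_at_pair[OF sym root(2,1) root'(1,2,3,4)] K_def kflag_iff by (rule refl)
  have "A b a = A a b" by (rule sym)
  thus ?thesis unfolding * ** by (simp only: kgram_eq)
qed

section \<open>Symmetries of the flag form\<close>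

text \<open>
  The effect of exchanging the two vertices of the pair.
\<close>

definition rev_link :: "link \<Rightarrow> link" where
  "rev_link s = (case s of NoLink \<Rightarrow> NoLink | LinkL \<Rightarrow> LinkR | LinkR \<Rightarrow> LinkL | LinkLR \<Rightarrow> LinkLR)"

lemma link_rev: "link q p = rev_link (link p q)"
  by (cases p; cases q; simp add: link_def rev_link_def)

definition neg_a :: "aflag \<Rightarrow> aflag" where
  "neg_a = case_aflag M1 P1 M2 P2 M3 P3 A0"
definition neg_e :: "eflag \<Rightarrow> eflag" where
  "neg_e = case_eflag E1 E2 E3 EM1 EP1 EM2 EP2 EM3 EP3 E0"
definition swap_k :: "kflag \<Rightarrow> kflag" where
  "swap_k = case_kflag T2 T1 C2 C1 K0"

lemma flag_rev:
  "sflag (rev_link s) (rev_link t) e = sflag s t e"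
  "aflag (rev_link s) (rev_link t) e = neg_a (aflag s t e)"
  "eflag (rev_link s) (rev_link t) e = neg_e (eflag s t e)"
  "kflag (rev_link s) (rev_link t) = kflag s t"
  by (cases s; cases t; simp add: sflag_def aflag_def eflag_def kflag_def rev_link_def neg_a_def neg_e_def)+

lemma kflag_rev1: "kflag (rev_link s) t = kflag s t" "kflag s (rev_link t) = kflag s t"
  by (cases s; cases t; simp add: kflag_def rev_link_def)+

lemma flag_commute:
  "sflag t s e = sflag s t e"
  "aflag t s e = aflag s t e"
  "eflag t s e = eflag s t e"
  "kflag t s = swap_k (kflag s t)"
  by (cases s; cases t; simp add: sflag_def aflag_def eflag_def kflag_def swap_k_def)+

lemma pos_kernel_commute:
  assumes "pos_kernel k"
  shows "k t s = k s t"
proof -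
  from assms obtain ws where "\<forall>s t. k s t = (\<Sum>(w, l)\<leftarrow>ws. w * l s * l t)"
    unfolding pos_kernel_def by blast
  thus ?thesis by (simp add: mult_ac)
qed

lemmas gram_commute = pos_kernel_commute[OF pos_kernel_sgram] pos_kernel_commute[OF pos_kernel_agram]
  pos_kernel_commute[OF pos_kernel_egram]

lemma kgram_commute: "kgram t s e = kgram s t e"
  by (cases s; cases t; simp)

lemma agram_neg: "agram (neg_a s) (neg_a t) = agram s t"
  by (cases s; cases t; simp add: neg_a_def)

lemma egram_neg: "egram (neg_e s) (neg_e t) = egram s t"
  by (cases s; cases t; simp add: neg_e_def)

lemma kgram_swap: "kgram (swap_k s) (swap_k t) e = kgram s t e"
  by (cases s; cases t; simp add: swap_k_def)

text \<open>
  Exchange of the two roots, of the vertices inside a flag, and of the two flags. In the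
  antisymmetric parts the exchange of roots changes the sign of both flags, so the product is
  unchanged.
\<close>

lemma flag_form_at_sym:
  assumes sym: "\<And>x y. A x y = A y x"
  shows "flag_form_at A b a c d e f = flag_form_at A a b c d e f"
    "flag_form_at A a b d c e f = flag_form_at A a b c d e f"
    "flag_form_at A a b c d f e = flag_form_at A a b c d e f"
    "flag_form_at A a b e f c d = flag_form_at A a b c d e f"
proof -
  let ?l = "\<lambda>x y z. link (A x y) (A x z)"
  show "flag_form_at A b a c d e f = flag_form_at A a b c d e f"
    unfolding flag_form_at_def flag_form_def sym[of b a]
    unfolding link_rev[of "A b c" "A a c"] link_rev[of "A b d" "A a d"] link_rev[of "A b e" "A a e"] link_rev[of "A b f" "A a f"]
      flag_rev agram_neg egram_neg
    by (simp only: kgram_commute[of "kflag (?l b c d) (?l b e f)" "kflag (?l a c d) (?l a e f)"])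
  show "flag_form_at A a b d c e f = flag_form_at A a b c d e f"
    unfolding flag_form_at_def flag_form_def sym[of d c]
    unfolding link_rev[of "A a d" "A a c"] link_rev[of "A b d" "A b c"] kflag_rev1
      flag_commute(1-3)[of "link (A a d) (A b d)" "link (A a c) (A b c)"]
    by (cases "A c d"; cases "A e f"; cases "A c e"; cases "A c f"; cases "A d e"; cases "A d f"; simp)
  show "flag_form_at A a b c d f e = flag_form_at A a b c d e f"
    unfolding flag_form_at_def flag_form_def sym[of f e]
    unfolding link_rev[of "A a f" "A a e"] link_rev[of "A b f" "A b e"] kflag_rev1
      flag_commute(1-3)[of "link (A a f) (A b f)" "link (A a e) (A b e)"]
    by (cases "A c d"; cases "A e f"; cases "A c e"; cases "A c f"; cases "A d e"; cases "A d f"; simp)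
  show "flag_form_at A a b e f c d = flag_form_at A a b c d e f"
    unfolding flag_form_at_def flag_form_def sym[of e c] sym[of e d] sym[of f c] sym[of f d]
    unfolding flag_commute(4)[of "?l a e f" "?l a c d"] flag_commute(4)[of "?l b e f" "?l b c d"] kgram_swap
    unfolding gram_commute(1)[of "sflag (link (A a e) (A b e)) (link (A a f) (A b f)) (A e f)"]
      gram_commute(2)[of "aflag (link (A a e) (A b e)) (link (A a f) (A b f)) (A e f)"]
      gram_commute(3)[of "eflag (link (A a e) (A b e)) (link (A a f) (A b f)) (A e f)"]
    by (cases "A c d"; cases "A e f"; cases "A c e"; cases "A c f"; cases "A d e"; cases "A d f"; simp)
qed

text \<open>
  The adjacent transpositions generate all permutations, and each of them permutes the 45
  summands up to the four symmetries of \<open>T\<close>.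
\<close>

lemma split_sum_swap:
  assumes T: "\<And>a b c d e f. T b a c d e f = T a b c d e f" "\<And>a b c d e f. T a b d c e f = T a b c d e f"
    "\<And>a b c d e f. T a b c d f e = T a b c d e f" "\<And>a b c d e f. T a b e f c d = T a b c d e f"
  shows "split_sum T b a c d e f = split_sum T a b c d e f"
    "split_sum T a c b d e f = split_sum T a b c d e f"
    "split_sum T a b d c e f = split_sum T a b c d e f"
    "split_sum T a b c e d f = split_sum T a b c d e f"
    "split_sum T a b c d f e = split_sum T a b c d e f"
  by (simp_all only: split_sum_def T add_ac)

section \<open>The bound for all graphs on six vertices\<close>

lemma all_bools_iff: "all_bools n P xs \<longleftrightarrow> (\<forall>ys. length ys = n \<longrightarrow> P (rev ys @ xs))"
proof (induction n arbitrary: xs)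
  case (Suc n)
  have "(\<forall>ys. length ys = Suc n \<longrightarrow> P (rev ys @ xs)) \<longleftrightarrow> (\<forall>b ys. length ys = n \<longrightarrow> P (rev ys @ b # xs))"
  proof (safe, goal_cases)
    case (1 b ys) from 1(1)[rule_format, of "b # ys"] 1(2) show ?case by simp
  next
    case (2 ys) thus ?case by (cases ys) auto
  qed
  also have "\<dots> \<longleftrightarrow> all_bools (Suc n) P xs"
    by (simp add: Suc.IH) (metis (full_types))
  finally show ?case by simp
qed simp

lemma all_bools_apply: "all_bools n P xs \<Longrightarrow> length ys = n \<Longrightarrow> P (ys @ xs)"
  using all_bools_iff[of n P xs] by (metis length_rev rev_rev_ident)

text \<open>
  The four levels of the exhaustive check, unfolded for a graph that passes all comparisons of
  degrees.
\<close>

lemma split_sum_sorted: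
  assumes "count4 ac ad ae af \<le> count4 bc bd be bf" "count4 ab bd be bf \<le> count4 ac cd ce cf"
    "count4 ac bc ce cf \<le> count4 ad bd de df" "count4 ad bd cd df \<le> count4 ae be ce ef" "count4 ae be ce de \<le> count4 af bf cf df"
  shows "split_sum_bits ab ac ad ae af bc bd be bf cd ce cf de df ef \<le> 2880"
proof -
  from all_bools_apply[OF all_graphs_checked, of "[bf, be, bd, bc, af, ae, ad, ac, ab]"]
  have "all_bools 3 check2 [bf, be, bd, bc, af, ae, ad, ac, ab]" using assms(1) by (simp del: count4.simps all_bools.simps)
  from all_bools_apply[OF this, of "[cf, ce, cd]"]
  have "all_bools 2 check3 [cf, ce, cd, bf, be, bd, bc, af, ae, ad, ac, ab]" using assms(2) by (simp del: count4.simps all_bools.simps)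
  from all_bools_apply[OF this, of "[df, de]"]
  have "all_bools 1 check4 [df, de, cf, ce, cd, bf, be, bd, bc, af, ae, ad, ac, ab]" using assms(3) by (simp del: count4.simps all_bools.simps)
  from all_bools_apply[OF this, of "[ef]"]
  show ?thesis using assms(4,5) by (simp del: count4.simps all_bools.simps)
qed

lemma count4_eq: "count4 p q r s = of_bool p + of_bool q + of_bool r + of_bool s"
  by simp

lemma split_sum_eq_bits:
  assumes sym: "\<And>x y. A x y = A y x"
  shows "split_sum (flag_form_at A) a b c d e f = split_sum_bits (A a b) (A a c) (A a d) (A a e) (A a f) (A b c) (A b d) (A b e) (A b f)
    (A c d) (A c e) (A c f) (A d e) (A d f) (A e f)"
  unfolding split_sum_bits_eq
  by (simp only: split_sum_def flag_form_at_def sym[of b a] sym[of c a] sym[of d a] sym[of e a] sym[of f a]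
     sym[of c b] sym[of d b] sym[of e b] sym[of f b] sym[of d c] sym[of e c] sym[of f c] sym[of e d] sym[of f d] sym[of f e])

text \<open>
  Sorting by degrees: as long as two neighbouring vertices are in the wrong order, exchanging
  them leaves the sum unchanged and increases \<open>\<Sum>i * deg i\<close>, so a sorted order is reached, to
  which the exhaustive check applies.
\<close>

lemma split_sum_le:
  assumes sym: "\<And>x y. A x y = A y x"
  shows "split_sum (flag_form_at A) a b c d e f \<le> 2880"
proof -
  define D where "D x y1 y2 y3 y4 y5 = (of_bool (A x y1) + of_bool (A x y2) + of_bool (A x y3) + of_bool (A x y4) + of_bool (A x y5) :: nat)" for x y1 y2 y3 y4 y5
  note sw = split_sum_swap[of "flag_form_at A", OF flag_form_at_sym[OF sym]]
  \<comment> \<open>The weighted sum is at most \<open>5 * (1 + 2 + 3 + 4 + 5) = 75\<close>, so the subtraction from 100 does not truncate.\<close>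
  define \<mu> where "\<mu> a b c d e f = (100::nat) - (D b a c d e f + 2 * D c a b d e f + 3 * D d a b c e f + 4 * D e a b c d f + 5 * D f a b c d e)" for a b c d e f
  have Dle: "D x y1 y2 y3 y4 y5 \<le> 5" for x y1 y2 y3 y4 y5 unfolding D_def by (simp add: of_bool_def)
  have comm: "D x y2 y1 y3 y4 y5 = D x y1 y2 y3 y4 y5" "D x y1 y3 y2 y4 y5 = D x y1 y2 y3 y4 y5"
     "D x y1 y2 y4 y3 y5 = D x y1 y2 y3 y4 y5" "D x y1 y2 y3 y5 y4 = D x y1 y2 y3 y4 y5" for x y1 y2 y3 y4 y5
    unfolding D_def by simp_all
  show ?thesis
  proof (induction "\<mu> a b c d e f" arbitrary: a b c d e f rule: less_induct)
    case less
    let ?a = "D a b c d e f" and ?b = "D b a c d e f" and ?c = "D c a b d e f" and ?d = "D d a b c e f" and ?e = "D e a b c d f" and ?f = "D f a b c d e"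
    note le5 = Dle[of a b c d e f] Dle[of b a c d e f] Dle[of c a b d e f] Dle[of d a b c e f] Dle[of e a b c d f] Dle[of f a b c d e]
    consider "?a > ?b" | "?b > ?c" | "?c > ?d" | "?d > ?e" | "?e > ?f"
      | "?a \<le> ?b" "?b \<le> ?c" "?c \<le> ?d" "?d \<le> ?e" "?e \<le> ?f" by linarith
    thus ?case
    proof cases
      case 1
      hence "\<mu> b a c d e f < \<mu> a b c d e f" unfolding \<mu>_def using le5
        by (simp add: comm(1)[of _ b a])
      from less[OF this] show ?thesis by (simp only: sw)
    next
      case 2
      hence "\<mu> a c b d e f < \<mu> a b c d e f" unfolding \<mu>_def using le5
        by (simp add: comm(2)[of _ _ c b])
      from less[OF this] show ?thesis by (simp only: sw)
    next
      case 3
      hence "\<mu> a b d c e f < \<mu> a b c d e f" unfolding \<mu>_def using le5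
        by (simp add: comm(3)[of _ _ _ d c] comm(2)[of _ _ d c])
      from less[OF this] show ?thesis by (simp only: sw)
    next
      case 4
      hence "\<mu> a b c e d f < \<mu> a b c d e f" unfolding \<mu>_def using le5
        by (simp add: comm(4)[of _ _ _ _ e d] comm(3)[of _ _ _ e d])
      from less[OF this] show ?thesis by (simp only: sw)
    next
      case 5
      hence "\<mu> a b c d f e < \<mu> a b c d e f" unfolding \<mu>_def using le5
        by (simp add: comm(4)[of _ _ _ _ f e])
      from less[OF this] show ?thesis by (simp only: sw)
    next
      case 6
      show ?thesis
        unfolding split_sum_eq_bits[OF sym]
        by (rule split_sum_sorted; unfold count4_eq; insert 6; unfold D_def)
          (simp_all only: sym[of b a] sym[of c a] sym[of d a] sym[of e a] sym[of f a]
             sym[of c b] sym[of d b] sym[of e b] sym[of f b] sym[of d c] sym[of e c] sym[of f c] sym[of e d] sym[of f d] sym[of f e])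
    qed
  qed
qed

section \<open>Bad tuples and the flag inequality\<close>

text \<open>
  Adjacency of the parts of \<^const>\<open>B28\<close>, which has the loop \<open>00\<close> and the edge \<open>12\<close>.
\<close>

definition linked :: "nat \<Rightarrow> nat \<Rightarrow> bool" where
  "linked i j \<longleftrightarrow> i = 0 \<and> j = 0 \<or> i = 1 \<and> j = 2 \<or> i = 2 \<and> j = 1"

text \<open>
  The roots \<open>a, c, u, v\<close> are adjacent like vertices of the parts \<open>0, 1, 2, 2\<close>.
\<close>

definition root_tuple :: "('v \<Rightarrow> 'v \<Rightarrow> bool) \<Rightarrow> 'v \<Rightarrow> 'v \<Rightarrow> 'v \<Rightarrow> 'v \<Rightarrow> bool" where
  "root_tuple A a c u v \<longleftrightarrow> A c u \<and> A c v \<and> \<not> A u v \<and> \<not> A a c \<and> \<not> A a u \<and> \<not> A a v"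

text \<open>
  The roots see \<open>z\<close> like a vertex of part \<open>i\<close>.
\<close>

definition attached :: "('v \<Rightarrow> 'v \<Rightarrow> bool) \<Rightarrow> 'v \<Rightarrow> 'v \<Rightarrow> 'v \<Rightarrow> 'v \<Rightarrow> 'v \<Rightarrow> nat \<Rightarrow> bool" where
  "attached A a c u v z i \<longleftrightarrow>
     A z a = linked i 0 \<and> A z c = linked i 1 \<and> A z u = linked i 2 \<and> A z v = linked i 2"

text \<open>
  The parts that the roots predict for \<open>z\<close> and \<open>w\<close> do not exist, or contradict the adjacency of
  \<open>z\<close> and \<open>w\<close>.
\<close>

definition bad :: "('v \<Rightarrow> 'v \<Rightarrow> bool) \<Rightarrow> 'v \<Rightarrow> 'v \<Rightarrow> 'v \<Rightarrow> 'v \<Rightarrow> 'v \<Rightarrow> 'v \<Rightarrow> bool" where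
  "bad A a c u v z w \<longleftrightarrow> root_tuple A a c u v \<and>
     \<not> (\<exists>i<3. \<exists>j<3. attached A a c u v z i \<and> attached A a c u v w j \<and> A z w = linked i j)"

text \<open>
  The part to which a vertex with the given adjacencies to the four roots is attached; \<open>3\<close>
  stands for none.
\<close>

definition class_of_bits :: "bool \<Rightarrow> bool \<Rightarrow> bool \<Rightarrow> bool \<Rightarrow> nat" where
  "class_of_bits p q r s = (if p then if q then 3 else if r then 3 else if s then 3 else 0
     else if q then if r then 3 else if s then 3 else 2 else if r then if s then 1 else 3 else 3)"

text \<open>
  A root tuple fixes six of the 15 adjacencies, which leaves \<open>2\<^sup>9\<close> graphs to evaluate. The gap
  \<open>56 = 2880 - 2824\<close> is the source of the slack in the flag inequality.
\<close>

fun check_bad :: "bool list \<Rightarrow> bool" where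
  "check_bad [ef, df, de, cf, ce, bf, be, af, ae] =
     (if class_of_bits ae be ce de < 3 \<and> class_of_bits af bf cf df < 3 \<and> ef = linked (class_of_bits ae be ce de) (class_of_bits af bf cf df) then True
      else split_sum_bits False False False ae af True True be bf False ce cf de df ef \<le> 2824)"
| "check_bad _ = True"

lemma bad_graphs_checked: "all_bools 9 check_bad []"
  by code_simp

lemma class_of_bits_attached:
  assumes "class_of_bits (A z a) (A z c) (A z u) (A z v) < 3"
  shows "attached A a c u v z (class_of_bits (A z a) (A z c) (A z u) (A z v))"
  using assms by (auto simp: attached_def class_of_bits_def linked_def split: if_splits)

lemma split_sum_bad_le:
  assumes sym: "\<And>x y. A x y = A y x" and "bad A a c u v z w"
  shows "split_sum (flag_form_at A) a c u v z w \<le> 2824"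
proof -
  have R: "root_tuple A a c u v" using assms by (simp add: bad_def)
  have "check_bad [A z w, A w v, A z v, A w u, A z u, A w c, A z c, A w a, A z a]"
    using all_bools_apply[OF bad_graphs_checked, of "[A z w, A w v, A z v, A w u, A z u, A w c, A z c, A w a, A z a]"]
    by (simp del: check_bad.simps)
  moreover have "\<not> (class_of_bits (A z a) (A z c) (A z u) (A z v) < 3 \<and> class_of_bits (A w a) (A w c) (A w u) (A w v) < 3 \<and>
      A z w = linked (class_of_bits (A z a) (A z c) (A z u) (A z v)) (class_of_bits (A w a) (A w c) (A w u) (A w v)))"
    using assms(2) class_of_bits_attached[of A z a c u v] class_of_bits_attached[of A w a c u v] unfolding bad_def by blast
  ultimately show ?thesis
    unfolding split_sum_eq_bits[OF sym]
    using R by (simp add: root_tuple_def sym[of a z] sym[of a w] sym[of c z] sym[of c w] sym[of u z] sym[of u w] sym[of v z] sym[of v w])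
qed

text \<open>
  All 45 summands have the same weighted sum, because they differ by a renaming of positions.
\<close>

lemma tsum_split_sum:
  "tsum V m (\<lambda>\<phi>. of_int (split_sum T (\<phi> 0) (\<phi> 1) (\<phi> 2) (\<phi> 3) (\<phi> 4) (\<phi> 5)))
   = 45 * tsum V m (\<lambda>\<phi>. of_int (T (\<phi> 0) (\<phi> 1) (\<phi> 2) (\<phi> 3) (\<phi> 4) (\<phi> 5)))"
proof -
  define X where "X = tsum V m (\<lambda>\<phi>. of_int (T (\<phi> 0) (\<phi> 1) (\<phi> 2) (\<phi> 3) (\<phi> 4) (\<phi> 5)))"
  have X: "tsum V m (\<lambda>\<phi>. of_int (T (\<phi> a) (\<phi> b) (\<phi> c) (\<phi> d) (\<phi> e) (\<phi> f))) = X"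
    if "distinct [a, b, c, d, e, f]" "{a, b, c, d, e, f} \<subseteq> {..<6}" for a b c d e f
    unfolding X_def using tsum_index[OF that, of V m "\<lambda>a b c d e f. of_int (T a b c d e f)"] .
  show ?thesis
    unfolding X_def[symmetric]
    by (simp add: split_sum_def tsum_add X)
qed

text \<open>
  The decomposition of the flag form into the four positive semidefinite kernels and the eight
  indicators of copies.
\<close>

lemma of_int_flag_form_at:
  assumes sym: "\<And>x y. A x y = A y x"
  shows "of_int (flag_form_at A a b c d e f) = (if A a b
       then of_int (egram (eflag (link (A a c) (A b c)) (link (A a d) (A b d)) (A c d)) (eflag (link (A a e) (A b e)) (link (A a f) (A b f)) (A e f))) else 0)
    + (if \<not> A a b
       then of_int (sgram (sflag (link (A a c) (A b c)) (link (A a d) (A b d)) (A c d)) (sflag (link (A a e) (A b e)) (link (A a f) (A b f)) (A e f))) else 0)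
    + (if \<not> A a b
       then of_int (agram (aflag (link (A a c) (A b c)) (link (A a d) (A b d)) (A c d)) (aflag (link (A a e) (A b e)) (link (A a f) (A b f)) (A e f))) else 0)
    + (if A c d \<and> A e f \<and> \<not> A c e \<and> \<not> A c f \<and> \<not> A d e \<and> \<not> A d f
       then of_int (kpos (kflag (link (A a c) (A a d)) (link (A a e) (A a f))) (kflag (link (A b c) (A b d)) (link (A b e) (A b f)))) else 0)
    + 2048 * ((of_bool (copy_at A e a b f c d) + of_bool (copy_at A f a b e c d)) + (of_bool (copy_at A c a b d e f) + of_bool (copy_at A d a b c e f))
            + (of_bool (copy_at A e b a f c d) + of_bool (copy_at A f b a e c d)) + (of_bool (copy_at A c b a d e f) + of_bool (copy_at A d b a c e f)) :: real)"
proof (cases "A c d \<and> A e f \<and> \<not> A c e \<and> \<not> A c f \<and> \<not> A d e \<and> \<not> A d f")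
  case True
  thus ?thesis
    unfolding flag_form_at_def flag_form_def using kgram_copies[of A c d e f a b, OF sym] by simp
next
  case False
  hence "\<not> copy_at A e a b f c d" "\<not> copy_at A f a b e c d" "\<not> copy_at A c a b d e f" "\<not> copy_at A d a b c e f"
     "\<not> copy_at A e b a f c d" "\<not> copy_at A f b a e c d" "\<not> copy_at A c b a d e f" "\<not> copy_at A d b a c e f"
    by (simp_all add: copy_at_def sym[of e c] sym[of e d] sym[of f c] sym[of f d] sym[of f e] sym[of d c], blast+)
  thus ?thesis
    unfolding flag_form_at_def flag_form_def using False by (cases "A c d"; cases "A e f"; cases "A c e"; cases "A c f"; cases "A d e"; simp)
qed

text \<open>
  The kernels contribute nonnegative amounts, and the eight copy terms give \<open>8 * 2048 = 16384\<close>.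
\<close>

lemma tsum_flag_form_ge:
  assumes m: "\<And>v. v \<in> V \<Longrightarrow> m v \<ge> 0" and sym: "\<And>x y. A x y = A y x"
  shows "tsum V m (\<lambda>\<phi>. of_int (flag_form_at A (\<phi> 0) (\<phi> 1) (\<phi> 2) (\<phi> 3) (\<phi> 4) (\<phi> 5)))
    \<ge> 16384 * tsum V m (\<lambda>\<phi>. of_bool (copy_at A (\<phi> 0) (\<phi> 1) (\<phi> 2) (\<phi> 3) (\<phi> 4) (\<phi> 5)))"
proof -
  define X where "X = tsum V m (\<lambda>\<phi>. of_bool (copy_at A (\<phi> 0) (\<phi> 1) (\<phi> 2) (\<phi> 3) (\<phi> 4) (\<phi> 5)))"
  have X: "tsum V m (\<lambda>\<phi>. of_bool (copy_at A (\<phi> a) (\<phi> b) (\<phi> c) (\<phi> d) (\<phi> e) (\<phi> f))) = X"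
    if "distinct [a, b, c, d, e, f]" "{a, b, c, d, e, f} \<subseteq> {..<6}" for a b c d e f
    unfolding X_def using tsum_index[OF that, of V m "\<lambda>a b c d e f. of_bool (copy_at A a b c d e f)"] .
  have X8:
    "tsum V m (\<lambda>\<phi>. of_bool (copy_at A (\<phi> 4) (\<phi> 0) (\<phi> 1) (\<phi> 5) (\<phi> 2) (\<phi> 3))) = X"
    "tsum V m (\<lambda>\<phi>. of_bool (copy_at A (\<phi> 5) (\<phi> 0) (\<phi> 1) (\<phi> 4) (\<phi> 2) (\<phi> 3))) = X"
    "tsum V m (\<lambda>\<phi>. of_bool (copy_at A (\<phi> 2) (\<phi> 0) (\<phi> 1) (\<phi> 3) (\<phi> 4) (\<phi> 5))) = X"
    "tsum V m (\<lambda>\<phi>. of_bool (copy_at A (\<phi> 3) (\<phi> 0) (\<phi> 1) (\<phi> 2) (\<phi> 4) (\<phi> 5))) = X"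
    "tsum V m (\<lambda>\<phi>. of_bool (copy_at A (\<phi> 4) (\<phi> 1) (\<phi> 0) (\<phi> 5) (\<phi> 2) (\<phi> 3))) = X"
    "tsum V m (\<lambda>\<phi>. of_bool (copy_at A (\<phi> 5) (\<phi> 1) (\<phi> 0) (\<phi> 4) (\<phi> 2) (\<phi> 3))) = X"
    "tsum V m (\<lambda>\<phi>. of_bool (copy_at A (\<phi> 2) (\<phi> 1) (\<phi> 0) (\<phi> 3) (\<phi> 4) (\<phi> 5))) = X"
    "tsum V m (\<lambda>\<phi>. of_bool (copy_at A (\<phi> 3) (\<phi> 1) (\<phi> 0) (\<phi> 2) (\<phi> 4) (\<phi> 5))) = X"
    by (rule X; simp)+
  have m': "\<forall>v\<in>V. m v \<ge> 0" using m by blast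
  note p2 = tsum_root2_nonneg[OF m'] and p4 = tsum_root4_nonneg[OF m' pos_kernel_kpos]
  have arith: "16384 * X \<le> p + q + r + s + 2048 * (X + X + (X + X) + (X + X) + (X + X))"
    if "0 \<le> p" "0 \<le> q" "0 \<le> r" "0 \<le> s" for p q r s using that by simp
  show ?thesis
    unfolding X_def[symmetric] of_int_flag_form_at[OF sym] tsum_add tsum_cmult X8
    using p2[where R = A and g = "\<lambda>a b c d. eflag (link (A a c) (A b c)) (link (A a d) (A b d)) (A c d)", OF pos_kernel_egram]
      p2[where R = "\<lambda>a b. \<not> A a b" and g = "\<lambda>a b c d. sflag (link (A a c) (A b c)) (link (A a d) (A b d)) (A c d)", OF pos_kernel_sgram]
      p2[where R = "\<lambda>a b. \<not> A a b" and g = "\<lambda>a b c d. aflag (link (A a c) (A b c)) (link (A a d) (A b d)) (A c d)", OF pos_kernel_agram]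
      p4[where R = "\<lambda>c d e f. A c d \<and> A e f \<and> \<not> A c e \<and> \<not> A c f \<and> \<not> A d e \<and> \<not> A d f"
        and g = "\<lambda>c d e f a. kflag (link (A a c) (A a d)) (link (A a e) (A a f))"]
    by (rule arith)
qed

text \<open>
  Dividing \<open>45 * 16384 * F + 56 * bad \<le> 2880 * mass\<^sup>6\<close> by \<open>2880\<close> gives \<open>256\<close> as the factor of
  the copies and \<open>56 / 2880 \<ge> 1 / 60\<close> as the factor of the bad tuples.
\<close>

theorem flag_inequality:
  assumes fin: "finite V" and m: "\<And>v. v \<in> V \<Longrightarrow> m v \<ge> 0" and sym: "\<And>x y. A x y = A y x"
  shows "256 * tsum V m (\<lambda>\<phi>. of_bool (copy_at A (\<phi> 0) (\<phi> 1) (\<phi> 2) (\<phi> 3) (\<phi> 4) (\<phi> 5)))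
     + tsum V m (\<lambda>\<phi>. of_bool (bad A (\<phi> 0) (\<phi> 1) (\<phi> 2) (\<phi> 3) (\<phi> 4) (\<phi> 5))) / 60
    \<le> (\<Sum>v\<in>V. m v) ^ 6"
proof -
  let ?B = "tsum V m (\<lambda>\<phi>. of_bool (bad A (\<phi> 0) (\<phi> 1) (\<phi> 2) (\<phi> 3) (\<phi> 4) (\<phi> 5)))"
  have B: "?B \<ge> 0" unfolding tsum_def using m by (intro sum_nonneg mult_nonneg_nonneg prod_nonneg) (auto simp: PiE_def Pi_def)
  have "tsum V m (\<lambda>\<phi>. of_int (split_sum (flag_form_at A) (\<phi> 0) (\<phi> 1) (\<phi> 2) (\<phi> 3) (\<phi> 4) (\<phi> 5)))
     \<le> tsum V m (\<lambda>\<phi>. 2880 - 56 * of_bool (bad A (\<phi> 0) (\<phi> 1) (\<phi> 2) (\<phi> 3) (\<phi> 4) (\<phi> 5)))"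
  proof (rule tsum_mono[OF m])
    fix \<phi> :: "nat \<Rightarrow> 'a"
    have 1: "split_sum (flag_form_at A) (\<phi> 0) (\<phi> 1) (\<phi> 2) (\<phi> 3) (\<phi> 4) (\<phi> 5) \<le> 2880" by (rule split_sum_le[OF sym])
    have 2: "split_sum (flag_form_at A) (\<phi> 0) (\<phi> 1) (\<phi> 2) (\<phi> 3) (\<phi> 4) (\<phi> 5) \<le> 2824" if "bad A (\<phi> 0) (\<phi> 1) (\<phi> 2) (\<phi> 3) (\<phi> 4) (\<phi> 5)"
      by (rule split_sum_bad_le[OF sym that])
    show "real_of_int (split_sum (flag_form_at A) (\<phi> 0) (\<phi> 1) (\<phi> 2) (\<phi> 3) (\<phi> 4) (\<phi> 5))
      \<le> 2880 - 56 * of_bool (bad A (\<phi> 0) (\<phi> 1) (\<phi> 2) (\<phi> 3) (\<phi> 4) (\<phi> 5))"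
      using 1 2 by (cases "bad A (\<phi> 0) (\<phi> 1) (\<phi> 2) (\<phi> 3) (\<phi> 4) (\<phi> 5)") auto
  qed
  also have "\<dots> = 2880 * (\<Sum>v\<in>V. m v) ^ 6 - 56 * ?B"
    by (simp only: tsum_diff tsum_cmult tsum_const[OF fin])
  finally show ?thesis
    using tsum_flag_form_ge[of V m A, OF m sym] B unfolding tsum_split_sum by linarith
qed

section \<open>Copies as six-tuples\<close>

definition adj :: "'v pattern \<Rightarrow> 'v \<Rightarrow> 'v \<Rightarrow> bool" where
  "adj G x y \<longleftrightarrow> {x, y} \<in> edges G"

lemma adj_sym: "adj G x y = adj G y x"
  by (simp add: adj_def insert_commute)

lemma adj_irrefl: "simple_graph G \<Longrightarrow> \<not> adj G x x"
  by (auto simp: adj_def simple_graph_def)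

definition is_copy :: "('v \<Rightarrow> 'v \<Rightarrow> bool) \<Rightarrow> (nat \<Rightarrow> 'v) \<Rightarrow> bool" where
  "is_copy A \<phi> \<longleftrightarrow> copy_at A (\<phi> 0) (\<phi> 1) (\<phi> 2) (\<phi> 3) (\<phi> 4) (\<phi> 5)"

lemma is_copy_iff:
  assumes sym: "\<And>x y. A x y = A y x"
  shows "is_copy A \<phi> \<longleftrightarrow> (\<forall>i<6. \<forall>j<6. i \<noteq> j \<longrightarrow> A (\<phi> i) (\<phi> j) = ({i, j} \<in> edges F28))"
proof -
  have lt6: "(\<forall>i<6. P i) \<longleftrightarrow> P 0 \<and> P 1 \<and> P 2 \<and> P 3 \<and> P 4 \<and> P (5::nat)" for P
    by (simp only: numeral_eq_Suc pred_numeral_simps BitM.simps numeral_One One_nat_def All_less_Suc not_less0 simp_thms conj_ac)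
  show ?thesis
  proof
    assume "is_copy A \<phi>"
    hence F: "A (\<phi> 0) (\<phi> 2)" "A (\<phi> 0) (\<phi> 3)" "A (\<phi> 1) (\<phi> 4)" "A (\<phi> 1) (\<phi> 5)" "A (\<phi> 4) (\<phi> 5)"
      and N: "\<not> A (\<phi> 0) (\<phi> 1)" "\<not> A (\<phi> 0) (\<phi> 4)" "\<not> A (\<phi> 0) (\<phi> 5)" "\<not> A (\<phi> 1) (\<phi> 2)"
        "\<not> A (\<phi> 1) (\<phi> 3)" "\<not> A (\<phi> 2) (\<phi> 3)" "\<not> A (\<phi> 2) (\<phi> 4)" "\<not> A (\<phi> 2) (\<phi> 5)" "\<not> A (\<phi> 3) (\<phi> 4)" "\<not> A (\<phi> 3) (\<phi> 5)"
      unfolding is_copy_def copy_at_def by simp_all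
    have "\<not> A x y \<Longrightarrow> \<not> A y x" for x y by (simp add: sym[of y x])
    note N' = N[THEN this]
    have "A x y \<Longrightarrow> A y x" for x y by (simp add: sym[of y x])
    note F' = F[THEN this]
    show "\<forall>i<6. \<forall>j<6. i \<noteq> j \<longrightarrow> A (\<phi> i) (\<phi> j) = ({i, j} \<in> edges F28)"
      unfolding lt6 using F F' N N' by (simp add: F28_def doubleton_eq_iff)
  next
    assume "\<forall>i<6. \<forall>j<6. i \<noteq> j \<longrightarrow> A (\<phi> i) (\<phi> j) = ({i, j} \<in> edges F28)"
    thus "is_copy A \<phi>"
      unfolding lt6 is_copy_def copy_at_def by (simp add: F28_def doubleton_eq_iff)
  qed
qed

definition copies :: "'v pattern \<Rightarrow> (nat \<Rightarrow> 'v) set" where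
  "copies G = {\<phi> \<in> {..<6} \<rightarrow>\<^sub>E verts G. inj_on \<phi> {..<6} \<and> is_copy (adj G) \<phi>}"

definition F28_adj :: "nat \<Rightarrow> nat \<Rightarrow> bool" where
  "F28_adj i j \<longleftrightarrow> (i, j) \<in> set [(0, 2), (2, 0), (0, 3), (3, 0), (1, 4), (4, 1), (1, 5), (5, 1), (4, 5), (5, 4)]"

lemma adj_F28: "adj F28 = F28_adj"
  by (auto simp: fun_eq_iff adj_def F28_def F28_adj_def doubleton_eq_iff)

text \<open>
  The automorphisms of \<^const>\<open>F28\<close> as lists of values, enumerated position by position with early
  pruning: \<open>6\<^sup>6\<close> candidates would be too many to filter.
\<close>

definition F28_auts :: "nat list list" where
  "F28_auts = [[a, b, c, d, e, f]. a \<leftarrow> [0..<6], c \<leftarrow> filter (F28_adj a) [0..<6],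
     d \<leftarrow> filter (\<lambda>d. F28_adj a d \<and> d \<noteq> c \<and> \<not> F28_adj c d) [0..<6],
     b \<leftarrow> filter (\<lambda>b. \<not> F28_adj a b \<and> \<not> F28_adj b c \<and> \<not> F28_adj b d \<and> b \<noteq> a \<and> b \<noteq> c \<and> b \<noteq> d) [0..<6],
     e \<leftarrow> filter (\<lambda>e. F28_adj b e \<and> \<not> F28_adj a e \<and> \<not> F28_adj c e \<and> \<not> F28_adj d e \<and> e \<noteq> a \<and> e \<noteq> c \<and> e \<noteq> d \<and> e \<noteq> b) [0..<6],
     f \<leftarrow> filter (\<lambda>f. F28_adj b f \<and> F28_adj e f \<and> \<not> F28_adj a f \<and> \<not> F28_adj c f \<and> \<not> F28_adj d f \<and> f \<noteq> a \<and> f \<noteq> c \<and> f \<noteq> d \<and> f \<noteq> b \<and> f \<noteq> e) [0..<6]]"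

lemma F28_auts_distinct: "distinct F28_auts \<and> length F28_auts = 12"
  by code_simp

lemma mem_concat_mapI: "y \<in> set xs \<Longrightarrow> z \<in> set (g y) \<Longrightarrow> z \<in> set (concat (map g xs))"
  by auto

lemma mem_F28_autsI:
  assumes lt: "a < 6" "b < 6" "c < 6" "d < 6" "e < 6" "f < 6"
    and F: "copy_at F28_adj a b c d e f" and dist: "distinct [a, b, c, d, e, f]"
  shows "[a, b, c, d, e, f] \<in> set F28_auts"
proof -
  have F': "F28_adj a c" "F28_adj a d" "F28_adj b e" "F28_adj b f" "F28_adj e f" "\<not> F28_adj a b" "\<not> F28_adj a e" "\<not> F28_adj a f"
    "\<not> F28_adj b c" "\<not> F28_adj b d" "\<not> F28_adj c d" "\<not> F28_adj c e" "\<not> F28_adj c f" "\<not> F28_adj d e" "\<not> F28_adj d f"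
    using F by (auto simp: copy_at_def)
  have d': "d \<noteq> c" "b \<noteq> a" "b \<noteq> c" "b \<noteq> d" "e \<noteq> a" "e \<noteq> c" "e \<noteq> d" "e \<noteq> b" "f \<noteq> a" "f \<noteq> c" "f \<noteq> d" "f \<noteq> b" "f \<noteq> e"
    using dist by auto
  show ?thesis
    unfolding F28_auts_def
    apply (rule mem_concat_mapI[of a], simp add: lt)
    apply (rule mem_concat_mapI[of c], simp add: lt F')
    apply (rule mem_concat_mapI[of d], simp add: lt F' d')
    apply (rule mem_concat_mapI[of b], simp add: lt F' d')
    apply (rule mem_concat_mapI[of e], simp add: lt F' d')
    by (simp add: lt F' d')
qed

lemma mem_F28_autsE:
  assumes "xs \<in> set F28_auts"
  obtains a b c d e f where "xs = [a, b, c, d, e, f]" "a < 6" "b < 6" "c < 6" "d < 6" "e < 6" "f < 6"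
    "copy_at F28_adj a b c d e f" "distinct [a, b, c, d, e, f]"
proof -
  from assms obtain a c d b e f where xs: "xs = [a, b, c, d, e, f]"
    and "a \<in> set [0..<6]" "c \<in> set (filter (F28_adj a) [0..<6])"
    "d \<in> set (filter (\<lambda>d. F28_adj a d \<and> d \<noteq> c \<and> \<not> F28_adj c d) [0..<6])"
    "b \<in> set (filter (\<lambda>b. \<not> F28_adj a b \<and> \<not> F28_adj b c \<and> \<not> F28_adj b d \<and> b \<noteq> a \<and> b \<noteq> c \<and> b \<noteq> d) [0..<6])"
    "e \<in> set (filter (\<lambda>e. F28_adj b e \<and> \<not> F28_adj a e \<and> \<not> F28_adj c e \<and> \<not> F28_adj d e \<and> e \<noteq> a \<and> e \<noteq> c \<and> e \<noteq> d \<and> e \<noteq> b) [0..<6])"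
    "f \<in> set (filter (\<lambda>f. F28_adj b f \<and> F28_adj e f \<and> \<not> F28_adj a f \<and> \<not> F28_adj c f \<and> \<not> F28_adj d f \<and> f \<noteq> a \<and> f \<noteq> c \<and> f \<noteq> d \<and> f \<noteq> b \<and> f \<noteq> e) [0..<6])"
    unfolding F28_auts_def by (auto simp del: set_filter set_upt)
  hence lt: "a < 6" "b < 6" "c < 6" "d < 6" "e < 6" "f < 6"
    and F: "F28_adj a c" "F28_adj a d" "F28_adj b e" "F28_adj b f" "F28_adj e f" "\<not> F28_adj a b" "\<not> F28_adj a e" "\<not> F28_adj a f"
    "\<not> F28_adj b c" "\<not> F28_adj b d" "\<not> F28_adj c d" "\<not> F28_adj c e" "\<not> F28_adj c f" "\<not> F28_adj d e" "\<not> F28_adj d f"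
    and ne: "d \<noteq> c" "b \<noteq> a" "b \<noteq> c" "b \<noteq> d" "e \<noteq> a" "e \<noteq> c" "e \<noteq> d" "e \<noteq> b" "f \<noteq> a" "f \<noteq> c" "f \<noteq> d" "f \<noteq> b" "f \<noteq> e"
    by simp_all
  have irr: "\<not> F28_adj x x" for x by (auto simp: F28_adj_def)
  have "a \<noteq> c" "a \<noteq> d" using F(1,2) irr by metis+
  hence dist: "distinct [a, b, c, d, e, f]" using ne by simp
  have "copy_at F28_adj a b c d e f" using F unfolding copy_at_def by blast
  from that[OF xs lt this dist] show thesis .
qed

lemma card_copies_F28: "card (copies F28) = 12"
proof -
  let ?m = "\<lambda>\<phi>. [\<phi> 0, \<phi> 1, \<phi> 2, \<phi> 3, \<phi> 4, \<phi> (5::nat)] :: nat list"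
  have lt6: "{..<6::nat} = {0, 1, 2, 3, 4, 5}" by auto
  have inj: "inj_on ?m (copies F28)"
  proof (rule inj_onI)
    fix \<phi> \<psi> :: "nat \<Rightarrow> nat" assume "\<phi> \<in> copies F28" "\<psi> \<in> copies F28" and eq: "?m \<phi> = ?m \<psi>"
    hence "\<phi> \<in> {..<6} \<rightarrow>\<^sub>E {..<6}" "\<psi> \<in> {..<6} \<rightarrow>\<^sub>E {..<6}" by (auto simp: copies_def F28_def)
    thus "\<phi> = \<psi>" by (rule PiE_ext) (use eq in \<open>auto simp: lt6\<close>)
  qed
  have "?m ` copies F28 = set F28_auts"
  proof (intro equalityI subsetI)
    fix xs assume "xs \<in> ?m ` copies F28"
    then obtain \<phi> where \<phi>: "\<phi> \<in> {..<6} \<rightarrow>\<^sub>E {..<6}" "inj_on \<phi> {..<6}" "copy_at F28_adj (\<phi> 0) (\<phi> 1) (\<phi> 2) (\<phi> 3) (\<phi> 4) (\<phi> 5)" "xs = ?m \<phi>"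
      by (auto simp: copies_def F28_def[THEN arg_cong[where f = fst]] adj_F28 is_copy_def)
    have "\<phi> i < 6" if "i < 6" for i using \<phi>(1) that by (auto simp: PiE_def Pi_def)
    hence lt: "\<phi> 0 < 6" "\<phi> 1 < 6" "\<phi> 2 < 6" "\<phi> 3 < 6" "\<phi> 4 < 6" "\<phi> 5 < 6" by simp_all
    have ne: "\<phi> i \<noteq> \<phi> j" if "i < 6" "j < 6" "i \<noteq> j" for i j using \<phi>(2) that by (auto simp: inj_on_def)
    show "xs \<in> set F28_auts"
      unfolding \<phi>(4) by (rule mem_F28_autsI) (use \<phi>(3) lt ne in simp_all)
  next
    fix xs assume "xs \<in> set F28_auts"
    then obtain a b c d e f where xs: "xs = [a, b, c, d, e, f]" and lt: "a < 6" "b < 6" "c < 6" "d < 6" "e < 6" "f < 6"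
      and F: "copy_at F28_adj a b c d e f" and dist: "distinct [a, b, c, d, e, f]"
      by (rule mem_F28_autsE)
    define \<phi> where "\<phi> = (\<lambda>i\<in>{..<6}. xs ! i)"
    have "?m \<phi> = xs" by (simp add: \<phi>_def xs)
    moreover have "\<phi> \<in> copies F28"
    proof -
      have len: "length xs = 6" "distinct xs" "set xs \<subseteq> {..<6}" using xs lt dist by auto
      have "\<phi> \<in> {..<6} \<rightarrow>\<^sub>E {..<6}"
      proof (unfold \<phi>_def restrict_PiE_iff, intro ballI)
        fix i :: nat assume "i \<in> {..<6}"
        hence "xs ! i \<in> set xs" using len(1) by simp
        thus "xs ! i \<in> {..<6}" using len(3) by blast
      qed
      moreover have "inj_on \<phi> {..<6}"
        using nth_eq_iff_index_eq[OF len(2)] len(1) by (auto simp: inj_on_def \<phi>_def)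
      moreover have "is_copy (adj F28) \<phi>"
        using F by (simp add: is_copy_def adj_F28 \<phi>_def xs)
      ultimately show ?thesis by (simp add: copies_def F28_def)
    qed
    ultimately show "xs \<in> ?m ` copies F28" by force
  qed
  thus ?thesis using card_image[OF inj] F28_auts_distinct distinct_card[of F28_auts] by simp
qed

lemma verts_F28 [simp]: "verts F28 = {..<6}"
  by (simp add: F28_def)

lemma isomorphism_F28_iff:
  assumes G: "simple_graph G" and S: "S \<subseteq> verts G"
  shows "isomorphism F28 (induced G S) \<phi> \<longleftrightarrow> bij_betw \<phi> {..<6} S \<and> is_copy (adj G) \<phi>"
proof (cases "bij_betw \<phi> {..<6} S")
  case True
  have in_S: "\<phi> i \<in> S" if "i < 6" for i using True that by (auto simp: bij_betw_def)
  have e: "{\<phi> i, \<phi> j} \<in> edges (induced G S) \<longleftrightarrow> adj G (\<phi> i) (\<phi> j)" if "i < 6" "j < 6" for i j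
    using in_S that by (simp add: induced_def adj_def)
  have loop: "{i, i} \<notin> edges F28" for i by (auto simp: F28_def doubleton_eq_iff)
  have "isomorphism F28 (induced G S) \<phi> \<longleftrightarrow> (\<forall>i<6. \<forall>j<6. ({i, j} \<in> edges F28) = adj G (\<phi> i) (\<phi> j))"
    using True e by (auto simp: isomorphism_def induced_def[THEN arg_cong[where f = fst]])
  also have "\<dots> \<longleftrightarrow> (\<forall>i<6. \<forall>j<6. i \<noteq> j \<longrightarrow> adj G (\<phi> i) (\<phi> j) = ({i, j} \<in> edges F28))"
    using loop adj_irrefl[OF G] by metis
  also have "\<dots> \<longleftrightarrow> is_copy (adj G) \<phi>"
    by (rule is_copy_iff[symmetric]) (rule adj_sym)
  finally show ?thesis using True by simp
next
  case False
  thus ?thesis by (simp add: isomorphism_def induced_def)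
qed

lemma isomorphism_inv:
  assumes "isomorphism G H f"
  shows "isomorphism H G (inv_into (verts G) f)"
proof -
  have b: "bij_betw f (verts G) (verts H)" and e: "\<And>x y. x \<in> verts G \<Longrightarrow> y \<in> verts G \<Longrightarrow> {x, y} \<in> edges G \<longleftrightarrow> {f x, f y} \<in> edges H"
    using assms by (auto simp: isomorphism_def)
  have "{x, y} \<in> edges H \<longleftrightarrow> {inv_into (verts G) f x, inv_into (verts G) f y} \<in> edges G"
    if "x \<in> verts H" "y \<in> verts H" for x y
    using e[of "inv_into (verts G) f x" "inv_into (verts G) f y"] b that
    by (simp add: bij_betw_def f_inv_into_f inv_into_into)
  thus ?thesis using bij_betw_inv_into[OF b] by (simp add: isomorphism_def)
qed

lemma isomorphism_comp:
  assumes f: "isomorphism G H f" and g: "isomorphism H K g"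
  shows "isomorphism G K (g \<circ> f)"
proof -
  have bf: "bij_betw f (verts G) (verts H)" and bg: "bij_betw g (verts H) (verts K)"
    using f g by (simp_all add: isomorphism_def)
  have "{x, y} \<in> edges G \<longleftrightarrow> {(g \<circ> f) x, (g \<circ> f) y} \<in> edges K" if xy: "x \<in> verts G" "y \<in> verts G" for x y
  proof -
    have "f x \<in> verts H" "f y \<in> verts H" using bf xy by (simp_all add: bij_betwE)
    thus ?thesis using f g xy unfolding isomorphism_def by simp
  qed
  thus ?thesis using bij_betw_trans[OF bf bg] by (simp add: isomorphism_def)
qed

lemma isomorphism_cong:
  assumes "\<And>x. x \<in> verts G \<Longrightarrow> f x = g x"
  shows "isomorphism G H f \<longleftrightarrow> isomorphism G H g"
proof -
  have "bij_betw f (verts G) (verts H) \<longleftrightarrow> bij_betw g (verts G) (verts H)"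
    by (rule bij_betw_cong) (rule assms)
  thus ?thesis unfolding isomorphism_def using assms by simp
qed

definition copies_on :: "'v pattern \<Rightarrow> 'v set \<Rightarrow> (nat \<Rightarrow> 'v) set" where
  "copies_on G S = {\<phi> \<in> copies G. \<phi> ` {..<6} = S}"

lemma copies_on_iff:
  assumes "simple_graph G" "S \<subseteq> verts G"
  shows "\<phi> \<in> copies_on G S \<longleftrightarrow> \<phi> \<in> extensional {..<6} \<and> isomorphism F28 (induced G S) \<phi>"
  unfolding isomorphism_F28_iff[OF assms] copies_on_def copies_def PiE_def Pi_def bij_betw_def
  using assms(2) by blast

lemma simple_graph_F28: "simple_graph F28"
  by (auto simp: simple_graph_def F28_def)

lemma copies_on_F28: "copies_on F28 {..<6} = copies F28"
proof -
  have "\<phi> ` {..<6} = {..<6}" if "\<phi> \<in> copies F28" for \<phi>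
  proof (rule endo_inj_surj)
    show "\<phi> ` {..<6} \<subseteq> {..<6}" "inj_on \<phi> {..<6}" using that by (auto simp: copies_def)
  qed simp
  thus ?thesis by (auto simp: copies_on_def)
qed

text \<open>
  Composition with one isomorphism turns automorphisms of \<^const>\<open>F28\<close> into the copies with vertex
  set \<open>S\<close>.
\<close>

lemma card_copies_on:
  assumes iso: "isomorphic (induced G S) F28" and G: "simple_graph G" "S \<subseteq> verts G"
  shows "card (copies_on G S) = 12"
proof -
  let ?H = "induced G S"
  from iso obtain h where h: "isomorphism ?H F28 h" unfolding isomorphic_def by blast
  define g where "g = inv_into (verts ?H) h"
  have g: "isomorphism F28 ?H g" unfolding g_def by (rule isomorphism_inv[OF h])
  have bh: "bij_betw h S {..<6}" using h by (simp add: isomorphism_def induced_def)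
  have bg: "bij_betw g {..<6} S" using g by (simp add: isomorphism_def induced_def)
  have gh: "g (h x) = x" if "x \<in> S" for x
    using that bh by (simp add: g_def induced_def bij_betw_def)
  have hg: "h (g i) = i" if "i < 6" for i
    using that bh by (simp add: g_def induced_def bij_betw_def f_inv_into_f)
  have F28i: "induced F28 {..<6} = F28" by (auto simp: induced_def F28_def)
  have char: "\<phi> \<in> copies_on G S \<longleftrightarrow> \<phi> \<in> extensional {..<6} \<and> isomorphism F28 ?H \<phi>" for \<phi>
    by (rule copies_on_iff[OF G])
  have charF: "\<phi> \<in> copies F28 \<longleftrightarrow> \<phi> \<in> extensional {..<6} \<and> isomorphism F28 F28 \<phi>" for \<phi>
    using copies_on_iff[OF simple_graph_F28, of "{..<6}"] by (simp add: F28i copies_on_F28)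
  have rG: "isomorphism F28 ?H (restrict \<phi> {..<6}) \<longleftrightarrow> isomorphism F28 ?H \<phi>" for \<phi>
    by (rule isomorphism_cong) simp
  have rF: "isomorphism F28 F28 (restrict \<phi> {..<6}) \<longleftrightarrow> isomorphism F28 F28 \<phi>" for \<phi>
    by (rule isomorphism_cong) simp
  have "bij_betw (\<lambda>\<sigma>. restrict (g \<circ> \<sigma>) {..<6}) (copies F28) (copies_on G S)"
  proof (rule bij_betwI[where g = "\<lambda>\<phi>. restrict (h \<circ> \<phi>) {..<6}"])
    show "(\<lambda>\<sigma>. restrict (g \<circ> \<sigma>) {..<6}) \<in> copies F28 \<rightarrow> copies_on G S"
      unfolding Pi_iff char rG using isomorphism_comp[OF _ g] charF restrict_extensional by blast
    show "(\<lambda>\<phi>. restrict (h \<circ> \<phi>) {..<6}) \<in> copies_on G S \<rightarrow> copies F28"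
      unfolding Pi_iff charF rF using isomorphism_comp[OF _ h] char restrict_extensional by blast
    fix \<sigma> assume \<sigma>: "\<sigma> \<in> copies F28"
    hence "\<sigma> i < 6" if "i < 6" for i using that by (auto simp: copies_def)
    thus "restrict (h \<circ> restrict (g \<circ> \<sigma>) {..<6}) {..<6} = \<sigma>"
      using \<sigma> by (intro extensionalityI[of _ "{..<6}"]) (auto simp: hg charF)
  next
    fix \<phi> assume \<phi>: "\<phi> \<in> copies_on G S"
    hence "\<phi> i \<in> S" if "i < 6" for i using that by (auto simp: copies_on_def)
    thus "restrict (g \<circ> restrict (h \<circ> \<phi>) {..<6}) {..<6} = \<phi>"
      using \<phi> by (intro extensionalityI[of _ "{..<6}"]) (auto simp: gh char)
  qed
  thus ?thesis using bij_betw_same_card card_copies_F28 by metis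
qed

lemma finite_copies: "simple_graph G \<Longrightarrow> finite (copies G)"
  unfolding copies_def simple_graph_def by (intro finite_subset[OF _ finite_PiE[of "{..<6}" "\<lambda>_. verts G"]]) auto

lemma card_copies:
  assumes G: "simple_graph G"
  shows "card (copies G) = 12 * card {S. S \<subseteq> verts G \<and> card S = card (verts F28) \<and> isomorphic (induced G S) F28}"
    (is "_ = 12 * card ?\<S>")
proof -
  have fin: "finite (verts G)" using G by (simp add: simple_graph_def)
  have finS: "finite ?\<S>" by (rule finite_subset[of _ "Pow (verts G)"]) (use fin in auto)
  have "copies G = (\<Union>S\<in>?\<S>. copies_on G S)"
  proof (intro equalityI subsetI)
    fix \<phi> assume \<phi>: "\<phi> \<in> copies G"
    let ?S = "\<phi> ` {..<6}"
    have S: "?S \<subseteq> verts G" "card ?S = 6" using \<phi> by (auto simp: copies_def card_image)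
    have on: "\<phi> \<in> copies_on G ?S" using \<phi> by (simp add: copies_on_def)
    hence "isomorphism F28 (induced G ?S) \<phi>" using copies_on_iff[OF G S(1)] by blast
    hence "isomorphic (induced G ?S) F28" using isomorphism_inv unfolding isomorphic_def by blast
    thus "\<phi> \<in> (\<Union>S\<in>?\<S>. copies_on G S)" using S on by (intro UN_I[of ?S]) auto
  qed (auto simp: copies_on_def)
  also have "card \<dots> = (\<Sum>S\<in>?\<S>. card (copies_on G S))"
    by (rule card_UN_disjoint[OF finS]) (use finite_copies[OF G] in \<open>auto simp: copies_on_def\<close>)
  also have "\<dots> = (\<Sum>S\<in>?\<S>. 12)"
    by (rule sum.cong) (use card_copies_on[OF _ G] in auto)
  finally show ?thesis by simp
qed

lemma ind_density_F28:
  assumes G: "simple_graph G"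
  shows "ind_density F28 G = card (copies G) / (12 * (card (verts G) choose 6))"
  unfolding ind_density_def card_copies[OF G] by simp

section \<open>Counting tuples with prescribed pairs\<close>

lemma tsum_card:
  assumes "finite V"
  shows "tsum V (\<lambda>_. 1) (\<lambda>\<phi>. of_bool (P \<phi>)) = card {\<phi> \<in> {..<6} \<rightarrow>\<^sub>E V. P \<phi>}"
proof -
  have "finite ({..<6::nat} \<rightarrow>\<^sub>E V)" using assms by (simp add: finite_PiE)
  thus ?thesis by (simp add: tsum_def of_bool_def sum.If_cases Int_def)
qed

lemma tsum_prod:
  assumes "finite V"
  shows "tsum V m (\<lambda>\<phi>. \<Prod>i<6. g i (\<phi> i)) = (\<Prod>i<6. \<Sum>v\<in>V. m v * g i v)"
  unfolding tsum_def prod.distrib[symmetric]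
  using prod_sum_PiE[of "{..<6::nat}" "\<lambda>_. V" "\<lambda>i v. m v * g i v"] assms by simp

definition wt :: "'v set \<Rightarrow> ('v \<Rightarrow> real) \<Rightarrow> ('v \<Rightarrow> nat) \<Rightarrow> nat \<Rightarrow> real" where
  "wt V m \<kappa> i = (\<Sum>v\<in>V. m v * of_bool (\<kappa> v = i))"

lemma copy_at_linked:
  "copy_at (\<lambda>x y. linked (\<kappa> x) (\<kappa> y)) a b c d e f \<longleftrightarrow>
    (\<kappa> a = 1 \<and> \<kappa> b = 0 \<and> \<kappa> c = 2 \<and> \<kappa> d = 2 \<and> \<kappa> e = 0 \<and> \<kappa> f = 0) \<or>
    (\<kappa> a = 2 \<and> \<kappa> b = 0 \<and> \<kappa> c = 1 \<and> \<kappa> d = 1 \<and> \<kappa> e = 0 \<and> \<kappa> f = 0)"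
  unfolding copy_at_def linked_def by presburger

text \<open>
  The triangle must lie in part 0; the centre of the path is in part 1 or in part 2 and its
  ends are in the other one.
\<close>

lemma tsum_linked:
  assumes fin: "finite V"
  shows "tsum V m (\<lambda>\<phi>. of_bool (is_copy (\<lambda>x y. linked (\<kappa> x) (\<kappa> y)) \<phi>))
    = wt V m \<kappa> 0 ^ 3 * (wt V m \<kappa> 1 * wt V m \<kappa> 2 ^ 2 + wt V m \<kappa> 2 * wt V m \<kappa> 1 ^ 2)"
proof -
  have 6: "{..<6::nat} = {0, 1, 2, 3, 4, 5}" by auto
  have prod6: "(\<Prod>i<6. f i) = f 0 * f 1 * f 2 * f 3 * f 4 * f (5::nat)" for f :: "nat \<Rightarrow> real"
    by (simp add: 6 mult_ac)
  define g :: "nat list \<Rightarrow> nat \<Rightarrow> 'a \<Rightarrow> real" where "g xs i v = of_bool (\<kappa> v = xs ! i)" for xs i v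
  have "of_bool (is_copy (\<lambda>x y. linked (\<kappa> x) (\<kappa> y)) \<phi>)
      = (\<Prod>i<6. g [1, 0, 2, 2, 0, 0] i (\<phi> i)) + (\<Prod>i<6. g [2, 0, 1, 1, 0, 0] i (\<phi> i))" for \<phi>
    unfolding prod6 is_copy_def copy_at_linked g_def by (simp add: of_bool_def)
  hence "tsum V m (\<lambda>\<phi>. of_bool (is_copy (\<lambda>x y. linked (\<kappa> x) (\<kappa> y)) \<phi>))
      = (\<Prod>i<6. \<Sum>v\<in>V. m v * g [1, 0, 2, 2, 0, 0] i v) + (\<Prod>i<6. \<Sum>v\<in>V. m v * g [2, 0, 1, 1, 0, 0] i v)"
    by (simp add: tsum_add tsum_prod[OF fin])
  thus ?thesis unfolding prod6 g_def wt_def[symmetric]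
    by (simp add: power2_eq_square power3_eq_cube algebra_simps)
qed

text \<open>
  Moves any three distinct positions to the first three, where sums can be unnested.
\<close>

lemma perm3_exists:
  fixes i j l :: nat
  assumes "i < 6" "j < 6" "l < 6" "i \<noteq> j" "i \<noteq> l" "j \<noteq> l"
  obtains \<pi> where "\<pi> permutes {..<6::nat}" "\<pi> 0 = i" "\<pi> 1 = j" "\<pi> 2 = l"
proof -
  define p where "p = transpose 0 i"
  have p: "p permutes {..<6}" unfolding p_def using assms by (intro permutes_swap_id) auto
  have pp: "p (p x) = x" for x by (simp add: p_def)
  define j' where "j' = p j"
  have j': "j' < 6" "j' \<noteq> 0" using assms by (auto simp: j'_def p_def transpose_def)
  define q where "q = p \<circ> transpose 1 j'"
  have q: "q permutes {..<6}" unfolding q_def using j' p by (intro permutes_compose[OF permutes_swap_id]) auto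
  have "transpose 1 j' 0 = 0" "transpose 1 j' 1 = j'" using j' by (auto simp: transpose_def)
  hence q0: "q 0 = i" "q 1 = j" by (simp_all add: q_def j'_def pp, simp add: p_def)
  define l' where "l' = inv q l"
  have ql: "q l' = l" unfolding l'_def using q by (simp add: permutes_inverses)
  have l': "l' < 6" using permutes_in_image[OF q, of l'] ql assms(3) by simp
  have "l' \<noteq> 0" "l' \<noteq> 1" using ql q0 assms(5,6) by metis+
  note l' = l' this
  have "q \<circ> transpose 2 l' permutes {..<6}" using l' q by (intro permutes_compose[OF permutes_swap_id]) auto
  moreover have "(q \<circ> transpose 2 l') 0 = i" "(q \<circ> transpose 2 l') 1 = j" "(q \<circ> transpose 2 l') 2 = l"
    using l' q0 ql by (auto simp: transpose_def)
  ultimately show thesis by (rule that)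
qed

lemma tsum_pair:
  fixes i j :: nat
  assumes fin: "finite V" and ij: "i < 6" "j < 6" "i \<noteq> j"
  shows "tsum V m (\<lambda>\<phi>. g (\<phi> i) (\<phi> j)) = (\<Sum>x\<in>V. \<Sum>y\<in>V. m x * m y * g x y) * (\<Sum>v\<in>V. m v) ^ 4"
proof -
  obtain l :: nat where l: "l < 6" "i \<noteq> l" "j \<noteq> l"
  proof (cases "i \<noteq> 0 \<and> j \<noteq> 0")
    case True thus ?thesis using that[of 0] by simp
  next
    case False thus ?thesis using that[of 1] that[of 2] ij by (cases "i = 1 \<or> j = 1") auto
  qed
  obtain \<pi> where \<pi>: "\<pi> permutes {..<6::nat}" "\<pi> 0 = i" "\<pi> 1 = j"
    using perm3_exists[OF ij(1,2) l(1) ij(3) l(2,3)] by metis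
  have "tsum V m (\<lambda>\<phi>. g (\<phi> i) (\<phi> j)) = tsum V m (\<lambda>\<phi>. g (\<phi> 0) (\<phi> 1))"
    using tsum_permute[OF \<pi>(1), of V m "\<lambda>\<phi>. g (\<phi> 0) (\<phi> 1)"] \<pi> by simp
  also have "\<dots> = (\<Sum>a\<in>V. \<Sum>b\<in>V. \<Sum>c\<in>V. \<Sum>d\<in>V. \<Sum>e\<in>V. \<Sum>f\<in>V. m a * m b * m c * m d * m e * m f * g a b)"
    using tsum_nested[of V m "\<lambda>a b c d e f. g a b"] .
  also have "\<dots> = (\<Sum>a\<in>V. \<Sum>b\<in>V. m a * m b * g a b * (\<Sum>v\<in>V. m v) ^ 4)"
  proof (intro sum.cong refl)
    fix a b
    have "(\<Sum>c\<in>V. \<Sum>d\<in>V. \<Sum>e\<in>V. \<Sum>f\<in>V. m a * m b * m c * m d * m e * m f * g a b)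
       = (\<Sum>c\<in>V. \<Sum>d\<in>V. \<Sum>e\<in>V. \<Sum>f\<in>V. (m a * m b * g a b) * (m c * (m d * (m e * m f))))"
      by (intro sum.cong refl) simp
    also have "\<dots> = (m a * m b * g a b) * ((\<Sum>c\<in>V. m c) * ((\<Sum>c\<in>V. m c) * ((\<Sum>c\<in>V. m c) * (\<Sum>c\<in>V. m c))))"
      by (simp only: sum_distrib_left[symmetric] sum_distrib_right[symmetric])
    finally show "(\<Sum>c\<in>V. \<Sum>d\<in>V. \<Sum>e\<in>V. \<Sum>f\<in>V. m a * m b * m c * m d * m e * m f * g a b)
      = m a * m b * g a b * (\<Sum>v\<in>V. m v) ^ 4"
      by (simp add: power4_eq_xxxx mult.assoc)
  qed
  finally show ?thesis by (simp only: sum_distrib_right)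
qed

lemma sum_pairs_card:
  assumes "finite V" "W \<subseteq> V \<times> V"
  shows "(\<Sum>x\<in>V. \<Sum>y\<in>V. of_bool ((x, y) \<in> W)) = real (card W)"
proof -
  have "(\<Sum>x\<in>V. \<Sum>y\<in>V. of_bool ((x, y) \<in> W)) = (\<Sum>p\<in>V \<times> V. of_bool (p \<in> W) :: real)"
    by (simp add: sum.cartesian_product' split_def)
  also have "\<dots> = card W"
    using assms by (simp add: of_bool_def sum.If_cases Int_absorb1)
  finally show ?thesis .
qed

lemma tsum_pair_count:
  fixes i j :: nat
  assumes fin: "finite V" and ij: "i < 6" "j < 6" "i \<noteq> j" and W: "W \<subseteq> V \<times> V"
  shows "tsum V (\<lambda>_. 1) (\<lambda>\<phi>. of_bool ((\<phi> i, \<phi> j) \<in> W)) = real (card W) * real (card V) ^ 4"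
  using tsum_pair[OF fin ij, of "\<lambda>_. 1" "\<lambda>x y. of_bool ((x, y) \<in> W)"] sum_pairs_card[OF fin W] by simp

text \<open>
  The coincidence \<open>\<phi> k = \<phi> l\<close> removes the free choice of \<open>\<phi> l\<close>, because \<open>l\<close> is not one of the
  positions \<open>i, j\<close> that are constrained by \<open>W\<close>.
\<close>

lemma tsum_pair_coincidence:
  fixes i j k l :: nat
  assumes fin: "finite V" and ij: "i < 6" "j < 6" "i \<noteq> j" and kl: "k < 6" "l < 6" "k \<noteq> l"
    and l: "l \<noteq> i" "l \<noteq> j" and W: "W \<subseteq> V \<times> V"
  shows "tsum V (\<lambda>_. 1) (\<lambda>\<phi>. of_bool ((\<phi> i, \<phi> j) \<in> W \<and> \<phi> k = \<phi> l)) = real (card W) * real (card V) ^ 3"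
proof -
  obtain \<pi> where \<pi>: "\<pi> permutes {..<6::nat}" "\<pi> 0 = i" "\<pi> 1 = j" "\<pi> 2 = l"
    using perm3_exists[OF ij(1,2) kl(2) ij(3)] l by metis
  define k' where "k' = inv \<pi> k"
  have k': "\<pi> k' = k" unfolding k'_def using \<pi>(1) by (simp add: permutes_inverses)
  have "k' < 6" "k' \<noteq> 2" using permutes_in_image[OF \<pi>(1), of k'] k' \<pi>(4) kl by auto
  hence "k' = 0 \<or> k' = 1 \<or> k' = 3 \<or> k' = 4 \<or> k' = 5" by auto
  moreover have "tsum V (\<lambda>_. 1) (\<lambda>\<phi>. of_bool ((\<phi> i, \<phi> j) \<in> W \<and> \<phi> k = \<phi> l))
    = tsum V (\<lambda>_. 1) (\<lambda>\<phi>. of_bool ((\<phi> 0, \<phi> 1) \<in> W \<and> \<phi> k' = \<phi> 2))"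
    using tsum_permute[OF \<pi>(1), of V "\<lambda>_. 1" "\<lambda>\<phi>. of_bool ((\<phi> 0, \<phi> 1) \<in> W \<and> \<phi> k' = \<phi> 2)"] \<pi> k' by simp
  moreover have "tsum V (\<lambda>_. 1) (\<lambda>\<phi>. of_bool ((\<phi> 0, \<phi> 1) \<in> W \<and> \<phi> k' = \<phi> 2)) = real (card W) * real (card V) ^ 3"
    if k': "k' = 0 \<or> k' = 1 \<or> k' = 3 \<or> k' = 4 \<or> k' = 5"
  proof -
    let ?sel = "\<lambda>a b d e f. if k' = 0 then a else if k' = 1 then b else if k' = 3 then d else if k' = 4 then e else f"
    have D: "(\<Sum>c\<in>V. of_bool (a = c)) = (1::real)" "(\<Sum>c\<in>V. of_bool (c = a)) = (1::real)" if "a \<in> V" for a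
      using that fin by (simp_all add: of_bool_def)
    \<comment> \<open>The coincidence fixes the third position; its partner may be any other position.\<close>
    have inner: "(\<Sum>c\<in>V. \<Sum>d\<in>V. \<Sum>e\<in>V. \<Sum>f\<in>V. of_bool ((a, b) \<in> W \<and> ?sel a b d e f = c))
        = of_bool ((a, b) \<in> W) * real (card V) ^ 3" if ab: "a \<in> V" "b \<in> V" for a b
    proof (cases "(a, b) \<in> W")
      case True
      have "(\<Sum>c\<in>V. \<Sum>d\<in>V. \<Sum>e\<in>V. \<Sum>f\<in>V. of_bool (?sel a b d e f = c)) = real (card V) ^ 3"
        using k'
      proof (elim disjE)
        assume "k' = 0" thus ?thesis using D(1)[OF ab(1)] by (simp add: sum_distrib_left[symmetric] power3_eq_cube)
      next
        assume "k' = 1" thus ?thesis using D(1)[OF ab(2)] by (simp add: sum_distrib_left[symmetric] power3_eq_cube)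
      next
        assume "k' = 3" thus ?thesis by (simp add: sum_distrib_left[symmetric] D power3_eq_cube)
      next
        assume "k' = 4" thus ?thesis by (simp add: sum_distrib_left[symmetric] D power3_eq_cube)
      next
        assume "k' = 5" thus ?thesis by (simp add: D power3_eq_cube)
      qed
      thus ?thesis using True by simp
    qed simp
    have "tsum V (\<lambda>_. 1) (\<lambda>\<phi>. of_bool ((\<phi> 0, \<phi> 1) \<in> W \<and> \<phi> k' = \<phi> 2))
      = tsum V (\<lambda>_. 1) (\<lambda>\<phi>. of_bool ((\<phi> 0, \<phi> 1) \<in> W \<and> ?sel (\<phi> 0) (\<phi> 1) (\<phi> 3) (\<phi> 4) (\<phi> 5) = \<phi> 2))"
      using k' by (elim disjE) simp_all
    also have "\<dots> = (\<Sum>a\<in>V. \<Sum>b\<in>V. \<Sum>c\<in>V. \<Sum>d\<in>V. \<Sum>e\<in>V. \<Sum>f\<in>V. of_bool ((a, b) \<in> W \<and> ?sel a b d e f = c))"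
      using tsum_nested[of V "\<lambda>_. 1" "\<lambda>a b c d e f. of_bool ((a, b) \<in> W \<and> ?sel a b d e f = c)"] by simp
    also have "\<dots> = (\<Sum>a\<in>V. \<Sum>b\<in>V. of_bool ((a, b) \<in> W) * real (card V) ^ 3)"
      by (intro sum.cong refl inner)
    also have "\<dots> = real (card W) * real (card V) ^ 3"
      by (simp only: sum_distrib_right[symmetric] sum_pairs_card[OF fin W])
    finally show ?thesis .
  qed
  ultimately show ?thesis by simp
qed

lemma coincidence_count:
  fixes i j :: nat
  assumes "finite V" "i < 6" "j < 6" "i \<noteq> j"
  shows "tsum V (\<lambda>_. 1) (\<lambda>\<phi>. of_bool (\<phi> i = \<phi> j)) = real (card V) ^ 5"
proof -
  have "(\<Sum>x\<in>V. \<Sum>y\<in>V. of_bool (x = y)) = real (card V)"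
    using assms(1) by (simp add: of_bool_def)
  thus ?thesis using tsum_pair[OF assms, of "\<lambda>_. 1" "\<lambda>x y. of_bool (x = y)"] by (simp add: numeral_eq_Suc)
qed

section \<open>Near-extremal graphs have few wrong pairs\<close>

abbreviation tcount :: "'v set \<Rightarrow> ((nat \<Rightarrow> 'v) \<Rightarrow> bool) \<Rightarrow> real" where
  "tcount V P \<equiv> tsum V (\<lambda>_. 1) (\<lambda>\<phi>. of_bool (P \<phi>))"

abbreviation bad_tuple :: "('v \<Rightarrow> 'v \<Rightarrow> bool) \<Rightarrow> (nat \<Rightarrow> 'v) \<Rightarrow> bool" where
  "bad_tuple A \<phi> \<equiv> bad A (\<phi> 0) (\<phi> 1) (\<phi> 2) (\<phi> 3) (\<phi> 4) (\<phi> 5)"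

text \<open>
  Ordered pairs whose adjacency would have to be changed to obtain the blowup with part
  assignment \<open>\<kappa>\<close>. Blowups are simple graphs, so the diagonal is left out.
\<close>

definition wrong :: "'v set \<Rightarrow> ('v \<Rightarrow> 'v \<Rightarrow> bool) \<Rightarrow> ('v \<Rightarrow> nat) \<Rightarrow> ('v \<times> 'v) set" where
  "wrong V A \<kappa> = {(x, y) \<in> V \<times> V. x \<noteq> y \<and> A x y \<noteq> linked (\<kappa> x) (\<kappa> y)}"

lemma wrong_subset: "wrong V A \<kappa> \<subseteq> V \<times> V"
  by (auto simp: wrong_def)

lemma attached_unique:
  assumes "attached A a c u v x i" "attached A a c u v x j" "i < 3" "j < 3"
  shows "i = j"
proof -
  have lin: "linked i 0 = (i = 0)" "linked i 1 = (i = 2)" "linked j 0 = (j = 0)" "linked j 1 = (j = 2)"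
    by (auto simp: linked_def)
  have "i = 0 \<longleftrightarrow> j = 0" "i = 2 \<longleftrightarrow> j = 2" using assms(1,2) unfolding attached_def lin by blast+
  thus ?thesis using assms(3,4) by linarith
qed

text \<open>
  Averaging over root tuples. Each copy of \<^const>\<open>F28\<close> contains a root tuple, so there are at least
  \<open>n\<^sup>4 / 512\<close> of them, whereas the flag inequality leaves at most \<open>15360 \<delta> n\<^sup>6\<close> bad tuples.
  Hence some root tuple is in at most \<open>10\<^sup>7 \<delta> n\<^sup>2\<close> bad tuples. Putting each vertex in the part
  predicted by these roots, and in part 0 if there is none, makes every wrong pair bad for
  them.
\<close>

lemma near_extremal_classes:
  fixes A :: "'v \<Rightarrow> 'v \<Rightarrow> bool"
  assumes fin: "finite V" and n: "V \<noteq> {}" and sym: "\<And>x y. A x y = A y x"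
    and \<delta>: "0 < \<delta>" "\<delta> \<le> 1 / 512"
    and F: "tcount V (is_copy A) \<ge> (1 / 256 - \<delta>) * card V ^ 6"
  obtains \<kappa> where "\<And>v. \<kappa> v < 3" "card (wrong V A \<kappa>) \<le> 10 ^ 7 * \<delta> * real (card V) ^ 2"
proof -
  define n where "n = real (card V)"
  have n0: "n > 0" using n fin by (simp add: n_def card_gt_0_iff)
  define r :: "'v \<Rightarrow> 'v \<Rightarrow> 'v \<Rightarrow> 'v \<Rightarrow> real" where "r a c u v = (\<Sum>z\<in>V. \<Sum>w\<in>V. of_bool (bad A a c u v z w))" for a c u v
  have B: "tcount V (bad_tuple A) = (\<Sum>a\<in>V. \<Sum>c\<in>V. \<Sum>u\<in>V. \<Sum>v\<in>V. r a c u v)"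
    using tsum_nested[of V "\<lambda>_. 1" "\<lambda>a c u v z w. of_bool (bad A a c u v z w)"] by (simp add: r_def)
  have Fle: "tcount V (is_copy A) \<le> (\<Sum>a\<in>V. \<Sum>c\<in>V. \<Sum>u\<in>V. \<Sum>v\<in>V. of_bool (root_tuple A a c u v) * n ^ 2)"
  proof -
    have "tcount V (is_copy A) = tsum V (\<lambda>_. 1) (\<lambda>\<phi>. of_bool (copy_at A (\<phi> 1) (\<phi> 0) (\<phi> 2) (\<phi> 3) (\<phi> 4) (\<phi> 5)))"
      unfolding is_copy_def using tsum_index[of 1 0 2 3 4 5 V "\<lambda>_. 1" "\<lambda>a b c d e f. of_bool (copy_at A a b c d e f)"] by simp
    also have "\<dots> = (\<Sum>a\<in>V. \<Sum>c\<in>V. \<Sum>u\<in>V. \<Sum>v\<in>V. \<Sum>z\<in>V. \<Sum>w\<in>V. of_bool (copy_at A c a u v z w))"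
      using tsum_nested[of V "\<lambda>_. 1" "\<lambda>a c u v z w. of_bool (copy_at A c a u v z w)"] by simp
    also have "\<dots> \<le> (\<Sum>a\<in>V. \<Sum>c\<in>V. \<Sum>u\<in>V. \<Sum>v\<in>V. \<Sum>z\<in>V. \<Sum>w\<in>V. of_bool (root_tuple A a c u v))"
    proof (intro sum_mono)
      fix a c u v z w
      have "copy_at A c a u v z w \<Longrightarrow> root_tuple A a c u v" unfolding copy_at_def root_tuple_def sym[of c a] by blast
      thus "of_bool (copy_at A c a u v z w) \<le> (of_bool (root_tuple A a c u v) :: real)" by (simp add: of_bool_def)
    qed
    also have "\<dots> = (\<Sum>a\<in>V. \<Sum>c\<in>V. \<Sum>u\<in>V. \<Sum>v\<in>V. of_bool (root_tuple A a c u v) * n ^ 2)"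
      by (simp add: n_def power2_eq_square mult_ac)
    finally show ?thesis .
  qed
  have flag: "256 * tcount V (is_copy A) + tcount V (bad_tuple A) / 60 \<le> n ^ 6"
    using flag_inequality[OF fin _ sym, of "\<lambda>_. 1"] by (simp add: is_copy_def n_def)
  have "\<exists>a\<in>V. \<exists>c\<in>V. \<exists>u\<in>V. \<exists>v\<in>V. root_tuple A a c u v \<and> r a c u v \<le> 10 ^ 7 * \<delta> * n ^ 2"
  proof (rule ccontr)
    assume *: "\<not> ?thesis"
    have "10 ^ 7 * \<delta> * (of_bool (root_tuple A a c u v) * n ^ 2) \<le> r a c u v" if "a \<in> V" "c \<in> V" "u \<in> V" "v \<in> V" for a c u v
    proof (cases "root_tuple A a c u v")
      case True thus ?thesis using * that by (auto simp: not_le intro: less_imp_le)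
    next
      case False thus ?thesis by (simp add: r_def sum_nonneg)
    qed
    hence "(\<Sum>a\<in>V. \<Sum>c\<in>V. \<Sum>u\<in>V. \<Sum>v\<in>V. 10 ^ 7 * \<delta> * (of_bool (root_tuple A a c u v) * n ^ 2)) \<le> tcount V (bad_tuple A)"
      unfolding B by (intro sum_mono)
    hence "10 ^ 7 * \<delta> * (\<Sum>a\<in>V. \<Sum>c\<in>V. \<Sum>u\<in>V. \<Sum>v\<in>V. of_bool (root_tuple A a c u v) * n ^ 2) \<le> tcount V (bad_tuple A)"
      by (simp only: sum_distrib_left)
    moreover have "10 ^ 7 * \<delta> * tcount V (is_copy A) \<le> 10 ^ 7 * \<delta> * (\<Sum>a\<in>V. \<Sum>c\<in>V. \<Sum>u\<in>V. \<Sum>v\<in>V. of_bool (root_tuple A a c u v) * n ^ 2)"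
      using Fle \<delta>(1) by (intro mult_left_mono) auto
    moreover have F': "tcount V (is_copy A) \<ge> (1 / 256 - \<delta>) * n ^ 6" using F by (simp add: n_def)
    moreover have "10 ^ 7 * \<delta> * (n ^ 6 / 512) \<le> 10 ^ 7 * \<delta> * tcount V (is_copy A)"
    proof (intro mult_left_mono)
      have "n ^ 6 / 512 \<le> (1 / 256 - \<delta>) * n ^ 6" using \<delta>(2) n0 mult_right_mono[of "1/512" "1/256 - \<delta>" "n ^ 6"] by simp
      thus "n ^ 6 / 512 \<le> tcount V (is_copy A)" using F' by simp
    qed (use \<delta> in auto)
    moreover have "(1 / 256 - \<delta>) * n ^ 6 = n ^ 6 / 256 - \<delta> * n ^ 6" by (simp add: algebra_simps)
    ultimately have "10 ^ 7 * (\<delta> * n ^ 6) / 512 \<le> 15360 * (\<delta> * n ^ 6)" using flag by linarith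
    moreover have "\<delta> * n ^ 6 > 0" using \<delta> n0 by simp
    ultimately show False by simp
  qed
  then obtain a c u v where R: "root_tuple A a c u v" and le: "r a c u v \<le> 10 ^ 7 * \<delta> * n ^ 2" by blast
  define \<kappa> where "\<kappa> x = (if \<exists>i<3. attached A a c u v x i then SOME i. i < 3 \<and> attached A a c u v x i else 0)" for x
  have \<kappa>: "\<kappa> x < 3" for x
  proof (cases "\<exists>i<3. attached A a c u v x i")
    case True
    from someI_ex[OF this] show ?thesis using True by (simp add: \<kappa>_def)
  next
    case False thus ?thesis unfolding \<kappa>_def by (simp only: if_False)
  qed
  have \<kappa>_eq: "\<kappa> x = i" if "i < 3" "attached A a c u v x i" for x i
  proof -
    have "(SOME i. i < 3 \<and> attached A a c u v x i) = i"
      using that attached_unique[of A a c u v x _ i] by (intro some_equality) blast+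
    moreover have "\<exists>i<3. attached A a c u v x i" using that by blast
    ultimately show ?thesis by (simp add: \<kappa>_def)
  qed
  define X where "X = {(z, w) \<in> V \<times> V. bad A a c u v z w}"
  have finX: "finite X" "X \<subseteq> V \<times> V" unfolding X_def using fin by (auto intro: finite_subset[of _ "V \<times> V"])
  have "wrong V A \<kappa> \<subseteq> X"
  proof
    fix p assume "p \<in> wrong V A \<kappa>"
    then obtain z w where p: "p = (z, w)" "z \<in> V" "w \<in> V" "A z w \<noteq> linked (\<kappa> z) (\<kappa> w)"
      by (auto simp: wrong_def)
    have "bad A a c u v z w" unfolding bad_def using R p(4) by (auto dest: \<kappa>_eq)
    thus "p \<in> X" using p by (simp add: X_def)
  qed
  hence "real (card (wrong V A \<kappa>)) \<le> real (card X)" using card_mono finX by force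
  also have "\<dots> = (\<Sum>z\<in>V. \<Sum>w\<in>V. of_bool ((z, w) \<in> X))" using sum_pairs_card[OF fin finX(2)] by simp
  also have "\<dots> = r a c u v" unfolding r_def by (intro sum.cong refl) (simp add: X_def)
  finally have "card (wrong V A \<kappa>) \<le> 10 ^ 7 * \<delta> * n ^ 2" using le by linarith
  thus thesis using that[of \<kappa>] \<kappa> by (simp add: n_def)
qed

section \<open>Wrong pairs produce bad tuples\<close>

lemma linked_sym: "linked i j = linked j i"
  by (auto simp: linked_def)

text \<open>
  Isolates the wrong pairs at one vertex, so that the effect of moving this vertex to another
  part can be compared.
\<close>

lemma card_wrong_split:
  assumes fin: "finite V" and x: "x \<in> V" and sym: "\<And>x y. A x y = A y x"
  shows "card (wrong V A \<kappa>) = card (wrong (V - {x}) A \<kappa>) + 2 * card {y \<in> V - {x}. A x y \<noteq> linked (\<kappa> x) (\<kappa> y)}"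
    (is "_ = _ + 2 * card ?D")
proof -
  let ?W' = "wrong (V - {x}) A \<kappa>"
  have fin': "finite ?D" "finite ?W'"
    using fin finite_subset[OF wrong_subset[of "V - {x}" A \<kappa>]] by auto
  have eq: "wrong V A \<kappa> = ?W' \<union> ({x} \<times> ?D \<union> ?D \<times> {x})"
    using x sym linked_sym by (auto simp: wrong_def)
  have "card ({x} \<times> ?D \<union> ?D \<times> {x}) = 2 * card ?D"
    using fin' by (subst card_Un_disjoint) (auto simp: card_cartesian_product)
  thus ?thesis unfolding eq using fin' by (subst card_Un_disjoint) (auto simp: wrong_def)
qed

text \<open>
  Used repeatedly, this turns a union bound into a pointwise inequality between indicators.
\<close>

lemma of_bool_minus: "r \<le> of_bool P \<Longrightarrow> r - of_bool Q \<le> (of_bool (P \<and> \<not> Q) :: real)"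
  by (cases P; cases Q) simp_all

lemma of_bool_mono: "(P \<Longrightarrow> Q) \<Longrightarrow> of_bool P \<le> (of_bool Q :: real)"
  by simp

text \<open>
  A graph with an assignment of its vertices to the parts, with loops chosen as in the blowup.
  With these loops the tuples that repeat a vertex are treated like all others.
\<close>

locale labelled_graph =
  fixes V :: "'v set" and A :: "'v \<Rightarrow> 'v \<Rightarrow> bool" and \<kappa> :: "'v \<Rightarrow> nat"
  assumes fin: "finite V" and nonempty: "V \<noteq> {}" and sym: "A x y = A y x"
    and loop: "A x x \<longleftrightarrow> \<kappa> x = 0" and \<kappa>_less: "\<kappa> x < 3"
begin

abbreviation "W \<equiv> wrong V A \<kappa>"
abbreviation "n \<equiv> real (card V)"
abbreviation "deg x \<equiv> (\<Sum>y\<in>V. of_bool ((x, y) \<in> W) :: real)"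

lemma W_iff: "(x, y) \<in> W \<longleftrightarrow> x \<in> V \<and> y \<in> V \<and> A x y \<noteq> linked (\<kappa> x) (\<kappa> y)"
  by (auto simp: wrong_def loop linked_def)

lemma W_sym: "(x, y) \<in> W \<longleftrightarrow> (y, x) \<in> W"
  using sym[of x y] linked_sym[of "\<kappa> x"] by (auto simp: W_iff)

lemma sum_W: "(\<Sum>x\<in>V. deg x) = card W"
  using sum_pairs_card[OF fin wrong_subset] .

lemma deg_nonneg: "0 \<le> deg x"
  by (intro sum_nonneg) simp

text \<open>
  Vertices of the parts \<open>0, 1, 2, 2\<close> without a wrong pair among them; these form a root tuple.
\<close>

definition clean_root :: "'v \<Rightarrow> 'v \<Rightarrow> 'v \<Rightarrow> 'v \<Rightarrow> bool" where
  "clean_root a c u v \<longleftrightarrow> \<kappa> a = 0 \<and> \<kappa> c = 1 \<and> \<kappa> u = 2 \<and> \<kappa> v = 2 \<and>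
     (a, c) \<notin> W \<and> (a, u) \<notin> W \<and> (a, v) \<notin> W \<and> (c, u) \<notin> W \<and> (c, v) \<notin> W \<and> (u, v) \<notin> W"

definition clean_for :: "'v \<Rightarrow> 'v \<Rightarrow> 'v \<Rightarrow> 'v \<Rightarrow> 'v \<Rightarrow> bool" where
  "clean_for a c u v z \<longleftrightarrow> (z, a) \<notin> W \<and> (z, c) \<notin> W \<and> (z, u) \<notin> W \<and> (z, v) \<notin> W"

lemma clean_root_tuple:
  assumes "clean_root a c u v" "a \<in> V" "c \<in> V" "u \<in> V" "v \<in> V"
  shows "root_tuple A a c u v"
  using assms by (simp add: clean_root_def root_tuple_def W_iff linked_def)

lemma clean_for_attached:
  assumes "clean_root a c u v" "clean_for a c u v z" "a \<in> V" "c \<in> V" "u \<in> V" "v \<in> V" "z \<in> V"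
  shows "attached A a c u v z (\<kappa> z)"
  using assms by (simp add: clean_root_def clean_for_def attached_def W_iff)

text \<open>
  The roots put \<open>w\<close> into its own part and into no other one, so the tuple is bad as soon as
  every possible part of \<open>z\<close> contradicts the adjacency of \<open>z\<close> and \<open>w\<close>.
\<close>

lemma clean_for_bad:
  assumes "clean_root a c u v" "a \<in> V" "c \<in> V" "u \<in> V" "v \<in> V" "w \<in> V" "clean_for a c u v w"
    and "\<And>i. i < 3 \<Longrightarrow> attached A a c u v z i \<Longrightarrow> A z w \<noteq> linked i (\<kappa> w)"
  shows "bad A a c u v z w"
proof -
  have "attached A a c u v w j \<Longrightarrow> j < 3 \<Longrightarrow> j = \<kappa> w" for j
    using attached_unique[OF _ clean_for_attached[OF assms(1,7,2-6)] _ \<kappa>_less] .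
  thus ?thesis unfolding bad_def using clean_root_tuple[OF assms(1-5)] assms(8) by blast
qed

abbreviation sum4 :: "('v \<Rightarrow> 'v \<Rightarrow> 'v \<Rightarrow> 'v \<Rightarrow> real) \<Rightarrow> real" where
  "sum4 F \<equiv> \<Sum>a\<in>V. \<Sum>c\<in>V. \<Sum>u\<in>V. \<Sum>v\<in>V. F a c u v"

lemma sum4_pair:
  shows "sum4 (\<lambda>a c u v. of_bool ((a, c) \<in> W)) = card W * n ^ 2"
    "sum4 (\<lambda>a c u v. of_bool ((a, u) \<in> W)) = card W * n ^ 2"
    "sum4 (\<lambda>a c u v. of_bool ((a, v) \<in> W)) = card W * n ^ 2"
    "sum4 (\<lambda>a c u v. of_bool ((c, u) \<in> W)) = card W * n ^ 2"
    "sum4 (\<lambda>a c u v. of_bool ((c, v) \<in> W)) = card W * n ^ 2"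
    "sum4 (\<lambda>a c u v. of_bool ((u, v) \<in> W)) = card W * n ^ 2"
  by (simp_all add: sum_distrib_left[symmetric] sum_distrib_right[symmetric] sum_W power2_eq_square mult_ac flip: of_nat_sum)

lemma sum4_single:
  fixes f :: "'v \<Rightarrow> real"
  shows "sum4 (\<lambda>a c u v. f a) = (\<Sum>x\<in>V. f x) * n ^ 3"
    "sum4 (\<lambda>a c u v. f c) = (\<Sum>x\<in>V. f x) * n ^ 3"
    "sum4 (\<lambda>a c u v. f u) = (\<Sum>x\<in>V. f x) * n ^ 3"
    "sum4 (\<lambda>a c u v. f v) = (\<Sum>x\<in>V. f x) * n ^ 3"
  by (simp_all add: sum_distrib_left[symmetric] sum_distrib_right[symmetric] power3_eq_cube mult_ac)

lemma sum4_pattern: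
  "sum4 (\<lambda>a c u v. of_bool (\<kappa> a = 0 \<and> \<kappa> c = 1 \<and> \<kappa> u = 2 \<and> \<kappa> v = 2)) =
    wt V (\<lambda>_. 1) \<kappa> 0 * wt V (\<lambda>_. 1) \<kappa> 1 * wt V (\<lambda>_. 1) \<kappa> 2 ^ 2"
  by (simp add: wt_def of_bool_conj sum_distrib_left[symmetric] sum_distrib_right[symmetric] power2_eq_square mult_ac)

lemma sum4_clean_root:
  "sum4 (\<lambda>a c u v. of_bool (clean_root a c u v)) \<ge>
    wt V (\<lambda>_. 1) \<kappa> 0 * wt V (\<lambda>_. 1) \<kappa> 1 * wt V (\<lambda>_. 1) \<kappa> 2 ^ 2 - 6 * (card W * n ^ 2)"
proof -
  have "sum4 (\<lambda>a c u v. of_bool (\<kappa> a = 0 \<and> \<kappa> c = 1 \<and> \<kappa> u = 2 \<and> \<kappa> v = 2) - of_bool ((a, c) \<in> W)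
     - of_bool ((a, u) \<in> W) - of_bool ((a, v) \<in> W) - of_bool ((c, u) \<in> W) - of_bool ((c, v) \<in> W) - of_bool ((u, v) \<in> W))
     \<le> sum4 (\<lambda>a c u v. of_bool (clean_root a c u v) :: real)"
    by (intro sum_mono, rule order_trans[OF _ of_bool_mono], (rule of_bool_minus)+, rule order.refl) (simp add: clean_root_def)
  thus ?thesis unfolding sum_subtractf sum4_pattern sum4_pair by simp
qed

abbreviation rooted_bad :: "'v \<Rightarrow> 'v \<Rightarrow> real" where
  "rooted_bad z w \<equiv> sum4 (\<lambda>a c u v. of_bool (bad A a c u v z w) :: real)"

text \<open>
  A wrong pair is bad for every clean root tuple that has no wrong pair with it, and few root
  tuples are lost if \<open>z\<close> and \<open>w\<close> have few wrong pairs.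
\<close>

lemma rooted_bad_wrong:
  assumes zw: "(z, w) \<in> W"
  shows "rooted_bad z w \<ge> sum4 (\<lambda>a c u v. of_bool (clean_root a c u v)) - 4 * n ^ 3 * (deg z + deg w)"
proof -
  have "sum4 (\<lambda>a c u v. of_bool (clean_root a c u v) - of_bool ((z, a) \<in> W) - of_bool ((z, c) \<in> W)
      - of_bool ((z, u) \<in> W) - of_bool ((z, v) \<in> W) - of_bool ((w, a) \<in> W) - of_bool ((w, c) \<in> W)
      - of_bool ((w, u) \<in> W) - of_bool ((w, v) \<in> W)) \<le> rooted_bad z w"
  proof (intro sum_mono)
    fix a c u v assume V: "a \<in> V" "c \<in> V" "u \<in> V" "v \<in> V"
    have zw': "z \<in> V" "w \<in> V" "A z w \<noteq> linked (\<kappa> z) (\<kappa> w)" using zw by (auto simp: W_iff)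
    have bd: "bad A a c u v z w" if R: "clean_root a c u v" "clean_for a c u v z" "clean_for a c u v w"
    proof (rule clean_for_bad[OF R(1) V zw'(2) R(3)])
      fix i assume "i < 3" "attached A a c u v z i"
      hence "i = \<kappa> z" using attached_unique[OF _ clean_for_attached[OF R(1,2) V zw'(1)] _ \<kappa>_less] by blast
      thus "A z w \<noteq> linked i (\<kappa> w)" using zw'(3) by simp
    qed
    show "of_bool (clean_root a c u v) - of_bool ((z, a) \<in> W) - of_bool ((z, c) \<in> W)
      - of_bool ((z, u) \<in> W) - of_bool ((z, v) \<in> W) - of_bool ((w, a) \<in> W) - of_bool ((w, c) \<in> W)
      - of_bool ((w, u) \<in> W) - of_bool ((w, v) \<in> W) \<le> (of_bool (bad A a c u v z w) :: real)"
      by (rule order_trans[OF _ of_bool_mono], (rule of_bool_minus)+, rule order.refl, rule bd) (simp_all add: clean_for_def)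
  qed
  thus ?thesis unfolding sum_subtractf sum4_single by (simp add: algebra_simps)
qed

lemma sum4_swap:
  fixes f :: "'v \<Rightarrow> 'v \<Rightarrow> 'v \<Rightarrow> 'v \<Rightarrow> 'v \<Rightarrow> real"
  shows "(\<Sum>a\<in>V. \<Sum>c\<in>V. \<Sum>u\<in>V. \<Sum>v\<in>V. \<Sum>w\<in>V. f a c u v w) = (\<Sum>w\<in>V. \<Sum>a\<in>V. \<Sum>c\<in>V. \<Sum>u\<in>V. \<Sum>v\<in>V. f a c u v w)"
proof -
  have "(\<Sum>a\<in>V. \<Sum>c\<in>V. \<Sum>u\<in>V. \<Sum>v\<in>V. \<Sum>w\<in>V. f a c u v w) = (\<Sum>a\<in>V. \<Sum>c\<in>V. \<Sum>u\<in>V. \<Sum>w\<in>V. \<Sum>v\<in>V. f a c u v w)"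
    by (rule sum.cong[OF refl], rule sum.cong[OF refl], rule sum.cong[OF refl], rule sum.swap)
  also have "\<dots> = (\<Sum>a\<in>V. \<Sum>c\<in>V. \<Sum>w\<in>V. \<Sum>u\<in>V. \<Sum>v\<in>V. f a c u v w)"
    by (rule sum.cong[OF refl], rule sum.cong[OF refl], rule sum.swap)
  also have "\<dots> = (\<Sum>a\<in>V. \<Sum>w\<in>V. \<Sum>c\<in>V. \<Sum>u\<in>V. \<Sum>v\<in>V. f a c u v w)"
    by (rule sum.cong[OF refl], rule sum.swap)
  also have "\<dots> = (\<Sum>w\<in>V. \<Sum>a\<in>V. \<Sum>c\<in>V. \<Sum>u\<in>V. \<Sum>v\<in>V. f a c u v w)"
    by (rule sum.swap)
  finally show ?thesis .
qed

text \<open>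
  For a clean root tuple, either \<open>x\<close> is attached to no part, and then every \<open>w\<close> gives a bad
  tuple, or it is attached to some part \<open>i\<close>, and then the at least \<open>h\<close> vertices that contradict
  part \<open>i\<close> do. Only the vertices \<open>w\<close> with a wrong pair to a root are lost.
\<close>

lemma rooted_bad_high:
  assumes x: "x \<in> V" and h: "h \<le> n"
    and min: "\<And>i. i < 3 \<Longrightarrow> h \<le> (\<Sum>y\<in>V. of_bool (A x y \<noteq> linked i (\<kappa> y)))"
  shows "(\<Sum>w\<in>V. rooted_bad x w) \<ge> h * sum4 (\<lambda>a c u v. of_bool (clean_root a c u v)) - 4 * (card W * n ^ 3)"
proof -
  have "sum4 (\<lambda>a c u v. h * of_bool (clean_root a c u v) - deg a - deg c - deg u - deg v)
    \<le> (\<Sum>a\<in>V. \<Sum>c\<in>V. \<Sum>u\<in>V. \<Sum>v\<in>V. \<Sum>w\<in>V. of_bool (bad A a c u v x w))"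
  proof (intro sum_mono)
    fix a c u v assume V: "a \<in> V" "c \<in> V" "u \<in> V" "v \<in> V"
    show "h * of_bool (clean_root a c u v) - deg a - deg c - deg u - deg v \<le> (\<Sum>w\<in>V. of_bool (bad A a c u v x w))"
    proof (cases "clean_root a c u v")
      case False
      have "0 \<le> (\<Sum>w\<in>V. of_bool (bad A a c u v x w) :: real)" by (intro sum_nonneg) simp
      thus ?thesis using False deg_nonneg[of a] deg_nonneg[of c] deg_nonneg[of u] deg_nonneg[of v] by simp
    next
      case True
      obtain Q where Q: "h \<le> (\<Sum>y\<in>V. of_bool (Q y))"
        and Qbad: "\<And>w. w \<in> V \<Longrightarrow> clean_for a c u v w \<Longrightarrow> Q w \<Longrightarrow> bad A a c u v x w"
      proof (cases "\<exists>i<3. attached A a c u v x i")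
        case True
        then obtain i where i: "i < 3" "attached A a c u v x i" by blast
        show thesis
        proof (rule that[of "\<lambda>y. A x y \<noteq> linked i (\<kappa> y)"])
          fix w assume w: "w \<in> V" "clean_for a c u v w" "A x w \<noteq> linked i (\<kappa> w)"
          show "bad A a c u v x w"
            using clean_for_bad[OF \<open>clean_root a c u v\<close> V w(1,2), of x] attached_unique[OF i(2) _ i(1)] w(3) by blast
        qed (rule min[OF i(1)])
      next
        case False
        show thesis
        proof (rule that[of "\<lambda>_. True"])
          fix w assume w: "w \<in> V" "clean_for a c u v w"
          show "bad A a c u v x w" using clean_for_bad[OF \<open>clean_root a c u v\<close> V w, of x] False by blast
        qed (use h in simp)
      qed
      have "(\<Sum>w\<in>V. of_bool (Q w) - of_bool ((a, w) \<in> W) - of_bool ((c, w) \<in> W) - of_bool ((u, w) \<in> W) - of_bool ((v, w) \<in> W))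
          \<le> (\<Sum>w\<in>V. of_bool (bad A a c u v x w) :: real)"
      proof (intro sum_mono)
        fix w assume w: "w \<in> V"
        have bd: "bad A a c u v x w" if q: "(((Q w \<and> (a, w) \<notin> W) \<and> (c, w) \<notin> W) \<and> (u, w) \<notin> W) \<and> (v, w) \<notin> W"
        proof (rule Qbad[OF w])
          show "clean_for a c u v w" unfolding clean_for_def W_sym[of w] using q by blast
        qed (use q in blast)
        show "of_bool (Q w) - of_bool ((a, w) \<in> W) - of_bool ((c, w) \<in> W) - of_bool ((u, w) \<in> W) - of_bool ((v, w) \<in> W)
           \<le> (of_bool (bad A a c u v x w) :: real)"
          by (rule order_trans[OF _ of_bool_mono], (rule of_bool_minus)+, rule order.refl, erule bd)
      qed
      thus ?thesis using True Q unfolding sum_subtractf by simp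
    qed
  qed
  also have "\<dots> = (\<Sum>w\<in>V. rooted_bad x w)"
    using sum4_swap .
  finally have le: "sum4 (\<lambda>a c u v. h * of_bool (clean_root a c u v) - deg a - deg c - deg u - deg v)
    \<le> (\<Sum>w\<in>V. rooted_bad x w)" .
  have "sum4 (\<lambda>a c u v. h * of_bool (clean_root a c u v)) =
    h * sum4 (\<lambda>a c u v. of_bool (clean_root a c u v))"
    by (simp only: sum_distrib_left)
  thus ?thesis using le unfolding sum_subtractf sum4_single[of "\<lambda>x. deg x"] unfolding sum_W by linarith
qed

text \<open>
  If \<open>\<kappa>\<close> minimises the number of wrong pairs, moving \<open>x\<close> to part \<open>i\<close> does not reduce it.
\<close>

lemma deg_le_min:
  assumes x: "x \<in> V" and min: "card (wrong V A \<kappa>) \<le> card (wrong V A (\<kappa>(x := i)))"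
  shows "deg x \<le> (\<Sum>y\<in>V. of_bool (A x y \<noteq> linked i (\<kappa> y)))"
proof -
  let ?D = "{y \<in> V - {x}. A x y \<noteq> linked (\<kappa> x) (\<kappa> y)}"
  let ?N = "{y \<in> V - {x}. A x y \<noteq> linked i (\<kappa> y)}"
  have "wrong (V - {x}) A (\<kappa>(x := i)) = wrong (V - {x}) A \<kappa>" by (auto simp: wrong_def)
  moreover have "{y \<in> V - {x}. A x y \<noteq> linked ((\<kappa>(x := i)) x) ((\<kappa>(x := i)) y)} = ?N" by auto
  ultimately have le: "card ?D \<le> card ?N"
    using min card_wrong_split[OF fin x sym, where \<kappa> = \<kappa>] card_wrong_split[OF fin x sym, where \<kappa> = "\<kappa>(x := i)"] by simp
  have "deg x = card {y \<in> V. (x, y) \<in> W}" using fin by (simp add: Int_def of_bool_def sum.If_cases)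
  also have "{y \<in> V. (x, y) \<in> W} = ?D" using x by (auto simp: wrong_def)
  also have "real (card ?D) \<le> card ?N" using le by simp
  also have "\<dots> = (\<Sum>y\<in>V. if y \<in> ?N then 1 else 0)" using fin by (simp add: sum.If_cases Int_def)
  also have "\<dots> \<le> (\<Sum>y\<in>V. of_bool (A x y \<noteq> linked i (\<kappa> y)))" by (intro sum_mono) simp
  finally show ?thesis .
qed

text \<open>
  Call a vertex high if it forms wrong pairs with more than \<open>n / 20000\<close> vertices. There are at
  least about \<open>n\<^sup>4 / 625\<close> clean root tuples. A wrong pair of two vertices that are not high
  lies in \<open>n\<^sup>4 / 1000\<close> bad tuples, and a high vertex in \<open>n\<^sup>5 / 10\<^sup>8\<close> of them. The wrong pairs
  are covered by these two kinds, a high vertex accounting for at most \<open>2 n\<close> of them.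
\<close>

lemma bad_count_ge:
  assumes min: "\<And>x i. x \<in> V \<Longrightarrow> i < 3 \<Longrightarrow> card W \<le> card (wrong V A (\<kappa>(x := i)))"
    and large: "\<And>i. i < 3 \<Longrightarrow> n / 5 \<le> wt V (\<lambda>_. 1) \<kappa> i"
    and few: "card W \<le> n ^ 2 / 10 ^ 8"
  shows "card W * n ^ 4 / (3 * 10 ^ 8) \<le> tcount V (bad_tuple A)"
proof -
  define S where "S = tcount V (bad_tuple A)"
  define rt where "rt = sum4 (\<lambda>a c u v. of_bool (clean_root a c u v) :: real)"
  define H where "H = {x \<in> V. deg x > n / 20000}"
  define Low where "Low = {(z, w) \<in> W. z \<notin> H \<and> w \<notin> H}"
  have n0: "n > 0" using nonempty fin by (simp add: card_gt_0_iff)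
  have finW: "finite W" by (rule finite_subset[OF wrong_subset]) (simp add: fin)
  have HV: "H \<subseteq> V" "finite H" using fin by (auto simp: H_def)
  have S: "S = (\<Sum>z\<in>V. \<Sum>w\<in>V. rooted_bad z w)"
  proof -
    have "S = tsum V (\<lambda>_. 1) (\<lambda>\<phi>. of_bool (bad A (\<phi> 2) (\<phi> 3) (\<phi> 4) (\<phi> 5) (\<phi> 0) (\<phi> 1)))"
      unfolding S_def using tsum_index[of 2 3 4 5 0 1 V "\<lambda>_. 1" "\<lambda>a b c d e f. of_bool (bad A a b c d e f)"] by simp
    also have "\<dots> = (\<Sum>z\<in>V. \<Sum>w\<in>V. rooted_bad z w)"
      using tsum_nested[of V "\<lambda>_. 1" "\<lambda>z w a c u v. of_bool (bad A a c u v z w)"] by simp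
    finally show ?thesis .
  qed
  have rb0: "rooted_bad z w \<ge> 0" for z w by (intro sum_nonneg) simp
  have S0: "S \<ge> 0" unfolding S by (intro sum_nonneg rb0)
  have few': "card W * n ^ 2 \<le> n ^ 4 / 10 ^ 8" using mult_right_mono[OF few, of "n ^ 2"] by (simp add: power_add[symmetric])
  have few3: "card W * n ^ 3 \<le> n ^ 5 / 10 ^ 8" using mult_right_mono[OF few, of "n ^ 3"] by (simp add: power_add[symmetric])
  have rt: "rt \<ge> n ^ 4 / 625 - 6 * n ^ 4 / 100000000"
  proof -
    have "n ^ 4 / 625 = (n / 5) * (n / 5) * (n / 5) ^ 2" by (simp add: power_divide eval_nat_numeral)
    also have "\<dots> \<le> wt V (\<lambda>_. 1) \<kappa> 0 * wt V (\<lambda>_. 1) \<kappa> 1 * wt V (\<lambda>_. 1) \<kappa> 2 ^ 2"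
      using large[of 0] large[of 1] large[of 2] n0 by (intro mult_mono power_mono mult_nonneg_nonneg) auto
    finally have "n ^ 4 / 625 - 6 * (card W * n ^ 2) \<le> rt" using sum4_clean_root unfolding rt_def by linarith
    thus ?thesis using few' by simp
  qed
  have low: "rooted_bad z w \<ge> n ^ 4 / 1000" if "(z, w) \<in> Low" for z w
  proof -
    have zw: "(z, w) \<in> W" "deg z \<le> n / 20000" "deg w \<le> n / 20000"
      using that wrong_subset[of V A \<kappa>] by (auto simp: Low_def H_def)
    have "4 * n ^ 3 * (deg z + deg w) \<le> 4 * n ^ 3 * (n / 10000)" using zw by (intro mult_left_mono) auto
    also have "\<dots> = n ^ 4 / 2500" by (simp add: eval_nat_numeral)
    finally have "n ^ 4 / 625 - 6 * n ^ 4 / 100000000 - n ^ 4 / 2500 \<le> rooted_bad z w"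
      using rooted_bad_wrong[OF zw(1)] rt unfolding rt_def by linarith
    moreover have "n ^ 4 \<ge> 0" by simp
    ultimately show ?thesis by linarith
  qed
  have high: "(\<Sum>w\<in>V. rooted_bad x w) \<ge> n ^ 5 / 10 ^ 8" if x: "x \<in> H" for x
  proof -
    have xV: "x \<in> V" "n / 20000 \<le> deg x" using x by (auto simp: H_def)
    have "n / 20000 * rt - 4 * (card W * n ^ 3) \<le> (\<Sum>w\<in>V. rooted_bad x w)"
      unfolding rt_def
    proof (rule rooted_bad_high[OF xV(1)])
      show "n / 20000 \<le> (\<Sum>y\<in>V. of_bool (A x y \<noteq> linked i (\<kappa> y)))" if "i < 3" for i
        using order_trans[OF xV(2) deg_le_min[OF xV(1) min[OF xV(1) that]]] .
    qed simp
    moreover have "n / 20000 * (n ^ 4 / 1000) \<le> n / 20000 * rt"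
    proof (intro mult_left_mono)
      have "n ^ 4 \<ge> 0" by simp
      thus "n ^ 4 / 1000 \<le> rt" using rt by linarith
    qed simp
    moreover have "n / 20000 * (n ^ 4 / 1000) = n ^ 5 / 20000000" by (simp add: eval_nat_numeral)
    ultimately show ?thesis using few3 by simp
  qed
  have "card H * (n ^ 5 / 10 ^ 8) = (\<Sum>x\<in>H. n ^ 5 / 10 ^ 8)" by simp
  also have "\<dots> \<le> (\<Sum>x\<in>H. \<Sum>w\<in>V. rooted_bad x w)" by (intro sum_mono high)
  also have "\<dots> \<le> S" unfolding S using HV fin rb0 by (intro sum_mono2 sum_nonneg) auto
  finally have SH: "card H * (n ^ 5 / 10 ^ 8) \<le> S" .
  have "card Low * (n ^ 4 / 1000) = (\<Sum>p\<in>Low. n ^ 4 / 1000)" by simp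
  also have "\<dots> \<le> (\<Sum>p\<in>Low. rooted_bad (fst p) (snd p))" using low by (intro sum_mono) auto
  also have "\<dots> \<le> (\<Sum>p\<in>V\<times>V. rooted_bad (fst p) (snd p))"
    using wrong_subset[of V A \<kappa>] fin rb0 by (intro sum_mono2) (auto simp: Low_def)
  also have "\<dots> = S" unfolding S using sum.cartesian_product[of rooted_bad V V] by (simp only: split_def)
  finally have SL: "card Low * (n ^ 4 / 1000) \<le> S" .
  have "W \<subseteq> Low \<union> (H \<times> V \<union> V \<times> H)" using wrong_subset[of V A \<kappa>] by (auto simp: Low_def)
  hence "card W \<le> card (Low \<union> (H \<times> V \<union> V \<times> H))"
    using finW HV fin by (intro card_mono) (auto simp: Low_def intro: finite_subset[OF _ finW])
  also have "\<dots> \<le> card Low + (card (H \<times> V) + card (V \<times> H))"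
    using card_Un_le[of Low "H \<times> V \<union> V \<times> H"] card_Un_le[of "H \<times> V" "V \<times> H"] by linarith
  finally have "card W \<le> card Low + 2 * card H * card V" by (simp add: card_cartesian_product mult.commute[of "card V"])
  hence "real (card W) \<le> card Low + 2 * card H * n" by (simp flip: of_nat_mult of_nat_add of_nat_le_iff)
  hence "card W * n ^ 4 \<le> (card Low + 2 * card H * n) * n ^ 4" by (intro mult_right_mono) auto
  also have "\<dots> = 1000 * (card Low * (n ^ 4 / 1000)) + 2 * 10 ^ 8 * (card H * (n ^ 5 / 10 ^ 8))"
    by (simp add: algebra_simps eval_nat_numeral)
  also have "\<dots> \<le> 3 * 10 ^ 8 * S" using SL SH S0 by simp
  finally show ?thesis unfolding S_def by simp
qed

end

section \<open>Wrong pairs cost copies\<close>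

definition pairs6 :: "(nat \<times> nat) set" where
  "pairs6 = {(i, j). i < j \<and> j < 6}"

lemma pairs6_eq: "pairs6 = set [(i, j). j \<leftarrow> [0..<6], i \<leftarrow> [0..<j]]"
  by (auto simp: pairs6_def)

lemma finite_pairs6: "finite pairs6" and card_pairs6: "card pairs6 = 15"
proof -
  have d: "distinct [(i, j). j \<leftarrow> [0..<6], i \<leftarrow> [0..<j]] \<and> length [(i, j). j \<leftarrow> [0..<6], i \<leftarrow> [0..<j]] = 15"
    by code_simp
  show "finite pairs6" unfolding pairs6_eq by simp
  show "card pairs6 = 15" unfolding pairs6_eq using d distinct_card by metis
qed

lemma is_copy_cong:
  assumes "\<And>i j. (i, j) \<in> pairs6 \<Longrightarrow> A (\<phi> i) (\<phi> j) = B (\<phi> i) (\<phi> j)"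
  shows "is_copy A \<phi> = is_copy B \<phi>"
  unfolding is_copy_def copy_at_def by (simp add: assms pairs6_def)

lemma not_inj6: "\<not> inj_on \<phi> {..<6} \<longleftrightarrow> (\<exists>p\<in>pairs6. \<phi> (fst p) = \<phi> (snd p))"
proof -
  have "(\<exists>i<6. \<exists>j<6. i \<noteq> j \<and> \<phi> i = \<phi> j) \<longleftrightarrow> (\<exists>j<6. \<exists>i<j. \<phi> i = \<phi> j)" (is "?L = ?R")
  proof
    assume ?L
    then obtain i j where ij: "i < 6" "j < 6" "i \<noteq> j" "\<phi> i = \<phi> j" by blast
    show ?R
    proof (cases "i < j")
      case True thus ?thesis using ij by blast
    next
      case False
      hence "j < i" using ij(3) by simp
      thus ?thesis using ij by metis
    qed
  next
    assume ?R
    then obtain i j where "j < 6" "i < j" "\<phi> i = \<phi> j" by blast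
    moreover from this have "i < 6" "i \<noteq> j" by auto
    ultimately show ?L by blast
  qed
  moreover have "(\<exists>p\<in>pairs6. \<phi> (fst p) = \<phi> (snd p)) \<longleftrightarrow> ?R" unfolding pairs6_def by auto
  moreover have "\<not> inj_on \<phi> {..<6} \<longleftrightarrow> ?L" unfolding inj_on_def by auto
  ultimately show ?thesis by blast
qed

lemma tsum_sum: "tsum V m (\<lambda>\<phi>. \<Sum>p\<in>P. F p \<phi>) = (\<Sum>p\<in>P. tsum V m (F p))"
  unfolding tsum_def sum_distrib_left by (rule sum.swap)

lemma of_bool_le_sum:
  assumes "finite P" "Q \<Longrightarrow> \<exists>p\<in>P. R p"
  shows "of_bool Q \<le> (\<Sum>p\<in>P. of_bool (R p) :: real)"
proof (cases Q)
  case True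
  then obtain p where "p \<in> P" "R p" using assms by blast
  thus ?thesis using member_le_sum[of p P "\<lambda>p. of_bool (R p) :: real"] assms(1) by simp
qed (simp add: sum_nonneg)

lemma noninj_count:
  assumes "finite V"
  shows "tcount V (\<lambda>\<phi>. \<not> inj_on \<phi> {..<6}) \<le> 15 * real (card V) ^ 5"
proof -
  have "tcount V (\<lambda>\<phi>. \<not> inj_on \<phi> {..<6}) \<le> tsum V (\<lambda>_. 1) (\<lambda>\<phi>. \<Sum>p\<in>pairs6. of_bool (\<phi> (fst p) = \<phi> (snd p)))"
    by (intro tsum_mono of_bool_le_sum finite_pairs6) (auto simp: not_inj6)
  also have "\<dots> = (\<Sum>p\<in>pairs6. real (card V) ^ 5)"
    unfolding tsum_sum by (intro sum.cong refl coincidence_count assms) (auto simp: pairs6_def)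
  finally show ?thesis by (simp add: card_pairs6)
qed

context labelled_graph
begin

abbreviation "L \<equiv> (\<lambda>x y. linked (\<kappa> x) (\<kappa> y))"

abbreviation wrong_pairs :: "(nat \<Rightarrow> 'v) \<Rightarrow> real" where
  "wrong_pairs \<phi> \<equiv> (\<Sum>p\<in>pairs6. of_bool ((\<phi> (fst p), \<phi> (snd p)) \<in> W))"

text \<open>
  If no pair of positions of \<open>\<phi>\<close> is wrong, the tuple induces the same looped graph in \<open>A\<close> and
  in the blowup.
\<close>

lemma wrong_pairs_ge:
  assumes "\<phi> \<in> {..<6} \<rightarrow>\<^sub>E V"
  shows "\<bar>of_bool (is_copy L \<phi>) - of_bool (is_copy A \<phi>)\<bar> \<le> wrong_pairs \<phi>"
proof -
  have "is_copy L \<phi> = is_copy A \<phi>" if "\<And>p. p \<in> pairs6 \<Longrightarrow> (\<phi> (fst p), \<phi> (snd p)) \<notin> W"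
  proof (rule is_copy_cong)
    fix i j assume ij: "(i, j) \<in> pairs6"
    hence "\<phi> i \<in> V" "\<phi> j \<in> V" using assms by (auto simp: pairs6_def PiE_def Pi_def)
    thus "L (\<phi> i) (\<phi> j) = A (\<phi> i) (\<phi> j)" using that[OF ij] by (auto simp: W_iff)
  qed
  hence "of_bool (is_copy L \<phi> \<noteq> is_copy A \<phi>) \<le> wrong_pairs \<phi>"
    by (intro of_bool_le_sum finite_pairs6) blast
  thus ?thesis by (cases "is_copy L \<phi>"; cases "is_copy A \<phi>") simp_all
qed

lemma tsum_wrong_pairs: "tsum V (\<lambda>_. 1) wrong_pairs = 15 * (card W * n ^ 4)"
proof -
  have "tsum V (\<lambda>_. 1) wrong_pairs = (\<Sum>p\<in>pairs6. card W * n ^ 4)"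
    unfolding tsum_sum by (intro sum.cong refl tsum_pair_count fin wrong_subset) (auto simp: pairs6_def)
  thus ?thesis by (simp add: card_pairs6)
qed

text \<open>
  Each of the \<open>15 * 15\<close> combinations of a wrong pair with a coincidence loses one factor \<open>n\<close>.
  If both concern the same two positions the combination does not occur, since a wrong pair has
  distinct entries.
\<close>

lemma tsum_wrong_noninj:
  "tsum V (\<lambda>_. 1) (\<lambda>\<phi>. of_bool (\<not> inj_on \<phi> {..<6}) * wrong_pairs \<phi>) \<le> 225 * (card W * n ^ 3)"
proof -
  have "tsum V (\<lambda>_. 1) (\<lambda>\<phi>. of_bool (\<not> inj_on \<phi> {..<6}) * wrong_pairs \<phi>)
    \<le> tsum V (\<lambda>_. 1) (\<lambda>\<phi>. \<Sum>p\<in>pairs6. \<Sum>q\<in>pairs6.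
        of_bool ((\<phi> (fst p), \<phi> (snd p)) \<in> W \<and> \<phi> (fst q) = \<phi> (snd q)))"
  proof (intro tsum_mono)
    fix \<phi> :: "nat \<Rightarrow> 'v"
    have "of_bool (\<not> inj_on \<phi> {..<6}) \<le> (\<Sum>q\<in>pairs6. of_bool (\<phi> (fst q) = \<phi> (snd q)) :: real)"
      by (intro of_bool_le_sum finite_pairs6) (auto simp: not_inj6)
    hence "of_bool (\<not> inj_on \<phi> {..<6}) * wrong_pairs \<phi>
        \<le> (\<Sum>q\<in>pairs6. of_bool (\<phi> (fst q) = \<phi> (snd q))) * wrong_pairs \<phi>"
      by (intro mult_right_mono sum_nonneg) auto
    also have "\<dots> = (\<Sum>p\<in>pairs6. \<Sum>q\<in>pairs6. of_bool ((\<phi> (fst p), \<phi> (snd p)) \<in> W \<and> \<phi> (fst q) = \<phi> (snd q)))"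
      by (simp only: mult.commute[of _ "wrong_pairs \<phi>"] sum_product of_bool_conj)
    finally show "of_bool (\<not> inj_on \<phi> {..<6}) * wrong_pairs \<phi>
      \<le> (\<Sum>p\<in>pairs6. \<Sum>q\<in>pairs6. of_bool ((\<phi> (fst p), \<phi> (snd p)) \<in> W \<and> \<phi> (fst q) = \<phi> (snd q)))" .
  qed simp
  also have "\<dots> = (\<Sum>p\<in>pairs6. \<Sum>q\<in>pairs6.
      tsum V (\<lambda>_. 1) (\<lambda>\<phi>. of_bool ((\<phi> (fst p), \<phi> (snd p)) \<in> W \<and> \<phi> (fst q) = \<phi> (snd q))))"
    by (simp only: tsum_sum)
  also have "\<dots> \<le> (\<Sum>p\<in>pairs6. \<Sum>q\<in>pairs6. card W * n ^ 3)"
  proof (intro sum_mono)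
    fix p q assume "p \<in> pairs6" "q \<in> pairs6"
    then obtain i j k l where p: "p = (i, j)" "i < 6" "j < 6" "i \<noteq> j" and q: "q = (k, l)" "k < 6" "l < 6" "k \<noteq> l" "k < l" "i < j"
      by (auto simp: pairs6_def)
    show "tsum V (\<lambda>_. 1) (\<lambda>\<phi>. of_bool ((\<phi> (fst p), \<phi> (snd p)) \<in> W \<and> \<phi> (fst q) = \<phi> (snd q))) \<le> card W * n ^ 3"
    proof (cases "l \<noteq> i \<and> l \<noteq> j")
      case True
      thus ?thesis using tsum_pair_coincidence[OF fin p(2-4) q(2-4) _ _ wrong_subset] p q by simp
    next
      case l: False
      show ?thesis
      proof (cases "k \<noteq> i \<and> k \<noteq> j")
        case True
        have "tsum V (\<lambda>_. 1) (\<lambda>\<phi>. of_bool ((\<phi> i, \<phi> j) \<in> W \<and> \<phi> l = \<phi> k)) = card W * n ^ 3"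
          using tsum_pair_coincidence[OF fin p(2-4) q(3,2) _ _ _ wrong_subset] True q(4) by simp
        thus ?thesis using p(1) q(1) by (simp add: eq_commute)
      next
        case False
        hence "k = i" "l = j" using l q p by auto
        have no: "((\<phi> i, \<phi> j) \<in> W \<and> \<phi> k = \<phi> l) = False" for \<phi>
          using \<open>k = i\<close> \<open>l = j\<close> by (auto simp: wrong_def)
        show ?thesis unfolding p(1) q(1) fst_conv snd_conv no by (simp add: tsum_def)
      qed
    qed
  qed
  also have "\<dots> = 225 * (card W * n ^ 3)" by (simp add: card_pairs6)
  finally show ?thesis .
qed

definition opt :: "nat \<Rightarrow> real" where
  "opt i = (if i = 0 then 1 / 2 else 1 / 4)"

text \<open>
  These weights give the parts the masses \<open>n / 2, n / 4, n / 4\<close>, for which the flag inequality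
  is an equality on the blowup.
\<close>

definition \<mu> :: "'v \<Rightarrow> real" where
  "\<mu> v = opt (\<kappa> v) * n / wt V (\<lambda>_. 1) \<kappa> (\<kappa> v)"

lemma wt_\<mu>:
  assumes "wt V (\<lambda>_. 1) \<kappa> i > 0"
  shows "wt V \<mu> \<kappa> i = opt i * n"
proof -
  have "wt V \<mu> \<kappa> i = (\<Sum>v\<in>V. opt i * n / wt V (\<lambda>_. 1) \<kappa> i * of_bool (\<kappa> v = i))"
    unfolding wt_def[of V \<mu>] by (intro sum.cong refl) (auto simp: \<mu>_def)
  also have "\<dots> = opt i * n / wt V (\<lambda>_. 1) \<kappa> i * wt V (\<lambda>_. 1) \<kappa> i"
    unfolding wt_def[of V "\<lambda>_. 1"] sum_distrib_left by simp
  finally show ?thesis using assms by simp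
qed

lemma sum_wt: "(\<Sum>v\<in>V. m v) = wt V m \<kappa> 0 + wt V m \<kappa> 1 + wt V m \<kappa> 2"
proof -
  have "m v = m v * of_bool (\<kappa> v = 0) + m v * of_bool (\<kappa> v = 1) + m v * of_bool (\<kappa> v = 2)" for v
    using \<kappa>_less[of v] by (cases "\<kappa> v = 0"; cases "\<kappa> v = 1"; cases "\<kappa> v = 2") auto
  hence "(\<Sum>v\<in>V. m v) = (\<Sum>v\<in>V. m v * of_bool (\<kappa> v = 0) + m v * of_bool (\<kappa> v = 1) + m v * of_bool (\<kappa> v = 2))"
    by (intro sum.cong refl) blast
  thus ?thesis unfolding wt_def by (simp only: sum.distrib)
qed

text \<open>
  With the weights \<open>\<mu>\<close> the flag inequality for \<open>A\<close> says that the blowup has more weighted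
  copies than \<open>A\<close>, by at least \<open>1 / 15360\<close> of the weighted number of bad tuples, hence by at
  least \<open>|W| n\<^sup>4 / 10\<^sup>13\<close>. The counts differ only on tuples with a wrong pair. Passing from \<open>\<mu>\<close>
  to weight 1, and from all tuples to injective ones, therefore costs only a small multiple of
  \<open>|W| n\<^sup>4\<close>. The closeness \<open>10\<^sup>-\<^sup>1\<^sup>8\<close> of the part sizes is chosen so that these losses stay
  below the gain.
\<close>

lemma blowup_count_ge:
  assumes min: "\<And>x i. x \<in> V \<Longrightarrow> i < 3 \<Longrightarrow> card W \<le> card (wrong V A (\<kappa>(x := i)))"
    and close: "\<And>i. i < 3 \<Longrightarrow> \<bar>wt V (\<lambda>_. 1) \<kappa> i - opt i * n\<bar> \<le> n / 10 ^ 18"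
    and few: "card W \<le> n ^ 2 / 10 ^ 8"
    and n: "n \<ge> 10 ^ 18"
  shows "tcount V (\<lambda>\<phi>. is_copy A \<phi> \<and> inj_on \<phi> {..<6}) + card W * n ^ 4 / 10 ^ 14
    \<le> tcount V (\<lambda>\<phi>. is_copy L \<phi> \<and> inj_on \<phi> {..<6})"
proof -
  have n0: "n > 0" using n by simp
  define E where "E = card W * n ^ 4"
  have E0: "E \<ge> 0" by (simp add: E_def)
  have large: "n / 5 \<le> wt V (\<lambda>_. 1) \<kappa> i" if "i < 3" for i
  proof -
    have "n / 4 \<le> opt i * n" using n0 by (simp add: opt_def)
    moreover have "n / 10 ^ 18 \<le> n / 100" using n0 by simp
    ultimately show ?thesis using close[OF that] n0 by linarith
  qed
  hence pos: "wt V (\<lambda>_. 1) \<kappa> i > 0" if "i < 3" for i using that n0 by fastforce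
  have \<mu>: "1 - 1 / 10 ^ 17 \<le> \<mu> v \<and> \<mu> v \<le> 1 + 1 / 10 ^ 17" for v
  proof -
    let ?X = "wt V (\<lambda>_. 1) \<kappa> (\<kappa> v)"
    have "\<bar>?X - opt (\<kappa> v) * n\<bar> \<le> ?X / 10 ^ 17"
      using close[OF \<kappa>_less[of v]] large[OF \<kappa>_less[of v]] by simp
    hence "(1 - 1 / 10 ^ 17) * ?X \<le> opt (\<kappa> v) * n" "opt (\<kappa> v) * n \<le> (1 + 1 / 10 ^ 17) * ?X" by (auto simp: abs_if field_simps split: if_splits)
    thus ?thesis unfolding \<mu>_def using pos[OF \<kappa>_less[of v]] by (simp only: pos_le_divide_eq pos_divide_le_eq)
  qed
  have \<mu>0: "0 \<le> \<mu> v" for v using \<mu>[of v] by simp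
  have prod: "\<bar>(\<Prod>i<6. \<mu> (\<phi> i)) - 1\<bar> \<le> 1 / 10 ^ 16" for \<phi> :: "nat \<Rightarrow> 'v"
  proof -
    have "(\<Prod>i<6::nat. \<mu> (\<phi> i)) \<le> (\<Prod>i<6::nat. 1 + 1 / 10 ^ 17)" using \<mu> \<mu>0 by (intro prod_mono) auto
    also have "\<dots> \<le> 1 + 1 / 10 ^ 16" by (simp add: field_simps)
    finally have "(\<Prod>i<6::nat. \<mu> (\<phi> i)) \<le> 1 + 1 / 10 ^ 16" .
    moreover have "(\<Prod>i<6::nat. 1 - 1 / 10 ^ 17) \<le> (\<Prod>i<6::nat. \<mu> (\<phi> i))" using \<mu> by (intro prod_mono) auto
    moreover have "1 - 1 / 10 ^ 16 \<le> (\<Prod>i<6::nat. 1 - 1 / 10 ^ 17 :: real)" by (simp add: field_simps)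
    ultimately show ?thesis by linarith
  qed
  define l where "l \<phi> = (of_bool (is_copy L \<phi>) :: real)" for \<phi>
  define f where "f \<phi> = (of_bool (is_copy A \<phi>) :: real)" for \<phi>
  have opt: "opt 0 = 1 / 2" "opt 1 = 1 / 4" "opt 2 = 1 / 4" by (simp_all add: opt_def)
  have wts: "wt V \<mu> \<kappa> 0 = n / 2" "wt V \<mu> \<kappa> 1 = n / 4" "wt V \<mu> \<kappa> 2 = n / 4"
    using wt_\<mu>[OF pos, of 0] wt_\<mu>[OF pos, of 1] wt_\<mu>[OF pos, of 2] unfolding opt by simp_all
  have sum_\<mu>: "(\<Sum>v\<in>V. \<mu> v) = n" unfolding sum_wt wts by simp
  have "256 * tsum V \<mu> l = n ^ 6" unfolding l_def tsum_linked[OF fin] wts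
    by (simp add: power_divide field_simps eval_nat_numeral)
  moreover have "256 * tsum V \<mu> f + tsum V \<mu> (\<lambda>\<phi>. of_bool (bad_tuple A \<phi>)) / 60 \<le> n ^ 6"
    using flag_inequality[of V \<mu> A, OF fin \<mu>0 sym] unfolding f_def is_copy_def sum_\<mu> .
  ultimately have flag: "tsum V \<mu> (\<lambda>\<phi>. of_bool (bad_tuple A \<phi>)) / 15360 \<le> tsum V \<mu> l - tsum V \<mu> f" by simp
  have bad: "E / (6 * 10 ^ 8) \<le> tsum V \<mu> (\<lambda>\<phi>. of_bool (bad_tuple A \<phi>))"
  proof -
    have "E / (6 * 10 ^ 8) \<le> 1 / 2 * tcount V (bad_tuple A)"
      using bad_count_ge[OF min large few] unfolding E_def by simp
    also have "\<dots> \<le> tsum V \<mu> (\<lambda>\<phi>. of_bool (bad_tuple A \<phi>))"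
      unfolding tsum_def sum_distrib_left
    proof (intro sum_mono)
      fix \<phi> :: "nat \<Rightarrow> 'v"
      have "1 / 10 ^ 16 \<le> (1 / 2 :: real)" by simp
      hence "1 / 2 \<le> (\<Prod>i<6. \<mu> (\<phi> i))" using prod[of \<phi>] by linarith
      thus "1 / 2 * ((\<Prod>i<6::nat. 1) * of_bool (bad_tuple A \<phi>)) \<le> (\<Prod>i<6. \<mu> (\<phi> i)) * of_bool (bad_tuple A \<phi>)" by simp
    qed
    finally show ?thesis .
  qed
  have unweight: "tsum V \<mu> l - tsum V \<mu> f \<le> tsum V (\<lambda>_. 1) l - tsum V (\<lambda>_. 1) f + 15 * E / 10 ^ 16"
  proof -
    have "tsum V \<mu> l - tsum V \<mu> f = (\<Sum>\<phi>\<in>{..<6} \<rightarrow>\<^sub>E V. (\<Prod>i<6. \<mu> (\<phi> i)) * (l \<phi> - f \<phi>))"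
      unfolding tsum_diff[symmetric] by (simp add: tsum_def)
    also have "\<dots> \<le> (\<Sum>\<phi>\<in>{..<6} \<rightarrow>\<^sub>E V. (l \<phi> - f \<phi>) + 1 / 10 ^ 16 * wrong_pairs \<phi>)"
    proof (intro sum_mono)
      fix \<phi> :: "nat \<Rightarrow> 'v" assume \<phi>: "\<phi> \<in> {..<6} \<rightarrow>\<^sub>E V"
      have "((\<Prod>i<6. \<mu> (\<phi> i)) - 1) * (l \<phi> - f \<phi>) \<le> \<bar>(\<Prod>i<6. \<mu> (\<phi> i)) - 1\<bar> * \<bar>l \<phi> - f \<phi>\<bar>"
        by (simp add: abs_mult[symmetric])
      also have "\<dots> \<le> 1 / 10 ^ 16 * wrong_pairs \<phi>"
        using prod[of \<phi>] wrong_pairs_ge[OF \<phi>] unfolding l_def f_def by (intro mult_mono) auto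
      finally show "(\<Prod>i<6. \<mu> (\<phi> i)) * (l \<phi> - f \<phi>) \<le> (l \<phi> - f \<phi>) + 1 / 10 ^ 16 * wrong_pairs \<phi>"
        by (simp add: algebra_simps)
    qed
    also have "\<dots> = tsum V (\<lambda>_. 1) l - tsum V (\<lambda>_. 1) f + 1 / 10 ^ 16 * tsum V (\<lambda>_. 1) wrong_pairs"
      unfolding sum.distrib sum_subtractf by (simp add: tsum_def sum_distrib_left)
    finally show ?thesis unfolding tsum_wrong_pairs E_def by simp
  qed
  have inj: "tsum V (\<lambda>_. 1) l - tsum V (\<lambda>_. 1) f \<le> tcount V (\<lambda>\<phi>. is_copy L \<phi> \<and> inj_on \<phi> {..<6})
     - tcount V (\<lambda>\<phi>. is_copy A \<phi> \<and> inj_on \<phi> {..<6}) + 225 * (card W * n ^ 3)"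
  proof -
    have "tsum V (\<lambda>_. 1) (\<lambda>\<phi>. l \<phi> - f \<phi>) \<le> tsum V (\<lambda>_. 1) (\<lambda>\<phi>. (of_bool (is_copy L \<phi> \<and> inj_on \<phi> {..<6})
        - of_bool (is_copy A \<phi> \<and> inj_on \<phi> {..<6})) + of_bool (\<not> inj_on \<phi> {..<6}) * wrong_pairs \<phi>)"
    proof (intro tsum_mono)
      fix \<phi> :: "nat \<Rightarrow> 'v" assume \<phi>: "\<phi> \<in> {..<6} \<rightarrow>\<^sub>E V"
      show "l \<phi> - f \<phi> \<le> (of_bool (is_copy L \<phi> \<and> inj_on \<phi> {..<6})
        - of_bool (is_copy A \<phi> \<and> inj_on \<phi> {..<6})) + of_bool (\<not> inj_on \<phi> {..<6}) * wrong_pairs \<phi>"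
      proof (cases "inj_on \<phi> {..<6}")
        case True thus ?thesis by (simp add: l_def f_def)
      next
        case False
        thus ?thesis using wrong_pairs_ge[OF \<phi>] unfolding l_def f_def by simp
      qed
    qed simp
    thus ?thesis using tsum_wrong_noninj unfolding tsum_add tsum_diff by linarith
  qed
  \<comment> \<open>Absorbs the lower order term of the passage to injective tuples; this is why \<open>n\<close> must be large.\<close>
  have W3: "card W * n ^ 3 \<le> E / 10 ^ 18"
  proof -
    have "card W * n ^ 3 * 10 ^ 18 \<le> card W * n ^ 3 * n" using n by (intro mult_left_mono) auto
    thus ?thesis by (simp add: E_def eval_nat_numeral mult_ac)
  qed
  have pw: "(10::real) ^ 18 = 1000000000000000000" "(10::real) ^ 16 = 10000000000000000"
    "(10::real) ^ 14 = 100000000000000" "(10::real) ^ 8 = 100000000" by simp_all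
  from W3 show ?thesis
    using inj unweight flag bad E0 unfolding E_def[symmetric] pw by linarith
qed

end

section \<open>Part sizes of near-optimal blowups\<close>

text \<open>
  The density of six-tuples that form a copy of \<^const>\<open>F28\<close> in a blowup of \<^const>\<open>B28\<close> with part ratios
  \<open>x0, x1, x2\<close>.
\<close>

definition lagrangian :: "real \<Rightarrow> real \<Rightarrow> real \<Rightarrow> real" where
  "lagrangian x0 x1 x2 = x0 ^ 3 * (x1 * x2 ^ 2 + x2 * x1 ^ 2)"

text \<open>
  With \<open>P = x0 (x1 + x2) = 1 / 4 - (x0 - 1 / 2)\<^sup>2\<close> the polynomial is \<open>(P\<^sup>3 - P x0\<^sup>2 (x1 -
  x2)\<^sup>2) / 4\<close>. Near the maximum both losses against \<open>(1 / 4)\<^sup>3 / 4\<close> are squares times factors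
  bounded away from 0. For \<open>\<gamma> = 0\<close> this is the uniqueness of the maximiser.
\<close>

lemma lagrangian_stable:
  fixes x0 x1 x2 \<gamma> :: real
  assumes x: "x0 \<ge> 0" "x1 \<ge> 0" "x2 \<ge> 0" "x0 + x1 + x2 = 1" and \<gamma>: "0 \<le> \<gamma>" "\<gamma> \<le> 1 / 10 ^ 4"
    and f: "1 / 256 - \<gamma> \<le> x0 ^ 3 * (x1 * x2 ^ 2 + x2 * x1 ^ 2)"
  shows "(x0 - 1 / 2)\<^sup>2 \<le> 64 * \<gamma>" "(x1 - x2)\<^sup>2 \<le> 512 * \<gamma>"
proof -
  define s where "s = x1 + x2"
  define P where "P = x0 * s"
  have x0: "x0 = 1 - s" using x by (simp add: s_def)
  have y: "(x0 - 1 / 2)\<^sup>2 = 1 / 4 - P" by (simp add: P_def x0 power2_eq_square algebra_simps)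
  have P: "0 \<le> P" "P \<le> 1 / 4" using x y zero_le_power2[of "x0 - 1 / 2"] by (auto simp: P_def s_def)
  have eq: "4 * (x0 ^ 3 * (x1 * x2 ^ 2 + x2 * x1 ^ 2)) = P ^ 3 - P * x0\<^sup>2 * (x1 - x2)\<^sup>2"
    by (simp add: P_def s_def power2_eq_square power3_eq_cube algebra_simps)
  have P3: "1 / 64 - 4 * \<gamma> \<le> P ^ 3 - P * x0\<^sup>2 * (x1 - x2)\<^sup>2" using f eq by linarith
  have pos: "0 \<le> P * x0\<^sup>2 * (x1 - x2)\<^sup>2" using P by simp
  have "1 / 16 * (1 / 4 - P) \<le> (1 / 16 + P / 4 + P ^ 2) * (1 / 4 - P)" using P by (intro mult_right_mono) auto
  also have "\<dots> = 1 / 64 - P ^ 3" by (simp add: power2_eq_square power3_eq_cube field_simps)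
  also have "\<dots> \<le> 4 * \<gamma>" using P3 pos by linarith
  finally have P64: "1 / 4 - P \<le> 64 * \<gamma>" by simp
  thus y64: "(x0 - 1 / 2)\<^sup>2 \<le> 64 * \<gamma>" using y by simp
  have "(x0 - 1 / 2)\<^sup>2 \<le> (1 / 4)\<^sup>2" using y64 \<gamma> by (simp add: power2_eq_square)
  hence "\<bar>x0 - 1 / 2\<bar> \<le> 1 / 4" using abs_le_square_iff[of "x0 - 1 / 2" "1 / 4"] by simp
  hence "1 / 4 \<le> x0" by linarith
  hence "(1 / 4)\<^sup>2 \<le> x0\<^sup>2" by (intro power_mono) auto
  moreover have "1 / 8 \<le> P" using P64 \<gamma> by simp
  ultimately have "1 / 8 * (1 / 4)\<^sup>2 \<le> P * x0\<^sup>2" using P by (intro mult_mono) auto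
  hence "1 / 128 * (x1 - x2)\<^sup>2 \<le> P * x0\<^sup>2 * (x1 - x2)\<^sup>2" by (intro mult_right_mono) (auto simp: power2_eq_square)
  moreover have "P ^ 3 \<le> (1 / 4) ^ 3" using P by (intro power_mono) auto
  ultimately show "(x1 - x2)\<^sup>2 \<le> 512 * \<gamma>" using P3 by (simp add: power3_eq_cube)
qed

lemma lagrangian_le:
  fixes x0 x1 x2 :: real
  assumes x: "x0 \<ge> 0" "x1 \<ge> 0" "x2 \<ge> 0" "x0 + x1 + x2 = 1"
  shows "x0 ^ 3 * (x1 * x2 ^ 2 + x2 * x1 ^ 2) \<le> 1 / 256"
proof -
  define P where "P = x0 * (x1 + x2)"
  have x0: "x0 = 1 - (x1 + x2)" using x by simp
  have y: "(x0 - 1 / 2)\<^sup>2 = 1 / 4 - P" by (simp add: P_def x0 power2_eq_square algebra_simps)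
  have P: "0 \<le> P" "P \<le> 1 / 4" using x y zero_le_power2[of "x0 - 1 / 2"] by (auto simp: P_def)
  have eq: "4 * (x0 ^ 3 * (x1 * x2 ^ 2 + x2 * x1 ^ 2)) = P ^ 3 - P * x0\<^sup>2 * (x1 - x2)\<^sup>2"
    by (simp add: P_def power2_eq_square power3_eq_cube algebra_simps)
  moreover have "P ^ 3 \<le> (1 / 4) ^ 3" using P by (intro power_mono) auto
  moreover have "0 \<le> P * x0\<^sup>2 * (x1 - x2)\<^sup>2" using P by simp
  ultimately show ?thesis by (simp add: power3_eq_cube)
qed

context labelled_graph
begin

lemma near_optimal_close:
  assumes many: "(1 / 256 - 1 / 10 ^ 40) * n ^ 6 \<le> tcount V (is_copy L)" and i: "i < 3"
  shows "\<bar>wt V (\<lambda>_. 1) \<kappa> i - opt i * n\<bar> \<le> n / 10 ^ 18"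
proof -
  have n0: "n > 0" using nonempty fin by (simp add: card_gt_0_iff)
  define x where "x j = wt V (\<lambda>_. 1) \<kappa> j / n" for j
  have wt: "wt V (\<lambda>_. 1) \<kappa> j = x j * n" for j using n0 by (simp add: x_def)
  have x0: "0 \<le> x j" for j by (simp add: x_def wt_def sum_nonneg)
  have x1: "x 0 + x 1 + x 2 = 1" using sum_wt[of "\<lambda>_. 1"] n0 by (simp add: x_def add_divide_distrib[symmetric])
  have eq: "tcount V (is_copy L) = x 0 ^ 3 * (x 1 * x 2 ^ 2 + x 2 * x 1 ^ 2) * n ^ 6"
    unfolding tsum_linked[OF fin] wt by (simp add: eval_nat_numeral algebra_simps)
  have "n ^ 6 > 0" using n0 by simp
  with many[unfolded eq] have f: "1 / 256 - 1 / 10 ^ 40 \<le> x 0 ^ 3 * (x 1 * x 2 ^ 2 + x 2 * x 1 ^ 2)"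
    by (rule mult_right_le_imp_le)
  have y: "\<bar>x 0 - 1 / 2\<bar> \<le> 23 / 10 ^ 20" and t: "\<bar>x 1 - x 2\<bar> \<le> 23 / 10 ^ 20"
  proof -
    have "(x 0 - 1 / 2)\<^sup>2 \<le> 64 * (1 / 10 ^ 40)" "(x 1 - x 2)\<^sup>2 \<le> 512 * (1 / 10 ^ 40)"
      by (rule lagrangian_stable[OF x0 x0 x0 x1 _ _ f]; simp)+
    hence "(x 0 - 1 / 2)\<^sup>2 \<le> (23 / 10 ^ 20)\<^sup>2" "(x 1 - x 2)\<^sup>2 \<le> (23 / 10 ^ 20)\<^sup>2"
      by (simp_all add: power2_eq_square)
    thus "\<bar>x 0 - 1 / 2\<bar> \<le> 23 / 10 ^ 20" "\<bar>x 1 - x 2\<bar> \<le> 23 / 10 ^ 20"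
      using abs_le_square_iff[of "x 0 - 1 / 2" "23 / 10 ^ 20"] abs_le_square_iff[of "x 1 - x 2" "23 / 10 ^ 20"] by simp_all
  qed
  have c: "23 / 10 ^ 20 \<le> (1 / 10 ^ 18 :: real)" by simp
  have "\<bar>x 1 - 1 / 4\<bar> \<le> 23 / 10 ^ 20" "\<bar>x 2 - 1 / 4\<bar> \<le> 23 / 10 ^ 20"
    using y t x1 by linarith+
  hence "\<bar>x 0 - opt 0\<bar> \<le> 1 / 10 ^ 18" "\<bar>x 1 - opt 1\<bar> \<le> 1 / 10 ^ 18" "\<bar>x 2 - opt 2\<bar> \<le> 1 / 10 ^ 18"
    using order_trans[OF _ c] y by (simp_all only: opt_def) simp_all
  moreover have "i = 0 \<or> i = 1 \<or> i = 2" using i by auto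
  ultimately have "\<bar>x i - opt i\<bar> \<le> 1 / 10 ^ 18" by metis
  hence "\<bar>x i - opt i\<bar> * n \<le> 1 / 10 ^ 18 * n" using n0 by (intro mult_right_mono) auto
  moreover have "\<bar>x i - opt i\<bar> * n = \<bar>x i * n - opt i * n\<bar>" using n0 by (simp add: abs_mult left_diff_distrib[symmetric])
  ultimately show ?thesis unfolding wt by simp
qed

lemma linked_count_ge: "tcount V (is_copy A) - 15 * (card W * n ^ 4) \<le> tcount V (is_copy L)"
proof -
  have "tcount V (is_copy A) \<le> tsum V (\<lambda>_. 1) (\<lambda>\<phi>. of_bool (is_copy L \<phi>) + wrong_pairs \<phi>)"
  proof (intro tsum_mono)
    fix \<phi> :: "nat \<Rightarrow> 'v" assume "\<phi> \<in> {..<6} \<rightarrow>\<^sub>E V"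
    thus "of_bool (is_copy A \<phi>) \<le> of_bool (is_copy L \<phi>) + wrong_pairs \<phi>" using wrong_pairs_ge[of \<phi>] by linarith
  qed simp
  thus ?thesis unfolding tsum_add tsum_wrong_pairs by linarith
qed

end

section \<open>Blowups, edit distance and maximum density\<close>

text \<open>
  An injective tuple never looks at the diagonal, so loops may be chosen at will.
\<close>

lemma card_copies_eq:
  assumes G: "simple_graph G" and A: "\<And>x y. x \<in> verts G \<Longrightarrow> y \<in> verts G \<Longrightarrow> x \<noteq> y \<Longrightarrow> A x y = adj G x y"
  shows "real (card (copies G)) = tcount (verts G) (\<lambda>\<phi>. is_copy A \<phi> \<and> inj_on \<phi> {..<6})"
proof -
  have fin: "finite (verts G)" using G by (simp add: simple_graph_def)
  have "is_copy A \<phi> = is_copy (adj G) \<phi>" if "\<phi> \<in> {..<6} \<rightarrow>\<^sub>E verts G" "inj_on \<phi> {..<6}" for \<phi>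
  proof (rule is_copy_cong)
    fix i j assume "(i, j) \<in> pairs6"
    hence ij: "i < 6" "j < 6" "i \<noteq> j" by (auto simp: pairs6_def)
    hence "\<phi> i \<in> verts G" "\<phi> j \<in> verts G" using that(1) by auto
    moreover have "\<phi> i \<noteq> \<phi> j" using inj_onD[OF that(2), of i j] ij by auto
    ultimately show "A (\<phi> i) (\<phi> j) = adj G (\<phi> i) (\<phi> j)" by (rule A)
  qed
  hence "copies G = {\<phi> \<in> {..<6} \<rightarrow>\<^sub>E verts G. is_copy A \<phi> \<and> inj_on \<phi> {..<6}}"
    unfolding copies_def by blast
  thus ?thesis unfolding tsum_card[OF fin] by simp
qed

definition class_graph :: "'v set \<Rightarrow> ('v \<Rightarrow> nat) \<Rightarrow> 'v pattern" where
  "class_graph V \<kappa> = (V, {{x, y} | x y. x \<in> V \<and> y \<in> V \<and> x \<noteq> y \<and> linked (\<kappa> x) (\<kappa> y)})"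

lemma verts_class_graph [simp]: "verts (class_graph V \<kappa>) = V"
  by (simp add: class_graph_def)

lemma simple_class_graph: "finite V \<Longrightarrow> simple_graph (class_graph V \<kappa>)"
  by (auto simp: class_graph_def simple_graph_def)

lemma adj_class_graph:
  "adj (class_graph V \<kappa>) x y \<longleftrightarrow> x \<in> V \<and> y \<in> V \<and> x \<noteq> y \<and> linked (\<kappa> x) (\<kappa> y)"
  unfolding adj_def class_graph_def snd_conv using linked_sym by (fastforce simp: doubleton_eq_iff)

lemma edges_B28: "i < 3 \<Longrightarrow> j < 3 \<Longrightarrow> {i, j} \<in> edges B28 \<longleftrightarrow> linked i j"
  by (auto simp: B28_def linked_def doubleton_eq_iff)

lemma verts_B28: "verts B28 = {..<3}"
  by (simp add: B28_def)

lemma blowup_B28_eq: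
  assumes "\<And>x. x \<in> V \<Longrightarrow> \<kappa> x < 3" "\<And>x i. i < 3 \<Longrightarrow> x \<in> P i \<longleftrightarrow> x \<in> V \<and> \<kappa> x = i"
  shows "blowup B28 P = class_graph V \<kappa>"
proof -
  have "(\<Union>i\<in>{..<3}. P i) = V" using assms by auto
  moreover have "(\<exists>i\<in>{..<3}. \<exists>j\<in>{..<3}. x \<in> P i \<and> y \<in> P j \<and> {i, j} \<in> edges B28)
      \<longleftrightarrow> x \<in> V \<and> y \<in> V \<and> linked (\<kappa> x) (\<kappa> y)" for x y
  proof
    assume "\<exists>i\<in>{..<3}. \<exists>j\<in>{..<3}. x \<in> P i \<and> y \<in> P j \<and> {i, j} \<in> edges B28"
    then obtain i j where "i < 3" "j < 3" "x \<in> P i" "y \<in> P j" "{i, j} \<in> edges B28" by auto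
    thus "x \<in> V \<and> y \<in> V \<and> linked (\<kappa> x) (\<kappa> y)" using assms(2) edges_B28 by auto
  next
    assume H: "x \<in> V \<and> y \<in> V \<and> linked (\<kappa> x) (\<kappa> y)"
    hence "\<kappa> x < 3" "\<kappa> y < 3" using assms(1) by auto
    thus "\<exists>i\<in>{..<3}. \<exists>j\<in>{..<3}. x \<in> P i \<and> y \<in> P j \<and> {i, j} \<in> edges B28"
      using H assms(2) edges_B28 by (intro bexI[of _ "\<kappa> x"] bexI[of _ "\<kappa> y"]) auto
  qed
  ultimately show ?thesis unfolding blowup_def class_graph_def verts_B28
    by (auto simp: conj_ac)
qed

lemma class_graph_blowups:
  fixes V :: "nat set"
  assumes "finite V" "\<And>x. x \<in> V \<Longrightarrow> \<kappa> x < 3"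
  shows "class_graph V \<kappa> \<in> blowups B28"
proof -
  let ?P = "\<lambda>i. {v \<in> V. \<kappa> v = i}"
  have "blowup B28 ?P = class_graph V \<kappa>" by (rule blowup_B28_eq) (use assms in auto)
  moreover have "blowup_parts B28 ?P" using assms(1) by (auto simp: blowup_parts_def disjoint_family_on_def)
  ultimately show ?thesis unfolding blowups_def by force
qed

lemma isomorphic_refl: "isomorphic G G"
  unfolding isomorphic_def isomorphism_def by (intro exI[of _ id]) auto

text \<open>
  The blowup with part assignment \<open>\<kappa>\<close> is one of the competitors, and each edge to be changed
  gives a wrong pair.
\<close>

lemma edit_distance_le:
  assumes G: "simple_graph G" and \<kappa>: "\<And>x. \<kappa> x < 3"
  shows "edit_distance G B28 \<le> card (wrong (verts G) (adj G) \<kappa>)"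
proof -
  let ?V = "verts G" let ?H = "class_graph ?V \<kappa>"
  let ?D = "\<lambda>H. (edges G - edges H) \<union> (edges H - edges G)"
  let ?S = "{card (?D H) | H. simple_graph H \<and> verts H = ?V \<and> (\<exists>H'\<in>blowups B28. isomorphic H H')}"
  have fin: "finite ?V" using G by (simp add: simple_graph_def)
  have edge: "\<exists>x y. e = {x, y} \<and> x \<in> verts K \<and> y \<in> verts K \<and> x \<noteq> y" if "simple_graph K" "e \<in> edges K"
    for e and K :: "nat pattern"
    using that by (auto simp: simple_graph_def card_2_iff) (metis insert_subset)
  have "finite ?S"
  proof (rule finite_subset)
    show "?S \<subseteq> {..card (Pow ?V)}"
    proof
      fix k assume "k \<in> ?S"
      then obtain H :: "nat pattern" where H: "k = card (?D H)" "simple_graph H" "verts H = ?V" by blast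
      hence "?D H \<subseteq> Pow ?V" using G unfolding simple_graph_def by blast
      hence "card (?D H) \<le> card (Pow ?V)" using fin by (intro card_mono) auto
      thus "k \<in> {..card (Pow ?V)}" using H(1) by simp
    qed
  qed simp
  moreover have H: "simple_graph ?H" by (rule simple_class_graph[OF fin])
  moreover have "\<exists>H'\<in>blowups B28. isomorphic ?H H'"
    by (rule bexI[OF isomorphic_refl class_graph_blowups[OF fin \<kappa>]])
  moreover have "verts ?H = ?V" by simp
  ultimately have "edit_distance G B28 \<le> card (?D ?H)"
    unfolding edit_distance_def by (intro Min_le) blast+
  also have "?D ?H \<subseteq> (\<lambda>(x, y). {x, y}) ` wrong ?V (adj G) \<kappa>"
  proof
    fix e assume e: "e \<in> ?D ?H"
    then obtain x y where xy: "e = {x, y}" "x \<in> ?V" "y \<in> ?V" "x \<noteq> y"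
      using edge[OF G, of e] edge[OF H, of e] by auto
    have "adj G x y \<noteq> adj ?H x y" using e unfolding xy(1) adj_def by blast
    hence "(x, y) \<in> wrong ?V (adj G) \<kappa>" using xy by (auto simp: wrong_def adj_class_graph)
    thus "e \<in> (\<lambda>(x, y). {x, y}) ` wrong ?V (adj G) \<kappa>" using xy(1) by (force intro: image_eqI[of _ _ "(x, y)"])
  qed
  hence "card (?D ?H) \<le> card (wrong ?V (adj G) \<kappa>)"
    by (rule surj_card_le[rotated]) (rule finite_subset[OF wrong_subset], simp add: fin)
  finally show ?thesis .
qed

text \<open>
  Needed for \<^const>\<open>Max\<close>: the numerator of a density is at most \<open>2\<^sup>k\<close>.
\<close>

lemma finite_densities:
  "finite {ind_density F28 G | G :: nat pattern. simple_graph G \<and> card (verts G) = k}" (is "finite ?S")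
proof (rule finite_subset)
  show "?S \<subseteq> (\<lambda>m. real m / real (k choose card (verts F28))) ` {..2 ^ k}"
  proof clarify
    fix G :: "nat pattern" assume G: "simple_graph G" "k = card (verts G)"
    have "card {S. S \<subseteq> verts G \<and> card S = card (verts F28) \<and> isomorphic (induced G S) F28} \<le> card (Pow (verts G))"
      using G(1) by (intro card_mono) (auto simp: simple_graph_def)
    also have "\<dots> = 2 ^ card (verts G)" using G(1) by (simp add: simple_graph_def card_Pow)
    finally show "ind_density F28 G \<in> (\<lambda>m. real m / real (card (verts G) choose card (verts F28))) ` {..2 ^ card (verts G)}"
      unfolding ind_density_def by (intro image_eqI[OF refl]) simp
  qed
qed simp

lemma max_density_ge:
  fixes G :: "nat pattern"
  assumes "simple_graph G"
  shows "ind_density F28 G \<le> max_density F28 (card (verts G))"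
  unfolding max_density_def by (rule Max_ge[OF finite_densities]) (use assms in blast)

lemma max_density_attained:
  obtains H :: "nat pattern" where "simple_graph H" "card (verts H) = k" "max_density F28 k = ind_density F28 H"
proof -
  have "simple_graph ({..<k}, {})" "card (verts ({..<k} :: nat set, {} :: nat set set)) = k" by (simp_all add: simple_graph_def)
  hence "{ind_density F28 G | G :: nat pattern. simple_graph G \<and> card (verts G) = k} \<noteq> {}" by blast
  from Max_in[OF finite_densities this] show thesis using that unfolding max_density_def by blast
qed

lemma choose6_le: "12 * real (n choose 6) \<le> real n ^ 6 / 60"
proof -
  have "(n choose 6) * fact 6 \<le> n ^ 6" by (rule binomial_fact_pow)
  hence "real ((n choose 6) * 720) \<le> real (n ^ 6)" by (simp only: of_nat_le_iff) (simp add: fact_numeral)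
  thus ?thesis by simp
qed

lemma choose6_limit: "(\<lambda>n. 12 * real (n choose 6) / real n ^ 6) \<longlonglongrightarrow> 1 / 60"
proof -
  let ?q = "\<lambda>n. 1 / real n"
  let ?g = "\<lambda>n. (1 - ?q n) * (1 - 2 * ?q n) * (1 - 3 * ?q n) * (1 - 4 * ?q n) * (1 - 5 * ?q n) / 60"
  have "?g \<longlonglongrightarrow> (1 - 0) * (1 - 2 * 0) * (1 - 3 * 0) * (1 - 4 * 0) * (1 - 5 * 0) / 60"
    by (intro tendsto_intros lim_1_over_n) simp
  moreover have "\<forall>\<^sub>F n in sequentially. ?g n = 12 * real (n choose 6) / real n ^ 6"
    using eventually_gt_at_top[of 0]
  proof eventually_elim
    case (elim n)
    have "real (n choose 6) = real n * (real n - 1) * (real n - 2) * (real n - 3) * (real n - 4) * (real n - 5) / 720"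
      unfolding binomial_gbinomial gbinomial_prod_rev by (simp add: numeral_eq_Suc)
    also have "\<dots> = real n ^ 6 * ?g n / 12"
    proof -
      have "real n - c = real n * (1 - c * ?q n)" for c using elim by (simp add: field_simps)
      from this[of 1] this[of 2] this[of 3] this[of 4] this[of 5] show ?thesis by (simp add: eval_nat_numeral)
    qed
    finally have *: "real (n choose 6) = real n ^ 6 * ?g n / 12" .
    have "N \<noteq> 0 \<Longrightarrow> x = N * g / 12 \<Longrightarrow> g = 12 * x / N" for N g x :: real by (simp add: field_simps)
    from this[OF _ *] show ?case using elim by simp
  qed
  ultimately show ?thesis using Lim_transform_eventually by fastforce
qed

section \<open>Limit densities of blowups\<close>

lemma copies_class_graph_bounds:
  assumes fin: "finite V"
  shows "real (card (copies (class_graph V \<kappa>))) \<le> lagrangian (wt V (\<lambda>_. 1) \<kappa> 0) (wt V (\<lambda>_. 1) \<kappa> 1) (wt V (\<lambda>_. 1) \<kappa> 2)"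
    and "lagrangian (wt V (\<lambda>_. 1) \<kappa> 0) (wt V (\<lambda>_. 1) \<kappa> 1) (wt V (\<lambda>_. 1) \<kappa> 2) - 15 * real (card V) ^ 5 \<le> real (card (copies (class_graph V \<kappa>)))"
proof -
  let ?L = "\<lambda>x y. linked (\<kappa> x) (\<kappa> y)"
  have c: "real (card (copies (class_graph V \<kappa>))) = tcount V (\<lambda>\<phi>. is_copy ?L \<phi> \<and> inj_on \<phi> {..<6})"
    using card_copies_eq[OF simple_class_graph[OF fin, of \<kappa>], of ?L] by (simp add: adj_class_graph)
  have l: "tcount V (is_copy ?L) = lagrangian (wt V (\<lambda>_. 1) \<kappa> 0) (wt V (\<lambda>_. 1) \<kappa> 1) (wt V (\<lambda>_. 1) \<kappa> 2)"
    unfolding tsum_linked[OF fin] lagrangian_def ..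
  show "real (card (copies (class_graph V \<kappa>))) \<le> lagrangian (wt V (\<lambda>_. 1) \<kappa> 0) (wt V (\<lambda>_. 1) \<kappa> 1) (wt V (\<lambda>_. 1) \<kappa> 2)"
    unfolding c l[symmetric] by (intro tsum_mono) simp_all
  have "tcount V (is_copy ?L) \<le> tsum V (\<lambda>_. 1) (\<lambda>\<phi>. of_bool (is_copy ?L \<phi> \<and> inj_on \<phi> {..<6}) + of_bool (\<not> inj_on \<phi> {..<6}))"
    by (intro tsum_mono) simp_all
  thus "lagrangian (wt V (\<lambda>_. 1) \<kappa> 0) (wt V (\<lambda>_. 1) \<kappa> 1) (wt V (\<lambda>_. 1) \<kappa> 2) - 15 * real (card V) ^ 5 \<le> real (card (copies (class_graph V \<kappa>)))"
    unfolding c l[symmetric] tsum_add using noninj_count[OF fin] by linarith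
qed

text \<open>
  Disjointness of the parts allows a part assignment to be read off.
\<close>

lemma blowup_classes:
  assumes "blowup_parts B28 P"
  obtains \<kappa> where "\<And>x. \<kappa> x < 3" "blowup B28 P = class_graph (\<Union>i\<in>{..<3}. P i) \<kappa>"
    "\<And>i. i < 3 \<Longrightarrow> {v \<in> (\<Union>i\<in>{..<3}. P i). \<kappa> v = i} = P i"
proof -
  define \<kappa> where "\<kappa> x = (if \<exists>i<3. x \<in> P i then SOME i. i < 3 \<and> x \<in> P i else 0)" for x
  have disj: "i = j" if "i < 3" "j < 3" "x \<in> P i" "x \<in> P j" for x i j
    using assms that unfolding blowup_parts_def disjoint_family_on_def verts_B28 by blast
  have \<kappa>: "\<kappa> x < 3 \<and> x \<in> P (\<kappa> x)" if "\<exists>i<3. x \<in> P i" for x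
    using someI_ex[OF that] that unfolding \<kappa>_def by simp
  have lt: "\<kappa> x < 3" for x
  proof (cases "\<exists>i<3. x \<in> P i")
    case False thus ?thesis unfolding \<kappa>_def by (simp only: if_False)
  qed (use \<kappa> in blast)
  have iff: "x \<in> P i \<longleftrightarrow> x \<in> (\<Union>i\<in>{..<3}. P i) \<and> \<kappa> x = i" if "i < 3" for x i
    using \<kappa>[of x] disj[of i "\<kappa> x" x] that by blast
  show thesis
  proof (rule that[OF lt])
    show "blowup B28 P = class_graph (\<Union>i\<in>{..<3}. P i) \<kappa>" by (rule blowup_B28_eq[OF lt iff])
    show "{v \<in> (\<Union>i\<in>{..<3}. P i). \<kappa> v = i} = P i" if "i < 3" for i using iff[OF that] by blast
  qed
qed

text \<open>
  The injective tuples differ from all tuples by \<open>O(n\<^sup>5)\<close>, and the normalisation uses the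
  actual number of vertices, which is only asymptotically \<open>n\<close>.
\<close>

lemma blowup_limit:
  fixes V :: "nat \<Rightarrow> nat \<Rightarrow> nat set"
  assumes parts: "\<And>n. blowup_parts B28 (V n)"
    and lim: "\<And>i. i < 3 \<Longrightarrow> (\<lambda>n. real (card (V n i)) / real n) \<longlonglongrightarrow> x i"
    and x: "x 0 + x 1 + x 2 = 1"
  shows "(\<lambda>n. ind_density F28 (blowup B28 (V n))) \<longlonglongrightarrow> 60 * lagrangian (x 0) (x 1) (x 2)"
proof -
  define U where "U n = (\<Union>i\<in>{..<3}. V n i)" for n
  have "\<exists>\<kappa>. (\<forall>x. \<kappa> x < 3) \<and> blowup B28 (V n) = class_graph (U n) \<kappa> \<and> (\<forall>i<3. {v \<in> U n. \<kappa> v = i} = V n i)" for n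
    using blowup_classes[OF parts[of n]] unfolding U_def by metis
  then obtain \<kappa> where \<kappa>: "\<And>n x. \<kappa> n x < (3::nat)" "\<And>n. blowup B28 (V n) = class_graph (U n) (\<kappa> n)"
    "\<And>n i. i < 3 \<Longrightarrow> {v \<in> U n. \<kappa> n v = i} = V n i" by metis
  have finV: "finite (V n i)" if "i < 3" for n i
    using parts[of n] that by (simp add: blowup_parts_def verts_B28)
  hence fin: "finite (U n)" for n by (simp add: U_def)
  define X where "X n i = real (card (V n i))" for n i
  define N where "N n = card (U n)" for n
  have wt: "wt (U n) (\<lambda>_. 1) (\<kappa> n) i = X n i" if "i < 3" for n i
    using fin[of n] \<kappa>(3)[OF that, of n] by (simp add: wt_def X_def Int_def of_bool_def sum.If_cases)
  have NX: "real (N n) = X n 0 + X n 1 + X n 2" for n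
  proof -
    have "U n = V n 0 \<union> V n 1 \<union> V n 2" unfolding U_def by (auto simp: numeral_3_eq_3 less_Suc_eq numeral_2_eq_2)
    moreover have "V n i \<inter> V n j = {}" if "i < 3" "j < 3" "i \<noteq> j" for i j
      using parts[of n] that unfolding blowup_parts_def disjoint_family_on_def verts_B28 by blast
    from this[of 0 1] this[of 0 2] this[of 1 2] have "V n 0 \<inter> V n 1 = {}" "(V n 0 \<union> V n 1) \<inter> V n 2 = {}" by auto
    ultimately show ?thesis using finV by (simp add: N_def X_def card_Un_disjoint)
  qed
  have limX: "(\<lambda>n. X n i / real n) \<longlonglongrightarrow> x i" if "i < 3" for i using lim[OF that] by (simp add: X_def)
  have limN: "(\<lambda>n. real (N n) / real n) \<longlonglongrightarrow> 1"
    using tendsto_add[OF tendsto_add[OF limX[of 0] limX[of 1]] limX[of 2]] x by (simp add: NX add_divide_distrib)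
  have Ntop: "filterlim N at_top sequentially"
  proof -
    have "filterlim (\<lambda>n. real (N n) / real n * real n) at_top sequentially"
      by (rule filterlim_tendsto_pos_mult_at_top[OF limN]) (simp_all add: filterlim_real_sequentially)
    moreover have "\<forall>\<^sub>F n in sequentially. real (N n) / real n * real n = real (N n)"
      using eventually_gt_at_top[of 0] by eventually_elim simp
    ultimately have "filterlim (\<lambda>n. real (N n)) at_top sequentially"
      using filterlim_cong[OF refl refl] by fastforce
    thus ?thesis by (simp add: filterlim_sequentially_iff_filterlim_real)
  qed
  define c where "c n = real (card (copies (blowup B28 (V n))))" for n
  define l where "l n = lagrangian (X n 0) (X n 1) (X n 2)" for n
  have bounds: "c n \<le> l n" "l n - 15 * real (N n) ^ 5 \<le> c n" for n
    using copies_class_graph_bounds[OF fin[of n], of "\<kappa> n"] unfolding c_def l_def N_def \<kappa>(2) by (simp_all add: wt)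
  have l6: "l n / real n ^ 6 = lagrangian (X n 0 / n) (X n 1 / n) (X n 2 / n)" for n
    by (cases "n = 0") (simp_all add: l_def lagrangian_def field_simps eval_nat_numeral)
  have liml: "(\<lambda>n. l n / real n ^ 6) \<longlonglongrightarrow> lagrangian (x 0) (x 1) (x 2)"
    unfolding l6 lagrangian_def by (intro tendsto_intros limX) simp_all
  have "(\<lambda>n. l n / real n ^ 6 - 15 * (real (N n) / real n) ^ 5 * (1 / real n)) \<longlonglongrightarrow> lagrangian (x 0) (x 1) (x 2) - 15 * 1 ^ 5 * 0"
    by (intro tendsto_intros liml limN lim_1_over_n)
  hence low: "(\<lambda>n. l n / real n ^ 6 - 15 * (real (N n) / real n) ^ 5 * (1 / real n)) \<longlonglongrightarrow> lagrangian (x 0) (x 1) (x 2)"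
    by simp
  have limc: "(\<lambda>n. c n / real n ^ 6) \<longlonglongrightarrow> lagrangian (x 0) (x 1) (x 2)"
  proof (rule tendsto_sandwich[OF _ _ low liml])
    show "\<forall>\<^sub>F n in sequentially. c n / real n ^ 6 \<le> l n / real n ^ 6"
      using bounds(1) by (simp add: divide_right_mono)
    show "\<forall>\<^sub>F n in sequentially. l n / real n ^ 6 - 15 * (real (N n) / real n) ^ 5 * (1 / real n) \<le> c n / real n ^ 6"
      using eventually_gt_at_top[of 0]
    proof eventually_elim
      case (elim n)
      have "(l n - 15 * real (N n) ^ 5) / real n ^ 6 \<le> c n / real n ^ 6" using bounds(2) by (simp add: divide_right_mono)
      thus ?case using elim by (simp add: diff_divide_distrib power_divide eval_nat_numeral)
    qed
  qed
  have limb: "(\<lambda>n. 12 * real (N n choose 6) / real (N n) ^ 6) \<longlonglongrightarrow> 1 / 60"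
    by (rule filterlim_compose[OF choose6_limit Ntop])
  have "(\<lambda>n. (c n / real n ^ 6) / (12 * real (N n choose 6) / real (N n) ^ 6 * (real (N n) / real n) ^ 6))
      \<longlonglongrightarrow> lagrangian (x 0) (x 1) (x 2) / (1 / 60 * 1 ^ 6)"
    by (rule tendsto_divide[OF limc tendsto_mult[OF limb tendsto_power[OF limN]]]) simp
  moreover have "\<forall>\<^sub>F n in sequentially. (c n / real n ^ 6) / (12 * real (N n choose 6) / real (N n) ^ 6 * (real (N n) / real n) ^ 6)
      = ind_density F28 (blowup B28 (V n))"
    using eventually_gt_at_top[of 0] eventually_compose_filterlim[OF eventually_gt_at_top[of 0] Ntop]
  proof eventually_elim
    case (elim n)
    have "ind_density F28 (blowup B28 (V n)) = c n / (12 * real (N n choose 6))"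
      unfolding c_def \<kappa>(2) ind_density_F28[OF simple_class_graph[OF fin]] by (simp add: N_def)
    thus ?case using elim by (simp add: power_divide)
  qed
  ultimately show ?thesis by (simp add: tendsto_cong mult.commute)
qed

text \<open>
  For the definite description it must be known that blowups with the given part ratios exist,
  as otherwise every \<open>L\<close> would qualify.
\<close>

lemma blowup_density_F28:
  assumes "x \<in> std_simplex 3"
  shows "blowup_density F28 B28 x = 60 * lagrangian (x ! 0) (x ! 1) (x ! 2)"
proof -
  have len: "length x = 3" and x0: "\<And>i. i < 3 \<Longrightarrow> 0 \<le> x ! i" and x1: "x ! 0 + x ! 1 + x ! 2 = 1"
    using assms by (auto simp: std_simplex_def numeral_3_eq_3 numeral_2_eq_2)
  let ?P = "\<lambda>L. \<forall>V :: nat \<Rightarrow> nat \<Rightarrow> nat set. (\<forall>n. blowup_parts B28 (V n)) \<and>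
        (\<forall>i\<in>verts B28. (\<lambda>n. real (card (V n i)) / real n) \<longlonglongrightarrow> x ! i) \<longrightarrow>
        (\<lambda>n. ind_density F28 (blowup B28 (V n))) \<longlonglongrightarrow> L"
  have P: "?P (60 * lagrangian (x ! 0) (x ! 1) (x ! 2))"
    using blowup_limit[of _ "(!) x"] x1 by (auto simp: verts_B28)
  \<comment> \<open>Residues modulo 3 keep the three parts disjoint.\<close>
  define V where "V n i = (\<lambda>k. 3 * k + i) ` {..<nat \<lfloor>x ! i * n\<rfloor>}" for n i :: nat
  have parts: "blowup_parts B28 (V n)" for n
    unfolding blowup_parts_def disjoint_family_on_def verts_B28 V_def by (auto dest: arg_cong[of _ _ "\<lambda>k. k mod 3"])
  have card: "card (V n i) = nat \<lfloor>x ! i * n\<rfloor>" for n i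
    unfolding V_def by (subst card_image) (auto intro: inj_onI)
  have lim: "(\<lambda>n. real (card (V n i)) / real n) \<longlonglongrightarrow> x ! i" if "i < 3" for i
  proof (rule tendsto_sandwich)
    have "(\<lambda>n. x ! i - 1 / real n) \<longlonglongrightarrow> x ! i - 0" by (intro tendsto_intros lim_1_over_n)
    thus "(\<lambda>n. x ! i - 1 / real n) \<longlonglongrightarrow> x ! i" by simp
    show "\<forall>\<^sub>F n in sequentially. x ! i - 1 / real n \<le> real (card (V n i)) / real n"
      using eventually_gt_at_top[of 0]
    proof eventually_elim
      case (elim n)
      have "x ! i * n - 1 \<le> of_int \<lfloor>x ! i * n\<rfloor>" by linarith
      also have "\<dots> \<le> real (card (V n i))" unfolding card by simp
      finally have "(x ! i * n - 1) / n \<le> real (card (V n i)) / n" by (rule divide_right_mono) simp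
      thus ?case using elim by (simp add: diff_divide_distrib)
    qed
    show "\<forall>\<^sub>F n in sequentially. real (card (V n i)) / real n \<le> x ! i"
      using eventually_gt_at_top[of 0]
    proof eventually_elim
      case (elim n)
      have "real (card (V n i)) \<le> x ! i * n" unfolding card using x0[OF that] by simp
      thus ?case using elim by (simp add: field_simps)
    qed
  qed simp
  show ?thesis unfolding blowup_density_def
  proof (rule the_equality[where P = ?P, OF P])
    fix L assume "?P L"
    hence "(\<lambda>n. ind_density F28 (blowup B28 (V n))) \<longlonglongrightarrow> L" using parts lim by (auto simp: verts_B28)
    moreover have "(\<lambda>n. ind_density F28 (blowup B28 (V n))) \<longlonglongrightarrow> 60 * lagrangian (x ! 0) (x ! 1) (x ! 2)"
      by (rule blowup_limit) (use parts lim x1 in auto)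
    ultimately show "L = 60 * lagrangian (x ! 0) (x ! 1) (x ! 2)" by (rule LIMSEQ_unique)
  qed
qed

section \<open>Maximum density and perfect stability\<close>

lemma card_copies_le:
  assumes G: "simple_graph G"
  shows "real (card (copies G)) \<le> real (card (verts G)) ^ 6 / 256"
proof -
  have fin: "finite (verts G)" using G by (simp add: simple_graph_def)
  have "real (card (copies G)) \<le> tcount (verts G) (is_copy (adj G))"
    unfolding card_copies_eq[OF G refl] by (intro tsum_mono) simp_all
  moreover have "256 * tcount (verts G) (is_copy (adj G)) + tcount (verts G) (bad_tuple (adj G)) / 60 \<le> real (card (verts G)) ^ 6"
    using flag_inequality[OF fin _ adj_sym, of "\<lambda>_. 1"] by (simp add: is_copy_def)
  moreover have "0 \<le> tcount (verts G) (bad_tuple (adj G))" unfolding tsum_def by (intro sum_nonneg) simp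
  ultimately show ?thesis by simp
qed

lemma div_ratio_limit:
  assumes "0 < k"
  shows "(\<lambda>n. real (n div k) / real n) \<longlonglongrightarrow> 1 / real k"
proof (rule tendsto_sandwich)
  have "(\<lambda>n. 1 / real k - 1 / real n) \<longlonglongrightarrow> 1 / real k - 0" by (intro tendsto_intros lim_1_over_n)
  thus "(\<lambda>n. 1 / real k - 1 / real n) \<longlonglongrightarrow> 1 / real k" by simp
  show "\<forall>\<^sub>F n in sequentially. 1 / real k - 1 / real n \<le> real (n div k) / real n"
    using eventually_gt_at_top[of 0]
  proof eventually_elim
    case (elim n)
    have "n mod k < k" using assms by simp
    hence "n \<le> k * (n div k) + k" using mult_div_mod_eq[of k n] by linarith
    hence "real n \<le> real k * real (n div k) + real k" by (simp flip: of_nat_mult of_nat_add)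
    hence "real n / real k - 1 \<le> real (n div k)" using assms by (simp add: field_simps)
    hence "(real n / real k - 1) / real n \<le> real (n div k) / real n" by (rule divide_right_mono) simp
    thus ?case using elim by (simp add: diff_divide_distrib)
  qed
  show "\<forall>\<^sub>F n in sequentially. real (n div k) / real n \<le> 1 / real k"
    using eventually_gt_at_top[of 0]
  proof eventually_elim
    case (elim n)
    have "k * (n div k) \<le> n" by simp
    hence "real k * real (n div k) \<le> real n" by (simp flip: of_nat_mult)
    thus ?case using elim assms by (simp add: field_simps)
  qed
qed simp

text \<open>
  The parts \<open>\<lfloor>n/2\<rfloor>\<close>, \<open>\<lfloor>n/4\<rfloor>\<close> and the rest give the lower bound; the flag inequality with unit
  weights gives the upper one.
\<close>

lemma max_density_limit: "max_density F28 \<longlonglongrightarrow> 15 / 64"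
proof -
  define V :: "nat \<Rightarrow> nat \<Rightarrow> nat set" where
    "V n i = (if i = 0 then {..<n div 2} else if i = 1 then {n div 2..<n div 2 + n div 4} else {n div 2 + n div 4..<n})" for n i
  have le: "n div 2 + n div 4 \<le> n" for n :: nat by linarith
  have parts: "blowup_parts B28 (V n)" for n
    unfolding blowup_parts_def disjoint_family_on_def V_def verts_B28 by auto
  have card: "card (verts (blowup B28 (V n))) = n" for n
  proof -
    have "verts (blowup B28 (V n)) = V n 0 \<union> V n 1 \<union> V n 2"
      by (auto simp: blowup_def verts_B28 numeral_3_eq_3 less_Suc_eq numeral_2_eq_2)
    also have "\<dots> = {..<n}" using le[of n] by (auto simp: V_def)
    finally show ?thesis by simp
  qed
  have simple: "simple_graph (blowup B28 (V n))" for n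
  proof -
    obtain \<kappa> where "blowup B28 (V n) = class_graph (\<Union>i\<in>{..<3}. V n i) \<kappa>" using blowup_classes[OF parts] by metis
    thus ?thesis using parts[of n] by (auto simp: blowup_parts_def verts_B28 intro: simple_class_graph)
  qed
  have "(\<lambda>n. 1 - real (n div 2) / real n - real (n div 4) / real n) \<longlonglongrightarrow> 1 - 1 / real 2 - 1 / real 4"
    by (intro tendsto_intros div_ratio_limit) simp_all
  moreover have "\<forall>\<^sub>F n in sequentially. 1 - real (n div 2) / real n - real (n div 4) / real n = real (card (V n 2)) / real n"
    using eventually_gt_at_top[of 0]
  proof eventually_elim
    case (elim n)
    have "real (card (V n 2)) = real n - (real (n div 2) + real (n div 4))"
      using le[of n] by (simp add: V_def of_nat_diff)
    thus ?case using elim by (simp add: diff_divide_distrib add_divide_distrib)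
  qed
  ultimately have lim2: "(\<lambda>n. real (card (V n 2)) / real n) \<longlonglongrightarrow> 1 / 4"
    using Lim_transform_eventually by fastforce
  have lim: "(\<lambda>n. real (card (V n i)) / real n) \<longlonglongrightarrow> [1 / 2, 1 / 4, 1 / 4] ! i" if "i < 3" for i
  proof -
    have "i = 0 \<or> i = 1 \<or> i = 2" using that by auto
    thus ?thesis using lim2 div_ratio_limit[of 2] div_ratio_limit[of 4] by (elim disjE) (simp_all add: V_def)
  qed
  have "(\<lambda>n. ind_density F28 (blowup B28 (V n))) \<longlonglongrightarrow> 60 * lagrangian ([1 / 2, 1 / 4, 1 / 4] ! 0) ([1 / 2, 1 / 4, 1 / 4] ! 1) ([1 / 2, 1 / 4, 1 / 4] ! 2)"
    by (rule blowup_limit[OF parts lim]) simp_all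
  hence low: "(\<lambda>n. ind_density F28 (blowup B28 (V n))) \<longlonglongrightarrow> 15 / 64"
    by (simp add: lagrangian_def power_divide)
  have up: "(\<lambda>n. 1 / 256 / (12 * real (n choose 6) / real n ^ 6)) \<longlonglongrightarrow> 15 / 64"
    using tendsto_divide[OF tendsto_const choose6_limit, of "1 / 256"] by simp
  show ?thesis
  proof (rule tendsto_sandwich[OF _ _ low up])
    show "\<forall>\<^sub>F n in sequentially. ind_density F28 (blowup B28 (V n)) \<le> max_density F28 n"
      using max_density_ge[OF simple] by (simp add: card)
    show "\<forall>\<^sub>F n in sequentially. max_density F28 n \<le> 1 / 256 / (12 * real (n choose 6) / real n ^ 6)"
    proof (rule always_eventually, rule allI)
      fix n
      obtain H :: "nat pattern" where H: "simple_graph H" "card (verts H) = n" "max_density F28 n = ind_density F28 H"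
        by (rule max_density_attained)
      have "ind_density F28 H \<le> (real n ^ 6 / 256) / (12 * real (n choose 6))"
        unfolding ind_density_F28[OF H(1)] H(2) of_nat_mult of_nat_numeral
        using card_copies_le[OF H(1), unfolded H(2)] by (intro divide_right_mono) simp_all
      thus "max_density F28 n \<le> 1 / 256 / (12 * real (n choose 6) / real n ^ 6)" using H(3) by simp
    qed
  qed
qed

text \<open>
  Among all part assignments take one with the fewest wrong pairs. The assignment found by
  averaging shows that this number is at most \<open>n\<^sup>2 / 10\<^sup>4\<^sup>3\<close>, so the blowup on these parts
  still has almost the optimal number of copies and its parts have nearly optimal sizes. The
  gain of the blowup over \<open>G\<close> then bounds the number of wrong pairs.
\<close>

lemma edit_distance_near_optimal:
  fixes G :: "nat pattern"
  assumes G: "simple_graph G" and n: "real (card (verts G)) \<ge> 10 ^ 18"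
    and many: "(1 / 256 - 1 / 10 ^ 50) * real (card (verts G)) ^ 6 \<le> real (card (copies G))"
  shows "real (edit_distance G B28) \<le> 10 ^ 14 * (max_density F28 (card (verts G)) - ind_density F28 G) * real (card (verts G)) ^ 2"
proof -
  define V where "V = verts G"
  define N where "N = real (card V)"
  have fin: "finite V" using G by (simp add: simple_graph_def V_def)
  have N: "N \<ge> 10 ^ 18" using n by (simp add: N_def V_def)
  hence N0: "N > 0" by simp
  have ne: "V \<noteq> {}" using N0 by (auto simp: N_def)
  have copies_le: "real (card (copies G)) \<le> tcount V (is_copy (adj G))"
    unfolding V_def card_copies_eq[OF G refl] by (intro tsum_mono) simp_all
  have F: "(1 / 256 - 1 / 10 ^ 50) * real (card V ^ 6) \<le> tcount V (is_copy (adj G))"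
    using many copies_le unfolding V_def of_nat_power by linarith
  obtain \<kappa>0 where \<kappa>0: "\<And>v. \<kappa>0 v < 3" "card (wrong V (adj G) \<kappa>0) \<le> 10 ^ 7 * (1 / 10 ^ 50) * N ^ 2"
  proof (rule near_extremal_classes[OF fin ne adj_sym _ _ F])
    fix \<kappa> :: "nat \<Rightarrow> nat"
    assume "\<And>v. \<kappa> v < 3" "card (wrong V (adj G) \<kappa>) \<le> 10 ^ 7 * (1 / 10 ^ 50) * (real (card V))\<^sup>2"
    thus thesis using that unfolding N_def by blast
  qed simp_all
  obtain \<kappa> where \<kappa>: "\<forall>v. \<kappa> v < 3" and least: "\<And>\<kappa>'. \<forall>v. \<kappa>' v < 3 \<Longrightarrow> card (wrong V (adj G) \<kappa>) \<le> card (wrong V (adj G) \<kappa>')"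
    using ex_has_least_nat[of "\<lambda>\<kappa>. \<forall>v. \<kappa> v < 3" \<kappa>0 "\<lambda>\<kappa>. card (wrong V (adj G) \<kappa>)"] \<kappa>0(1) by blast
  define A where "A x y = (if x = y then \<kappa> x = 0 else adj G x y)" for x y
  interpret labelled_graph V A \<kappa>
    by unfold_locales (use fin ne adj_sym[of G] \<kappa> in \<open>auto simp: A_def\<close>)
  have wrong: "wrong V A \<kappa>' = wrong V (adj G) \<kappa>'" for \<kappa>' by (auto simp: wrong_def A_def)
  have W: "card W \<le> 10 ^ 7 * (1 / 10 ^ 50) * N ^ 2"
    using least[of \<kappa>0] \<kappa>0 unfolding wrong by (meson le_trans of_nat_le_iff order_trans)
  have cG: "real (card (copies G)) = tcount V (\<lambda>\<phi>. is_copy A \<phi> \<and> inj_on \<phi> {..<6})"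
    unfolding V_def by (rule card_copies_eq[OF G]) (simp add: A_def)
  have cH: "real (card (copies (class_graph V \<kappa>))) = tcount V (\<lambda>\<phi>. is_copy L \<phi> \<and> inj_on \<phi> {..<6})"
    using card_copies_eq[OF simple_class_graph[OF fin, of \<kappa>], of L] by (simp add: adj_class_graph)
  have WN: "card W * N ^ 4 \<le> N ^ 6 / 10 ^ 43"
  proof -
    have "card W * N ^ 4 \<le> (10 ^ 7 * (1 / 10 ^ 50) * N ^ 2) * N ^ 4" by (rule mult_right_mono[OF W]) simp
    also have "\<dots> = N ^ 6 / 10 ^ 43" by (simp add: eval_nat_numeral)
    finally show ?thesis .
  qed
  have "(1 / 256 - 1 / 10 ^ 40) * N ^ 6 \<le> tcount V (is_copy L)"
  proof -
    have "tcount V (\<lambda>\<phi>. is_copy A \<phi> \<and> inj_on \<phi> {..<6}) \<le> tcount V (is_copy A)" by (intro tsum_mono) simp_all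
    hence "(1 / 256 - 1 / 10 ^ 50) * N ^ 6 - 15 * (N ^ 6 / 10 ^ 43) \<le> tcount V (is_copy L)"
      using linked_count_ge many cG WN unfolding N_def V_def by linarith
    moreover have "(1 / 256 - 1 / 10 ^ 40) * N ^ 6 \<le> (1 / 256 - 1 / 10 ^ 50 - 15 / 10 ^ 43) * N ^ 6"
      by (intro mult_right_mono) simp_all
    moreover have "(1 / 256 - 1 / 10 ^ 50 - 15 / 10 ^ 43) * N ^ 6 = (1 / 256 - 1 / 10 ^ 50) * N ^ 6 - 15 * (N ^ 6 / 10 ^ 43)"
      by (simp add: algebra_simps)
    ultimately show ?thesis by linarith
  qed
  note close = near_optimal_close[OF this[unfolded N_def]]
  have "10 ^ 7 * (1 / 10 ^ 50) * N ^ 2 \<le> N ^ 2 / 10 ^ 8" by simp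
  hence few: "card W \<le> N ^ 2 / 10 ^ 8" using W by linarith
  have gain: "real (card (copies G)) + card W * N ^ 4 / 10 ^ 14 \<le> real (card (copies (class_graph V \<kappa>)))"
    unfolding cG cH N_def
  proof (rule blowup_count_ge[OF _ close])
    show "card W \<le> card (wrong V A (\<kappa>(x := i)))" if "i < 3" for x i
      unfolding wrong by (rule least) (use \<kappa> that in simp)
    show "card W \<le> real (card V) ^ 2 / 10 ^ 8" using few by (simp add: N_def)
    show "10 ^ 18 \<le> real (card V)" using N by (simp add: N_def)
  qed
  define D where "D = 12 * real (card V choose 6)"
  have D0: "D > 0"
  proof -
    have "6 \<le> card V" using N by (simp add: N_def)
    thus ?thesis by (simp add: D_def)
  qed
  have DN: "D \<le> N ^ 6 / 60" using choose6_le by (simp add: D_def N_def)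
  define \<Delta> where "\<Delta> = max_density F28 (card V) - ind_density F28 G"
  have dens: "ind_density F28 (class_graph V \<kappa>) = card (copies (class_graph V \<kappa>)) / D" "ind_density F28 G = card (copies G) / D"
    unfolding ind_density_F28[OF G] ind_density_F28[OF simple_class_graph[OF fin]] by (simp_all add: D_def V_def)
  have "ind_density F28 (class_graph V \<kappa>) \<le> max_density F28 (card V)"
    using max_density_ge[OF simple_class_graph[OF fin, of \<kappa>]] by simp
  hence "real (card (copies (class_graph V \<kappa>))) / D - real (card (copies G)) / D \<le> \<Delta>"
    unfolding \<Delta>_def dens by simp
  hence "real (card (copies (class_graph V \<kappa>))) - real (card (copies G)) \<le> \<Delta> * D"
    using D0 by (simp add: diff_divide_distrib[symmetric] pos_divide_le_eq)
  hence gain': "card W * N ^ 4 / 10 ^ 14 \<le> \<Delta> * D" using gain by linarith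
  have \<Delta>0: "\<Delta> \<ge> 0" using max_density_ge[OF G] by (simp add: \<Delta>_def V_def)
  have "\<Delta> * D \<le> \<Delta> * N ^ 6"
  proof (rule mult_left_mono[OF _ \<Delta>0])
    show "D \<le> N ^ 6" using DN N0 zero_le_power[of N 6] by linarith
  qed
  hence "card W * N ^ 4 \<le> (10 ^ 14 * \<Delta> * N ^ 2) * N ^ 4" using gain' by (simp add: eval_nat_numeral)
  hence "card W \<le> 10 ^ 14 * \<Delta> * N ^ 2" using N0 by (simp only: mult_le_cancel_right_pos zero_less_power)
  moreover have "edit_distance G B28 \<le> card W"
    unfolding wrong using edit_distance_le[OF G, of \<kappa>] \<kappa> by (simp add: V_def)
  ultimately show ?thesis unfolding \<Delta>_def N_def V_def by linarith
qed

text \<open>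
  If the density deficit is at least \<open>10\<^sup>-\<^sup>5\<^sup>0\<close>, the trivial bound \<open>n\<^sup>2\<close> on the edit distance
  suffices. Otherwise, for large \<open>n\<close>, the graph has nearly \<open>n\<^sup>6 / 256\<close> copies and the previous
  lemma applies.
\<close>

lemma perfectly_stable_F28: "perfectly_stable F28 B28"
proof -
  define e :: real where "e = 1 / 10 ^ 50"
  have "\<forall>\<^sub>F n in sequentially. 15 / 64 - e < max_density F28 n"
    using max_density_limit by (rule order_tendstoD) (simp add: e_def)
  moreover have "\<forall>\<^sub>F n in sequentially. 1 / 60 - e < 12 * real (n choose 6) / real n ^ 6"
    using choose6_limit by (rule order_tendstoD) (simp add: e_def)
  ultimately have "\<forall>\<^sub>F n in sequentially. 15 / 64 - e < max_density F28 n \<and> 1 / 60 - e < 12 * real (n choose 6) / real n ^ 6"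
    by (rule eventually_conj)
  then obtain N where N: "\<And>n. n \<ge> N \<Longrightarrow> 15 / 64 - e < max_density F28 n"
    "\<And>n. n \<ge> N \<Longrightarrow> 1 / 60 - e < 12 * real (n choose 6) / real n ^ 6"
    unfolding eventually_sequentially by blast
  define C where "C = 10 ^ 50 + real N"
  have bound: "real (edit_distance G B28) \<le> C * (max_density F28 (card (verts G)) - ind_density F28 G) * real (card (verts G)) ^ 2"
    if G: "simple_graph G" and nC: "real (card (verts G)) \<ge> C" for G :: "nat pattern"
  proof -
    define n where "n = card (verts G)"
    define \<Delta> where "\<Delta> = max_density F28 n - ind_density F28 G"
    have \<Delta>0: "\<Delta> \<ge> 0" using max_density_ge[OF G] by (simp add: \<Delta>_def n_def)
    have n: "n \<ge> N" "real n \<ge> 10 ^ 50" using nC by (simp_all add: C_def n_def)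
    have C: "10 ^ 50 \<le> C" "10 ^ 14 \<le> C" by (simp_all add: C_def)
    show ?thesis
    proof (cases "e \<le> \<Delta>")
      case True
      have "edit_distance G B28 \<le> card (wrong (verts G) (adj G) (\<lambda>_. 0))"
        by (rule edit_distance_le[OF G]) simp
      also have "\<dots> \<le> card (verts G \<times> verts G)"
        using G by (intro card_mono wrong_subset) (simp add: simple_graph_def)
      finally have "real (edit_distance G B28) \<le> real n ^ 2"
        by (simp add: card_cartesian_product n_def power2_eq_square flip: of_nat_mult)
      also have "1 \<le> C * \<Delta>"
        using mult_mono[OF C(1) True] C(1) by (simp add: e_def)
      hence "1 * real n ^ 2 \<le> C * \<Delta> * real n ^ 2" by (rule mult_right_mono) simp
      finally show ?thesis by (simp add: \<Delta>_def n_def)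
    next
      case False
      hence ind: "15 / 64 - 2 * e \<le> ind_density F28 G" using N(1)[OF n(1)] by (simp add: \<Delta>_def)
      have b: "(1 / 60 - e) * real n ^ 6 \<le> 12 * real (n choose 6)"
        using N(2)[OF n(1)] n(2) by (simp add: pos_less_divide_eq)
      have "(1 / 256 - 1 / 10 ^ 50) * real n ^ 6 \<le> (15 / 64 - 2 * e) * ((1 / 60 - e) * real n ^ 6)"
      proof -
        have "1 / 256 - 1 / 10 ^ 50 \<le> (15 / 64 - 2 * e) * (1 / 60 - e)" by (simp add: e_def)
        thus ?thesis unfolding mult.assoc[symmetric] by (rule mult_right_mono) simp
      qed
      also have "\<dots> \<le> ind_density F28 G * (12 * real (n choose 6))"
      proof (rule mult_mono[OF ind b])
        show "0 \<le> ind_density F28 G" by (simp add: ind_density_def)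
        show "0 \<le> (1 / 60 - e) * real n ^ 6" by (simp add: e_def)
      qed
      also have "\<dots> = real (card (copies G))"
      proof -
        have "6 \<le> n" using n(2) by simp
        thus ?thesis unfolding ind_density_F28[OF G] by (simp add: n_def)
      qed
      finally have "(1 / 256 - 1 / 10 ^ 50) * real n ^ 6 \<le> real (card (copies G))" .
      hence "real (edit_distance G B28) \<le> 10 ^ 14 * \<Delta> * real n ^ 2"
        using edit_distance_near_optimal[OF G] n(2) unfolding \<Delta>_def n_def by simp
      also have "\<dots> \<le> C * \<Delta> * real n ^ 2"
        using C(2) \<Delta>0 by (intro mult_right_mono) simp_all
      finally show ?thesis by (simp add: \<Delta>_def n_def)
    qed
  qed
  have "C > 0" by (simp add: C_def add_pos_nonneg)
  thus ?thesis unfolding perfectly_stable_def using bound by blast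
qed

lemma opt_in_simplex: "[1/2, 1/4, 1/4] \<in> std_simplex 3"
  by (auto simp: std_simplex_def numeral_3_eq_3 less_Suc_eq)

lemma simplex3E:
  assumes "x \<in> std_simplex 3"
  shows "0 \<le> x ! 0" "0 \<le> x ! 1" "0 \<le> x ! 2" "x ! 0 + x ! 1 + x ! 2 = 1"
  using assms by (auto simp: std_simplex_def numeral_3_eq_3 numeral_2_eq_2)

lemma blowup_density_le:
  assumes "x \<in> std_simplex 3"
  shows "blowup_density F28 B28 x \<le> 15 / 64"
  using lagrangian_le[OF simplex3E[OF assms]] unfolding blowup_density_F28[OF assms] lagrangian_def by simp

lemma blowup_density_opt: "blowup_density F28 B28 [1/2, 1/4, 1/4] = 15 / 64"
  unfolding blowup_density_F28[OF opt_in_simplex] lagrangian_def by (simp add: power_divide)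

theorem theorem3p13:
  "max_density F28 \<longlonglongrightarrow> 15 / 64 \<and>
   perfectly_stable F28 B28 \<and>
   is_arg_max (blowup_density F28 B28) (\<lambda>x. x \<in> std_simplex 3) [1/2, 1/4, 1/4] \<and>
   (\<forall>x. is_arg_max (blowup_density F28 B28) (\<lambda>y. y \<in> std_simplex 3) x \<longrightarrow>
      (\<exists>\<sigma>. automorphism B28 \<sigma> \<and> (\<forall>i<3. x ! i = [1/2, 1/4, 1/4] ! \<sigma> i)))"
proof (intro conjI allI impI)
  show "max_density F28 \<longlonglongrightarrow> 15 / 64" by (rule max_density_limit)
  show "perfectly_stable F28 B28" by (rule perfectly_stable_F28)
  show "is_arg_max (blowup_density F28 B28) (\<lambda>x. x \<in> std_simplex 3) [1/2, 1/4, 1/4]"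
    unfolding is_arg_max_def blowup_density_opt using opt_in_simplex blowup_density_le by (auto simp: not_less)
  fix x assume "is_arg_max (blowup_density F28 B28) (\<lambda>y. y \<in> std_simplex 3) x"
  hence x: "x \<in> std_simplex 3" and "\<not> blowup_density F28 B28 x < 15 / 64"
    using opt_in_simplex blowup_density_opt unfolding is_arg_max_def by auto
  hence "1 / 256 - 0 \<le> (x ! 0) ^ 3 * (x ! 1 * (x ! 2) ^ 2 + x ! 2 * (x ! 1) ^ 2)"
    unfolding blowup_density_F28[OF x] lagrangian_def by simp
  note st = lagrangian_stable[OF simplex3E[OF x] _ _ this]
  have "(x ! 0 - 1 / 2)\<^sup>2 \<le> 64 * 0" "(x ! 1 - x ! 2)\<^sup>2 \<le> 512 * 0" by (rule st; simp)+
  hence "x ! 0 = 1 / 2" "x ! 1 = x ! 2" by simp_all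
  hence eq: "x ! 0 = 1 / 2" "x ! 1 = 1 / 4" "x ! 2 = 1 / 4" using simplex3E(4)[OF x] by simp_all
  show "\<exists>\<sigma>. automorphism B28 \<sigma> \<and> (\<forall>i<3. x ! i = [1/2, 1/4, 1/4] ! \<sigma> i)"
  proof (intro exI[of _ id] conjI allI impI)
    show "automorphism B28 id" by (simp add: isomorphism_def)
    fix i :: nat assume "i < 3"
    hence "i = 0 \<or> i = 1 \<or> i = 2" by auto
    thus "x ! i = [1/2, 1/4, 1/4] ! id i" using eq by auto
  qed
qed

end
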